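(* Let $X$ be a locally finite $\tilde A_2$-building. Then $\ell^p H^1(X)=0$ for every $1<p<\infty$.
   Context: A projective plane consists of a set of points, a set of lines and an incidence relation such that any two distinct points are incident with a unique common line, any two distinct lines are incident with a unique common point, there are at least two lines, and every line is incident with at least three points. Its incidence graph has the points and lines as vertices and the incident pairs as edges. An $\tilde A_2$-building $X$ is a simply connected $2$-dimensional simplicial complex in which the link of every vertex is the incidence graph of a projective plane, equipped with a type map from the vertices to $\mathbb{Z}/3\mathbb{Z}$ taking different values on adjacent vertices. Let $V$ and $E$ be the sets of vertices and oriented edges of $X$; let $\ell^0(V)$ be the space of all functions $V\to\mathbb{C}$ and $\ell^0(E)$ the space of functions $E\to\mathbb{C}$ that change sign when the orientation of an edge is reversed; $\ell^p(V)$, $\ell^p(E)$ are the subspaces of $p$-summable functions. Let $\delta:\ell^0(V)\to\ell^0(E)$ be $\delta f(e)=f(e^+)-f(e^-)$, where $e^-$ and $e^+$ are the origin and the end of $e$. The first $\ell^p$-cohomology of $X$ is $$\ell^pH^1(X)=\big(\delta(\ell^0(V))\cap\ell^p(E)\big)/\delta(\ell^p(V)).$$ *)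

theory Defs
  imports "HOL-Analysis.Analysis"
begin

section \<open>Abstract simplicial complexes\<close>

text \<open>
  A complex is given by its set of nonempty simplices. The library notion
  \<^const>\<open>simplicial_complex\<close> is about finite complexes in a Euclidean space, so it does
  not apply here.
\<close>

definition abstract_simplicial_complex :: "'a set set \<Rightarrow> bool" where
  "abstract_simplicial_complex X \<longleftrightarrow>
     (\<forall>s\<in>X. finite s \<and> s \<noteq> {}) \<and> (\<forall>s\<in>X. \<forall>t. t \<subseteq> s \<and> t \<noteq> {} \<longrightarrow> t \<in> X)"

definition vertices :: "'a set set \<Rightarrow> 'a set" where
  "vertices X = \<Union>X"

definition oriented_edges :: "'a set set \<Rightarrow> ('a \<times> 'a) set" where
  "oriented_edges X = {(x, y). x \<noteq> y \<and> {x, y} \<in> X}"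

definition two_dimensional :: "'a set set \<Rightarrow> bool" where
  "two_dimensional X \<longleftrightarrow> (\<forall>s\<in>X. card s \<le> 3) \<and> (\<exists>s\<in>X. card s = 3)"

definition locally_finite :: "'a set set \<Rightarrow> bool" where
  "locally_finite X \<longleftrightarrow> (\<forall>v\<in>vertices X. finite {s\<in>X. v \<in> s})"

definition link :: "'a set set \<Rightarrow> 'a \<Rightarrow> 'a set set" where
  "link X v = {s. s \<noteq> {} \<and> v \<notin> s \<and> insert v s \<in> X}"

definition simplicial_isomorphism ::
    "('a \<Rightarrow> 'b) \<Rightarrow> 'a set set \<Rightarrow> 'b set set \<Rightarrow> bool" where
  "simplicial_isomorphism f X Y \<longleftrightarrow> inj_on f (vertices X) \<and> (\<lambda>s. f ` s) ` X = Y"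

text \<open>
  Points of the geometric realization are given by their barycentric coordinates, with the
  topology of pointwise convergence (the topology of the function type). Since the coordinates
  are nonnegative with sum 1, this is the topology of the \<open>\<ell>\<^sup>1\<close> metric. It agrees with the weak
  topology if the complex is locally finite, and has the same homotopy type in general.
\<close>

definition geometric_realization :: "'a set set \<Rightarrow> ('a \<Rightarrow> real) set" where
  "geometric_realization X =
     {t. (\<forall>v. 0 \<le> t v) \<and> {v. t v \<noteq> 0} \<in> X \<and> (\<Sum>v | t v \<noteq> 0. t v) = 1}"

section \<open>Projective planes\<close>

locale projective_plane =
  fixes P :: "'p set" and L :: "'l set" and incident :: "'p \<Rightarrow> 'l \<Rightarrow> bool"
  assumes unique_line:
      "\<lbrakk>p \<in> P; q \<in> P; p \<noteq> q\<rbrakk> \<Longrightarrow> \<exists>!l. l \<in> L \<and> incident p l \<and> incident q l"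
    and unique_point:
      "\<lbrakk>l \<in> L; m \<in> L; l \<noteq> m\<rbrakk> \<Longrightarrow> \<exists>!p. p \<in> P \<and> incident p l \<and> incident p m"
    and two_lines: "\<exists>l\<in>L. \<exists>m\<in>L. l \<noteq> m"
    and three_points:
      "l \<in> L \<Longrightarrow> \<exists>p\<in>P. \<exists>q\<in>P. \<exists>r\<in>P. p \<noteq> q \<and> q \<noteq> r \<and> p \<noteq> r \<and>
         incident p l \<and> incident q l \<and> incident r l"

text \<open>The incidence graph, as a simplicial complex of dimension 1.\<close>

definition incidence_graph ::
    "'p set \<Rightarrow> 'l set \<Rightarrow> ('p \<Rightarrow> 'l \<Rightarrow> bool) \<Rightarrow> ('p + 'l) set set" where
  "incidence_graph P L incident =
     {{v} | v. v \<in> P <+> L} \<union> {{Inl p, Inr l} | p l. p \<in> P \<and> l \<in> L \<and> incident p l}"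

section \<open>Buildings of type \<open>\<tilde>A\<^sub>2\<close>\<close>

text \<open>
  The type \<^typ>\<open>3\<close> is the ring of integers modulo 3. In the condition on links, it is no
  restriction to take points and lines in the type of the vertices of \<open>X\<close>, since every plane
  whose incidence graph is isomorphic to a link of \<open>X\<close> has a copy there.
\<close>

locale A2_tilde_building =
  fixes X :: "'a set set" and vtype :: "'a \<Rightarrow> 3"
  assumes complex: "abstract_simplicial_complex X"
    and dimension: "two_dimensional X"
    and simply_connected: "simply_connected (geometric_realization X)"
    and links: "v \<in> vertices X \<Longrightarrow>
      \<exists>(P :: 'a set) (L :: 'a set) incident f.
        projective_plane P L incident \<and>
        simplicial_isomorphism f (link X v) (incidence_graph P L incident)"
    and vtype_adjacent: "(x, y) \<in> oriented_edges X \<Longrightarrow> vtype x \<noteq> vtype y"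

section \<open>First \<open>\<ell>\<^sup>p\<close>-cohomology\<close>

text \<open>
  Functions on the set of vertices or of oriented edges are represented by functions on the whole
  type that vanish outside this set. An oriented edge \<open>(x, y)\<close> has origin \<open>x\<close> and end \<open>y\<close>.
\<close>

definition l0_vertices :: "'a set set \<Rightarrow> ('a \<Rightarrow> complex) set" where
  "l0_vertices X = {f. \<forall>v. v \<notin> vertices X \<longrightarrow> f v = 0}"

definition l0_edges :: "'a set set \<Rightarrow> ('a \<times> 'a \<Rightarrow> complex) set" where
  "l0_edges X = {\<omega>. (\<forall>e. e \<notin> oriented_edges X \<longrightarrow> \<omega> e = 0) \<and>
                     (\<forall>(x, y)\<in>oriented_edges X. \<omega> (y, x) = - \<omega> (x, y))}"

definition lp_vertices :: "real \<Rightarrow> 'a set set \<Rightarrow> ('a \<Rightarrow> complex) set" where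
  "lp_vertices p X =
     {f \<in> l0_vertices X. (\<lambda>v. norm (f v) powr p) summable_on vertices X}"

definition lp_edges :: "real \<Rightarrow> 'a set set \<Rightarrow> ('a \<times> 'a \<Rightarrow> complex) set" where
  "lp_edges p X =
     {\<omega> \<in> l0_edges X. (\<lambda>e. norm (\<omega> e) powr p) summable_on oriented_edges X}"

definition coboundary :: "'a set set \<Rightarrow> ('a \<Rightarrow> complex) \<Rightarrow> 'a \<times> 'a \<Rightarrow> complex" where
  "coboundary X f = (\<lambda>e. if e \<in> oriented_edges X then f (snd e) - f (fst e) else 0)"

definition lp_Z1 :: "real \<Rightarrow> 'a set set \<Rightarrow> ('a \<times> 'a \<Rightarrow> complex) set" where
  "lp_Z1 p X = coboundary X ` l0_vertices X \<inter> lp_edges p X"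

definition lp_B1 :: "real \<Rightarrow> 'a set set \<Rightarrow> ('a \<times> 'a \<Rightarrow> complex) set" where
  "lp_B1 p X = coboundary X ` lp_vertices p X"

text \<open>
  The elements of the quotient space are the cosets of \<^term>\<open>lp_B1 p X\<close> in \<^term>\<open>lp_Z1 p X\<close>. Its
  zero element is the coset \<^term>\<open>lp_B1 p X\<close>, so the quotient is zero if and only if it is equal
  to \<^term>\<open>{lp_B1 p X}\<close>.
\<close>

definition lp_H1 :: "real \<Rightarrow> 'a set set \<Rightarrow> ('a \<times> 'a \<Rightarrow> complex) set set" where
  "lp_H1 p X = lp_Z1 p X // {(\<omega>, \<eta>). \<omega> \<in> lp_Z1 p X \<and> \<eta> \<in> lp_Z1 p X \<and> \<omega> - \<eta> \<in> lp_B1 p X}"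

end

theory Submission
  imports Defs
begin

text \<open>
  Only the connectedness of \<open>X\<close> and its local structure are used. On the typed, cyclically ordered
  triangles, averaging over one of the three positions gives operators \<open>T i\<close> which, together with
  the rotation, satisfy the relations of the affine Hecke algebra, because the links are
  projective planes. The spectral gap of the links yields a spectral gap on \<open>\<ell>\<^sup>2\<close> (Garland's method), so
  products of the three \<open>T i\<close> are strict contractions of \<open>\<ell>\<^sup>2\<close>, hence of \<open>\<ell>\<^sup>p\<close> for \<open>1 < p\<close>, if \<open>X\<close>
  is infinite. The cubes of the translations \<open>\<tau>1\<close> and \<open>\<tau>2\<close> are such products. If \<open>f\<close> has a \<open>p\<close>-summable
  coboundary, then \<open>f\<close>, as a function \<open>v\<close> of the first vertex of a triangle, is almost invariant under
  all operators, up to \<open>\<ell>\<^sup>p\<close>; so a Neumann series corrects it by an element of \<open>\<ell>\<^sup>p\<close> to a function \<open>g\<close>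
  fixed by the cube of \<open>\<tau>1\<close>. A contraction has no other fixed point in \<open>\<ell>\<^sup>p\<close> than \<open>0\<close>, so every relation
  which holds for \<open>g\<close> up to \<open>\<ell>\<^sup>p\<close>, and whose two sides are fixed as well, holds exactly. This makes \<open>g\<close>
  invariant under \<open>T 1\<close>, then under \<open>T 2\<close> and finally under \<open>T 0\<close>, so \<open>g\<close> depends only on the type,
  and \<open>f\<close> differs from a constant by an element of \<open>\<ell>\<^sup>p\<close>.
\<close>

section \<open>Flags of a finite projective plane\<close>

text \<open>A single \<open>T i\<close> is no strict contraction, since it fixes every function that
  does not depend on position i; norm is lost only when all three positions take part. This is why
  the translations are cubed: \<open>\<tau>1\<close> contains \<open>T 1\<close>, \<open>T 2\<close>
  and a rotation, and moving the rotations through the cube produces the missing \<open>T 0\<close>.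
  The obstacle is exactness, because up to l^p everything is invariant from the start.
  \<open>T 1\<close> commutes with \<open>\<tau>1\<close> and so preserves the fixed space of its
  cube, but for \<open>T 2\<close> this is available only with \<open>\<tau>2\<close>. The bridge is
  the pair \<open>\<tau>1 (\<tau>1 g) = \<tau>2 g\<close> and
  \<open>\<tau>2 (\<tau>2 g) = \<tau>1 g\<close>, which makes g fixed by the cube of
  \<open>\<tau>2\<close> too. For \<open>T 0\<close> neither translation helps; its invariance is
  extracted from the first relation by braid algebra. The gap on l^2 needs no spectral theorem: the
  mean of the three averages is iterated on finitely supported functions. Jensen's and Young's
  inequalities take the place of complex interpolation. Thickness enters as q \<ge> 2: for q = 1 the
  cosine sqrt q / (q + 1) is exactly 1/2 and no gap would follow.\<close>

locale flag_geometry =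
  fixes I :: "('p \<times> 'l) set" and q :: nat
  assumes finite_flags: "finite I"
    and card_points: "(x, y) \<in> I \<Longrightarrow> card {x'. (x', y) \<in> I} = q + 1"
    and card_lines: "(x, y) \<in> I \<Longrightarrow> card {y'. (x, y') \<in> I} = q + 1"
    and meet: "(x, y) \<in> I \<Longrightarrow> (x', y') \<in> I \<Longrightarrow> y \<noteq> y' \<Longrightarrow> \<exists>!a. (a, y) \<in> I \<and> (a, y') \<in> I"
    and join: "(x, y) \<in> I \<Longrightarrow> (x', y') \<in> I \<Longrightarrow> x \<noteq> x' \<Longrightarrow> \<exists>!b. (x, b) \<in> I \<and> (x', b) \<in> I"
begin

definition pts :: "'l \<Rightarrow> 'p set" where "pts y = {x. (x, y) \<in> I}"
definition lns :: "'p \<Rightarrow> 'l set" where "lns x = {y. (x, y) \<in> I}"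
text \<open>Averages over one coordinate of a flag. On the flags around a fixed third vertex of a
  triangle they become \<open>E 0\<close> and \<open>E 1\<close>.\<close>

definition point_avg :: "('p \<times> 'l \<Rightarrow> real) \<Rightarrow> 'l \<Rightarrow> real" where
  "point_avg \<phi> y = (\<Sum>x\<in>pts y. \<phi> (x, y)) / (q + 1)"
definition line_avg :: "('p \<times> 'l \<Rightarrow> real) \<Rightarrow> 'p \<Rightarrow> real" where
  "line_avg \<phi> x = (\<Sum>y\<in>lns x. \<phi> (x, y)) / (q + 1)"

lemma flag_ends: "(x, y) \<in> I \<Longrightarrow> x \<in> fst ` I" "(x, y) \<in> I \<Longrightarrow> y \<in> snd ` I"
  by force+

lemma finite_sets [simp]: "finite (pts y)" "finite (lns x)" "finite (fst ` I)" "finite (snd ` I)"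
proof -
  have "pts y \<subseteq> fst ` I" "lns x \<subseteq> snd ` I"
    by (auto simp: pts_def lns_def intro: flag_ends)
  then show "finite (pts y)" "finite (lns x)" "finite (fst ` I)" "finite (snd ` I)"
    using finite_flags finite_subset by blast+
qed

lemma card_pts: "y \<in> snd ` I \<Longrightarrow> card (pts y) = q + 1"
  using card_points by (auto simp: pts_def)

lemma card_lns: "x \<in> fst ` I \<Longrightarrow> card (lns x) = q + 1"
  using card_lines by (auto simp: lns_def)

lemma sum_flags_by_lines: "(\<Sum>t\<in>I. \<phi> t) = (\<Sum>y\<in>snd ` I. \<Sum>x\<in>pts y. \<phi> (x, y))"
proof -
  have "(\<Sum>y\<in>snd ` I. \<Sum>x\<in>pts y. \<phi> (x, y)) = (\<Sum>(y, x)\<in>(SIGMA y:snd ` I. pts y). \<phi> (x, y))"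
    by (rule sum.Sigma) auto
  also have "\<dots> = (\<Sum>t\<in>I. \<phi> t)"
    by (rule sum.reindex_bij_witness[where i = "\<lambda>(x, y). (y, x)" and j = "\<lambda>(y, x). (x, y)"])
      (auto simp: pts_def intro: flag_ends)
  finally show ?thesis by simp
qed

lemma sum_flags_by_points: "(\<Sum>t\<in>I. \<phi> t) = (\<Sum>x\<in>fst ` I. \<Sum>y\<in>lns x. \<phi> (x, y))"
proof -
  have "(\<Sum>x\<in>fst ` I. \<Sum>y\<in>lns x. \<phi> (x, y)) = (\<Sum>(x, y)\<in>(SIGMA x:fst ` I. lns x). \<phi> (x, y))"
    by (rule sum.Sigma) auto
  also have "(SIGMA x:fst ` I. lns x) = I"
    by (auto simp: lns_def intro: flag_ends)
  finally show ?thesis by simp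
qed

lemma sum_incident_swap:
  assumes "A \<subseteq> fst ` I"
  shows "(\<Sum>x\<in>A. \<Sum>y\<in>lns x. g x y) = (\<Sum>y\<in>snd ` I. \<Sum>x\<in>A \<inter> pts y. g x y)"
proof -
  have "finite A" using assms finite_sets(3) finite_subset by blast
  have "(\<Sum>x\<in>A. \<Sum>y\<in>lns x. g x y) = (\<Sum>x\<in>A. \<Sum>y\<in>{y \<in> snd ` I. (x, y) \<in> I}. g x y)"
    by (intro sum.cong) (auto simp: lns_def intro: flag_ends)
  also have "\<dots> = (\<Sum>y\<in>snd ` I. \<Sum>x\<in>{x \<in> A. (x, y) \<in> I}. g x y)"
    by (rule sum.swap_restrict) (use \<open>finite A\<close> in auto)
  finally show ?thesis by (simp add: pts_def Int_def)
qed

lemma card_common_points: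
  assumes "y \<in> snd ` I" "y' \<in> snd ` I" "y \<noteq> y'"
  shows "card (pts y \<inter> pts y') = 1"
proof -
  obtain x x' where "(x, y) \<in> I" "(x', y') \<in> I" using assms by auto
  from meet[OF this assms(3)] obtain a where "pts y \<inter> pts y' = {a}"
    by (auto simp: pts_def)
  then show ?thesis by simp
qed

text \<open>For the incidence matrix N of points against lines this is "N transposed times N is J +
  q", with J the all-ones matrix: two distinct lines share one point, and a line shares 1 + q points
  with itself.\<close>

lemma sum_two_steps_lines:
  fixes g :: "'l \<Rightarrow> real"
  assumes "y \<in> snd ` I"
  shows "(\<Sum>x\<in>pts y. \<Sum>y'\<in>lns x. g y') = (\<Sum>y'\<in>snd ` I. g y') + q * g y"
proof -
  have "(\<Sum>x\<in>pts y. \<Sum>y'\<in>lns x. g y') = (\<Sum>y'\<in>snd ` I. \<Sum>x\<in>pts y \<inter> pts y'. g y')"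
    by (rule sum_incident_swap) (auto simp: pts_def intro: flag_ends)
  also have "\<dots> = (\<Sum>y'\<in>snd ` I. g y' + (if y' = y then q * g y else 0))"
    using assms card_common_points[OF assms] card_pts[OF assms]
    by (intro sum.cong) (auto simp: algebra_simps)
  finally show ?thesis using assms by (simp add: sum.distrib)
qed

end

lemma (in flag_geometry) dual: "flag_geometry (prod.swap ` I) q"
proof -
  have iff: "(y, x) \<in> prod.swap ` I \<longleftrightarrow> (x, y) \<in> I" for x y by force
  show ?thesis
    by unfold_locales (use finite_flags card_points card_lines meet join in \<open>auto simp: iff\<close>)
qed

context flag_geometry
begin

lemma sum_two_steps_points:
  fixes g :: "'p \<Rightarrow> real"
  assumes "x \<in> fst ` I"
  shows "(\<Sum>y\<in>lns x. \<Sum>x'\<in>pts y. g x') = (\<Sum>x'\<in>fst ` I. g x') + q * g x"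
proof -
  interpret d: flag_geometry "prod.swap ` I" q by (rule dual)
  have "d.pts = lns" "d.lns = pts"
    by (force simp: d.pts_def d.lns_def pts_def lns_def fun_eq_iff)+
  then show ?thesis
    using d.sum_two_steps_lines[of x g] assms by (simp add: image_image)
qed

text \<open>The right-hand side is a multiple of the total sum plus a multiple of a single average.
  The total is the same in the dual formula below, which is the source of the braid
  relation.\<close>

lemma point_line_point_avg:
  assumes "y \<in> snd ` I"
  shows "(\<Sum>x\<in>pts y. line_avg (\<lambda>(x, y). point_avg \<phi> y) x) / (q + 1)
    = (\<Sum>t\<in>I. \<phi> t) / (1 + real q) ^ 3 + q / (1 + real q)\<^sup>2 * point_avg \<phi> y"
proof -
  have "(\<Sum>x\<in>pts y. line_avg (\<lambda>(x, y). point_avg \<phi> y) x)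
      = (\<Sum>x\<in>pts y. \<Sum>y'\<in>lns x. point_avg \<phi> y') / (q + 1)"
    by (simp add: line_avg_def sum_divide_distrib)
  also have "(\<Sum>x\<in>pts y. \<Sum>y'\<in>lns x. point_avg \<phi> y')
     = (\<Sum>y'\<in>snd ` I. point_avg \<phi> y') + q * point_avg \<phi> y"
    by (rule sum_two_steps_lines[OF assms])
  also have "(\<Sum>y'\<in>snd ` I. point_avg \<phi> y') = (\<Sum>t\<in>I. \<phi> t) / (q + 1)"
    by (simp add: point_avg_def sum_flags_by_lines sum_divide_distrib)
  finally show ?thesis
    by (simp add: add_divide_distrib power2_eq_square power3_eq_cube mult.assoc)
qed

lemma line_point_line_avg:
  assumes "x \<in> fst ` I"
  shows "(\<Sum>y\<in>lns x. point_avg (\<lambda>(x, y). line_avg \<phi> x) y) / (q + 1)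
    = (\<Sum>t\<in>I. \<phi> t) / (1 + real q) ^ 3 + q / (1 + real q)\<^sup>2 * line_avg \<phi> x"
proof -
  have "(\<Sum>y\<in>lns x. point_avg (\<lambda>(x, y). line_avg \<phi> x) y)
      = (\<Sum>y\<in>lns x. \<Sum>x'\<in>pts y. line_avg \<phi> x') / (q + 1)"
    by (simp add: point_avg_def sum_divide_distrib)
  also have "(\<Sum>y\<in>lns x. \<Sum>x'\<in>pts y. line_avg \<phi> x')
     = (\<Sum>x'\<in>fst ` I. line_avg \<phi> x') + q * line_avg \<phi> x"
    by (rule sum_two_steps_points[OF assms])
  also have "(\<Sum>x'\<in>fst ` I. line_avg \<phi> x') = (\<Sum>t\<in>I. \<phi> t) / (q + 1)"
    by (simp add: line_avg_def sum_flags_by_points sum_divide_distrib)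
  finally show ?thesis
    by (simp add: add_divide_distrib power2_eq_square power3_eq_cube mult.assoc)
qed

section \<open>Angle between the two partial averages\<close>

text \<open>On functions of sum zero the all-ones matrix vanishes and only the scalar q remains: the
  incidence matrix stretches every such function by sqrt q.\<close>

lemma sum_square_point_sums:
  fixes b :: "'p \<Rightarrow> real"
  assumes "(\<Sum>x\<in>fst ` I. b x) = 0"
  shows "(\<Sum>y\<in>snd ` I. (\<Sum>x\<in>pts y. b x)\<^sup>2) = q * (\<Sum>x\<in>fst ` I. (b x)\<^sup>2)"
proof -
  have "(\<Sum>y\<in>snd ` I. (\<Sum>x\<in>pts y. b x)\<^sup>2)
      = (\<Sum>y\<in>snd ` I. \<Sum>x\<in>pts y. b x * (\<Sum>x'\<in>pts y. b x'))"
    by (simp add: power2_eq_square sum_distrib_right)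
  also have "\<dots> = (\<Sum>x\<in>fst ` I. \<Sum>y\<in>lns x. b x * (\<Sum>x'\<in>pts y. b x'))"
    using sum_flags_by_points[of "\<lambda>(x, y). b x * (\<Sum>x'\<in>pts y. b x')"]
      sum_flags_by_lines[of "\<lambda>(x, y). b x * (\<Sum>x'\<in>pts y. b x')"] by simp
  also have "\<dots> = (\<Sum>x\<in>fst ` I. b x * (q * b x))"
    using assms by (intro sum.cong) (simp_all add: sum_distrib_left[symmetric] sum_two_steps_points)
  finally show ?thesis by (simp add: sum_distrib_left power2_eq_square mult_ac)
qed

lemma sum_flags_mult_le:
  fixes a :: "'l \<Rightarrow> real" and b :: "'p \<Rightarrow> real"
  assumes "(\<Sum>x\<in>fst ` I. b x) = 0" and "q > 0"
  shows "(\<Sum>(x, y)\<in>I. a y * b x)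
    \<le> sqrt q / 2 / (q + 1) * ((\<Sum>(x, y)\<in>I. (a y)\<^sup>2) + (\<Sum>(x, y)\<in>I. (b x)\<^sup>2))"
proof -
  define r where "r = sqrt q"
  have r: "r > 0" "r * r = q" using assms by (auto simp: r_def)
  \<comment> \<open>The weight sqrt q is chosen so that, once \<open>sum_square_point_sums\<close>
    has contributed its factor q, both sums carry the same factor sqrt q / 2.\<close>
  have young: "u * s \<le> r / 2 * u\<^sup>2 + s\<^sup>2 / (2 * r)" for u s
  proof -
    have "0 \<le> (r * u - s)\<^sup>2 / (2 * r)" using r by simp
    also have "\<dots> = r / 2 * u\<^sup>2 + s\<^sup>2 / (2 * r) - u * s"
      using r by (simp add: power2_eq_square field_simps)
    finally show ?thesis by simp
  qed
  have "(\<Sum>(x, y)\<in>I. a y * b x) = (\<Sum>y\<in>snd ` I. a y * (\<Sum>x\<in>pts y. b x))"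
    by (simp add: sum_flags_by_lines sum_distrib_left)
  also have "\<dots> \<le> (\<Sum>y\<in>snd ` I. r / 2 * (a y)\<^sup>2 + (\<Sum>x\<in>pts y. b x)\<^sup>2 / (2 * r))"
    by (intro sum_mono young)
  also have "\<dots> = r / 2 * (\<Sum>y\<in>snd ` I. (a y)\<^sup>2) + q * (\<Sum>x\<in>fst ` I. (b x)\<^sup>2) / (2 * r)"
    by (simp add: sum.distrib sum_distrib_left sum_divide_distrib[symmetric]
        sum_square_point_sums[OF assms(1)])
  also have "\<dots> = r / 2 * ((\<Sum>y\<in>snd ` I. (a y)\<^sup>2) + (\<Sum>x\<in>fst ` I. (b x)\<^sup>2))"
    using r by (simp add: field_simps flip: r(2))
  also have "(\<Sum>y\<in>snd ` I. (a y)\<^sup>2) = (\<Sum>(x, y)\<in>I. (a y)\<^sup>2) / (q + 1)"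
    by (simp add: sum_flags_by_lines card_pts sum_divide_distrib)
  also have "(\<Sum>x\<in>fst ` I. (b x)\<^sup>2) = (\<Sum>(x, y)\<in>I. (b x)\<^sup>2) / (q + 1)"
    by (simp add: sum_flags_by_points card_lns sum_divide_distrib)
  finally show ?thesis by (simp add: r_def flip: add_divide_distrib)
qed

end

text \<open>The worst case is q = 2 with sqrt 2 / 3, about 0.471; 12/25 is a rational number between
  this and 1/2. The product in the proof is 144 (n + 1)^2 - 625 n - 46.\<close>

lemma sqrt_div_le: 
  assumes "q \<ge> (2::nat)" shows "sqrt q / (1 + real q) \<le> 12 / 25"
proof -
  define n :: real where "n = q"
  have n: "n \<ge> 2" using assms by (simp add: n_def)
  have "0 \<le> (n - 2) * (144 * n - 49)" using n by (intro mult_nonneg_nonneg) auto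
  then have "625 * n \<le> 144 * (n + 1)\<^sup>2"
    by (simp add: power2_eq_square algebra_simps)
  then have "n \<le> (12 / 25 * (n + 1))\<^sup>2" by (simp add: power2_eq_square algebra_simps)
  then have "sqrt n \<le> 12 / 25 * (n + 1)" using n by (intro real_le_lsqrt) auto
  then show ?thesis using n by (simp add: n_def field_simps)
qed

text \<open>Carries an angle bound from the ranges of two orthogonal projections P, Q to their
  kernels. Read N, A, B, C as the square norms of psi, P psi, Q psi and the inner product of P psi
  and Q psi. Then N - A - B + C is the inner product of psi - P psi and psi - Q psi, and the last
  hypothesis says that psi - t (P psi + Q psi) has nonnegative square norm.\<close>

lemma projection_inequality:
  fixes N A B C \<epsilon> :: real
  assumes "0 \<le> \<epsilon>" "\<epsilon> \<le> 1" "2 * C \<le> \<epsilon> * (A + B)"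
    and "\<And>t. 0 \<le> N - 2 * t * (A + B) + t\<^sup>2 * (A + B + 2 * C)"
  shows "0 \<le> 2 * (N - A - B + C) + \<epsilon> * ((N - A) + (N - B))"
proof -
  define D where "D = A + B"
  define u where "u = 1 + \<epsilon>"
  have u: "u > 0" using assms by (simp add: u_def)
  \<comment> \<open>The choice t = 1 / (1 + \<epsilon>) minimizes the quadratic in the extremal case
    2 C = \<epsilon> (A + B).\<close>
  have "0 \<le> u\<^sup>2 * (N - 2 * (1 / u) * (A + B) + (1 / u)\<^sup>2 * (A + B + 2 * C))"
    by (intro mult_nonneg_nonneg assms(4)) auto
  also have "\<dots> = u\<^sup>2 * N - 2 * u * D + (D + 2 * C)"
    using u by (simp add: D_def power2_eq_square field_simps)
  finally have *: "0 \<le> u\<^sup>2 * N - 2 * u * D + (D + 2 * C)" .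
  have "0 \<le> (1 - \<epsilon>) * (\<epsilon> * D - 2 * C)"
    using assms by (intro mult_nonneg_nonneg) (auto simp: D_def)
  with * have "0 \<le> 2 * (u\<^sup>2 * N - 2 * u * D + (D + 2 * C)) + (1 - \<epsilon>) * (\<epsilon> * D - 2 * C)"
    by simp
  also have "\<dots> = (1 + \<epsilon>) * (2 * (N - D + C) + \<epsilon> * (2 * N - D))"
    by (simp add: u_def power2_eq_square algebra_simps)
  finally have "0 \<le> 2 * (N - D + C) + \<epsilon> * (2 * N - D)"
    using assms(1) by (simp add: zero_le_mult_iff)
  then show ?thesis by (simp add: D_def algebra_simps)
qed

context flag_geometry
begin

lemma sum_mult_point_avg:
  "(\<Sum>(x, y)\<in>I. \<psi> (x, y) * g y) = (\<Sum>(x, y)\<in>I. point_avg \<psi> y * g y)"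
  by (simp add: sum_flags_by_lines card_pts point_avg_def flip: sum_distrib_right)

lemma sum_mult_line_avg:
  "(\<Sum>(x, y)\<in>I. \<psi> (x, y) * g x) = (\<Sum>(x, y)\<in>I. line_avg \<psi> x * g x)"
  by (simp add: sum_flags_by_points card_lns line_avg_def flip: sum_distrib_right)

text \<open>
  Here \<open>12/25\<close> bounds \<open>\<surd>q / (q + 1)\<close>, the cosine of the angle between the two partial averages.
  It is less than \<open>1/2\<close>, which is what the local-to-global argument in a triangle requires.
\<close>

lemma deviation_inequality:
  assumes "q \<ge> 2"
  shows "0 \<le> (\<Sum>(x, y)\<in>I. 2 * ((\<psi> (x, y) - point_avg \<psi> y) * (\<psi> (x, y) - line_avg \<psi> x))
    + 12 / 25 * ((\<psi> (x, y) - point_avg \<psi> y)\<^sup>2 + (\<psi> (x, y) - line_avg \<psi> x)\<^sup>2))"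
proof -
  \<comment> \<open>Constants lie in the range of both averages, at angle zero. They do not affect
    deviations, so subtracting the mean leaves the part where the angle bound holds.\<close>
  define m where "m = (\<Sum>t\<in>I. \<psi> t) / card I"
  define \<eta> where "\<eta> t = \<psi> t - m" for t
  define a where "a = point_avg \<eta>"
  define b where "b = line_avg \<eta>"
  have a: "point_avg \<psi> y = a y + m" if "(x, y) \<in> I" for x y
    using card_pts[of y] that
    by (force simp: a_def point_avg_def \<eta>_def sum_subtractf field_simps)
  have b: "line_avg \<psi> x = b x + m" if "(x, y) \<in> I" for x y
    using card_lns[of x] that
    by (force simp: b_def line_avg_def \<eta>_def sum_subtractf field_simps)
  have sum0: "(\<Sum>t\<in>I. \<eta> t) = 0"
    using finite_flags by (cases "I = {}") (auto simp: \<eta>_def m_def sum_subtractf)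
  have b0: "(\<Sum>x\<in>fst ` I. b x) = 0"
    using sum0 by (simp add: b_def line_avg_def sum_flags_by_points flip: sum_divide_distrib)
  define N where "N = (\<Sum>(x, y)\<in>I. (\<eta> (x, y))\<^sup>2)"
  define A where "A = (\<Sum>(x, y)\<in>I. (a y)\<^sup>2)"
  define B where "B = (\<Sum>(x, y)\<in>I. (b x)\<^sup>2)"
  define C where "C = (\<Sum>(x, y)\<in>I. a y * b x)"
  have \<eta>a: "(\<Sum>(x, y)\<in>I. \<eta> (x, y) * a y) = A"
    using sum_mult_point_avg[of \<eta> a] by (simp add: A_def a_def power2_eq_square)
  have \<eta>b: "(\<Sum>(x, y)\<in>I. \<eta> (x, y) * b x) = B"
    using sum_mult_line_avg[of \<eta> b] by (simp add: B_def b_def power2_eq_square)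
  have "A \<ge> 0" "B \<ge> 0" by (auto simp: A_def B_def intro!: sum_nonneg)
  have "C \<le> sqrt q / 2 / (q + 1) * (A + B)"
    unfolding A_def B_def C_def by (rule sum_flags_mult_le[OF b0]) (use assms in simp)
  also have "\<dots> = sqrt q / (1 + real q) * ((A + B) / 2)" by simp
  also have "\<dots> \<le> 12 / 25 * ((A + B) / 2)"
    using \<open>A \<ge> 0\<close> \<open>B \<ge> 0\<close> by (intro mult_right_mono sqrt_div_le assms) auto
  finally have C: "2 * C \<le> 12 / 25 * (A + B)" by simp
  have "0 \<le> N - 2 * t * (A + B) + t\<^sup>2 * (A + B + 2 * C)" for t
  proof -
    have "0 \<le> (\<Sum>(x, y)\<in>I. (\<eta> (x, y) - t * (a y + b x))\<^sup>2)" by (auto intro: sum_nonneg)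
    also have "\<dots> = (\<Sum>(x, y)\<in>I. (\<eta> (x, y))\<^sup>2 - 2 * t * (\<eta> (x, y) * a y + \<eta> (x, y) * b x)
        + t\<^sup>2 * ((a y)\<^sup>2 + (b x)\<^sup>2 + 2 * (a y * b x)))"
      by (intro sum.cong) (auto simp: power2_eq_square algebra_simps)
    also have "\<dots> = N - 2 * t * (A + B) + t\<^sup>2 * (A + B + 2 * C)"
      using \<eta>a \<eta>b
      by (simp add: case_prod_unfold sum.distrib sum_subtractf N_def A_def B_def C_def
          flip: sum_distrib_left)
    finally show ?thesis .
  qed
  define e :: real where "e = 12 / 25"
  have "0 \<le> 2 * (N - A - B + C) + e * ((N - A) + (N - B))"
    using C \<open>\<And>t. 0 \<le> N - 2 * t * (A + B) + t\<^sup>2 * (A + B + 2 * C)\<close>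
    by (intro projection_inequality) (auto simp: e_def)
  also have "\<dots> = (\<Sum>(x, y)\<in>I. 
      2 * ((\<eta> (x, y))\<^sup>2 - \<eta> (x, y) * a y - \<eta> (x, y) * b x + a y * b x)
      + e * (((\<eta> (x, y))\<^sup>2 - 2 * (\<eta> (x, y) * a y) + (a y)\<^sup>2)
      + ((\<eta> (x, y))\<^sup>2 - 2 * (\<eta> (x, y) * b x) + (b x)\<^sup>2)))"
    using \<eta>a \<eta>b
    by (simp add: case_prod_unfold sum.distrib sum_subtractf N_def A_def B_def C_def
        flip: sum_distrib_left)
  also have "\<dots> = (\<Sum>(x, y)\<in>I. 2 * ((\<psi> (x, y) - point_avg \<psi> y) * (\<psi> (x, y) - line_avg \<psi> x))
    + e * ((\<psi> (x, y) - point_avg \<psi> y)\<^sup>2 + (\<psi> (x, y) - line_avg \<psi> x)\<^sup>2))"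
    by (intro sum.cong) (auto simp: a b \<eta>_def power2_eq_square algebra_simps)
  finally show ?thesis by (simp add: e_def)
qed

end

section \<open>Hecke operators on systems of triangles\<close>

text \<open>For fixed z, \<open>meet\<close> and \<open>join\<close> make the pairs (x, y) the flags
  of a projective plane, the link of z. The conditions refer to one position only;
  \<open>rotate\<close> transports them to the other two.\<close>

locale triangle_system =
  fixes \<Delta> :: "('a \<times> 'a \<times> 'a) set" and q :: nat
  assumes rotate: "(x, y, z) \<in> \<Delta> \<Longrightarrow> (y, z, x) \<in> \<Delta>"
    and card_fiber: "(x, y, z) \<in> \<Delta> \<Longrightarrow> card {x'. (x', y, z) \<in> \<Delta>} = q + 1"
    and q_ge_2: "q \<ge> 2"
    and meet: "(x, y, z) \<in> \<Delta> \<Longrightarrow> (x', y', z) \<in> \<Delta> \<Longrightarrow> y \<noteq> y' \<Longrightarrow>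
      \<exists>!a. (a, y, z) \<in> \<Delta> \<and> (a, y', z) \<in> \<Delta>"
    and join: "(x, y, z) \<in> \<Delta> \<Longrightarrow> (x', y', z) \<in> \<Delta> \<Longrightarrow> x \<noteq> x' \<Longrightarrow>
      \<exists>!b. (x, b, z) \<in> \<Delta> \<and> (x', b, z) \<in> \<Delta>"
begin

lemma rotate_iff: "(y, z, x) \<in> \<Delta> \<longleftrightarrow> (x, y, z) \<in> \<Delta>"
  using rotate by blast

definition fiber :: "'a \<Rightarrow> 'a \<Rightarrow> 'a set" where "fiber y z = {x. (x, y, z) \<in> \<Delta>}"
definition flags :: "'a \<Rightarrow> ('a \<times> 'a) set" where "flags z = {(x, y). (x, y, z) \<in> \<Delta>}"

lemma fiber_iff [simp]: "x \<in> fiber y z \<longleftrightarrow> (x, y, z) \<in> \<Delta>"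
  by (simp add: fiber_def)

lemma flags_iff [simp]: "(x, y) \<in> flags z \<longleftrightarrow> (x, y, z) \<in> \<Delta>"
  by (simp add: flags_def)

lemma fiber_rotate: "fiber z x = {y. (x, y, z) \<in> \<Delta>}"
  unfolding fiber_def using rotate by blast

lemma card_fiber': "(x, y, z) \<in> \<Delta> \<Longrightarrow> card (fiber y z) = q + 1"
  using card_fiber by (simp add: fiber_def)

lemma finite_fiber [simp]: "finite (fiber y z)"
proof (cases "fiber y z = {}")
  case False
  then show ?thesis using card_fiber' by (metis card.infinite ex_in_conv fiber_iff add_is_0 one_neq_zero)
qed simp

text \<open>Every line y other than y0 meets y0, so it is one of the finitely many lines through one
  of the finitely many points of y0.\<close>

lemma finite_flags: "finite (flags z)"
proof (cases "flags z = {}")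
  case False
  then obtain x0 y0 where 0: "(x0, y0, z) \<in> \<Delta>" by (auto simp: flags_def)
  define Y where "Y = insert y0 (\<Union>a\<in>fiber y0 z. fiber z a)"
  have "flags z \<subseteq> (\<Union>y\<in>Y. (\<lambda>x. (x, y)) ` fiber y z)"
  proof (clarify, unfold flags_iff)
    fix x y assume xy: "(x, y, z) \<in> \<Delta>"
    have "y \<in> Y"
    proof (cases "y = y0")
      case False
      with meet[OF 0 xy] obtain a where "(a, y0, z) \<in> \<Delta>" "(a, y, z) \<in> \<Delta>"
        by blast
      then show ?thesis using rotate[of a y z] by (auto simp: Y_def)
    qed (simp add: Y_def)
    with xy show "(x, y) \<in> (\<Union>y\<in>Y. (\<lambda>x. (x, y)) ` fiber y z)" by force
  qed
  moreover have "finite Y" by (auto simp: Y_def)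
  ultimately show ?thesis by (auto intro: finite_subset)
qed simp

lemma flag_geometry_flags: "flag_geometry (flags z) q"
proof
  show "card {y'. (x, y') \<in> flags z} = q + 1" if "(x, y) \<in> flags z" for x y
  proof -
    have "{y'. (x, y') \<in> flags z} = fiber z x" by (simp add: fiber_rotate)
    then show ?thesis using that card_fiber'[of y z x] rotate[of x y z] by simp
  qed
qed (use finite_flags card_fiber meet join in auto)

definition avg :: "('a \<times> 'a \<times> 'a \<Rightarrow> real) \<Rightarrow> 'a \<times> 'a \<times> 'a \<Rightarrow> real" where
  "avg \<phi> = (\<lambda>(x, y, z). if (x, y, z) \<in> \<Delta> then (\<Sum>x'\<in>fiber y z. \<phi> (x', y, z)) / (1 + real q)
     else \<phi> (x, y, z))"

end

definition rot :: "('a \<times> 'a \<times> 'a \<Rightarrow> real) \<Rightarrow> 'a \<times> 'a \<times> 'a \<Rightarrow> real" where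
  "rot \<phi> = (\<lambda>(x, y, z). \<phi> (y, z, x))"

lemma rot_apply [simp]: "rot \<phi> (x, y, z) = \<phi> (y, z, x)"
  by (simp add: rot_def)

lemma rot_rot_rot [simp]: "rot (rot (rot \<phi>)) = \<phi>"
  by (auto simp: fun_eq_iff)

lemma rot_const [simp]: "rot (\<lambda>t. c) = (\<lambda>t. c)"
  by (auto simp: fun_eq_iff)

context triangle_system
begin

text \<open>
  Positions in a triangle are counted modulo 3. All operators are the identity outside \<open>\<Delta>\<close> (up to a
  rotation), so that the relations hold as equations between functions on the whole type. The \<open>T i\<close>
  and \<open>rot\<close> generate an extended affine Hecke algebra of type \<open>\<tilde>A\<^sub>2\<close>.
\<close>

definition E :: "nat \<Rightarrow> ('a \<times> 'a \<times> 'a \<Rightarrow> real) \<Rightarrow> 'a \<times> 'a \<times> 'a \<Rightarrow> real" where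
  "E i \<phi> = (rot ^^ i) (avg ((rot ^^ (2 * i)) \<phi>))"

definition T :: "nat \<Rightarrow> ('a \<times> 'a \<times> 'a \<Rightarrow> real) \<Rightarrow> 'a \<times> 'a \<times> 'a \<Rightarrow> real" where
  "T i \<phi> = (\<lambda>t. ((1 + real q) * E i \<phi> t - \<phi> t) / q)"

lemma E_0: "E 0 = avg"
  by (simp add: E_def fun_eq_iff)

lemma rot_E: "rot (E i \<phi>) = E (Suc i) (rot \<phi>)"
  by (simp add: E_def funpow_swap1 numeral_2_eq_2)

lemma E_Suc: "E (Suc i) \<phi> = rot (E i (rot (rot \<phi>)))"
  by (simp add: rot_E)

lemma E_add_3: "E (Suc (Suc (Suc i))) \<phi> = E i \<phi>"
  by (simp add: E_Suc)

lemma rot_T: "rot (T i \<phi>) = T (Suc i) (rot \<phi>)"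
proof -
  have "rot (T i \<phi>) = (\<lambda>t. ((1 + real q) * rot (E i \<phi>) t - rot \<phi> t) / q)"
    by (auto simp: T_def fun_eq_iff)
  then show ?thesis by (simp add: T_def rot_E)
qed

lemma T_Suc: "T (Suc i) \<phi> = rot (T i (rot (rot \<phi>)))"
  by (simp add: rot_T)

lemma T_add_3: "T (Suc (Suc (Suc i))) \<phi> = T i \<phi>"
  by (simp add: T_Suc)

lemma E_outside: "t \<notin> \<Delta> \<Longrightarrow> E i \<phi> t = \<phi> t"
proof (induction i arbitrary: \<phi> t)
  case 0
  then show ?case by (cases t) (simp add: E_0 avg_def)
next
  case (Suc i)
  obtain x y z where t: "t = (x, y, z)" by (cases t)
  with Suc.prems have "(y, z, x) \<notin> \<Delta>" by (simp add: rotate_iff)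
  with t show ?case by (simp add: E_Suc Suc.IH)
qed

lemma T_outside: "t \<notin> \<Delta> \<Longrightarrow> T i \<phi> t = \<phi> t"
  using q_ge_2 by (simp add: T_def E_outside field_simps)

lemma rot_comb: "rot (\<lambda>t. a * \<phi> t + b * \<psi> t) = (\<lambda>t. a * rot \<phi> t + b * rot \<psi> t)"
  by (auto simp: fun_eq_iff)

lemma E_comb: "E i (\<lambda>t. a * \<phi> t + b * \<psi> t) = (\<lambda>t. a * E i \<phi> t + b * E i \<psi> t)"
proof (induction i arbitrary: \<phi> \<psi>)
  case 0
  show ?case
    by (auto simp: E_0 avg_def fun_eq_iff sum.distrib sum_distrib_left add_divide_distrib)
qed (simp add: E_Suc rot_comb)

lemma E_add: "E i (\<lambda>t. \<phi> t + \<psi> t) = (\<lambda>t. E i \<phi> t + E i \<psi> t)"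
  using E_comb[of i 1 \<phi> 1 \<psi>] by simp

lemma E_mult: "E i (\<lambda>t. \<phi> t * E i \<psi> t) = (\<lambda>t. E i \<phi> t * E i \<psi> t)"
proof (induction i arbitrary: \<phi> \<psi>)
  case 0
  show ?case
    by (auto simp: E_0 avg_def fun_eq_iff simp flip: sum_distrib_right sum_divide_distrib)
next
  case (Suc i)
  have "rot (\<lambda>t. \<phi> t * \<psi> t) = (\<lambda>t. rot \<phi> t * rot \<psi> t)" for \<phi> \<psi> :: "'a \<times> 'a \<times> 'a \<Rightarrow> real"
    by (auto simp: fun_eq_iff)
  with Suc show ?case by (simp add: E_Suc)
qed

lemma E_const [simp]: "E i (\<lambda>t. c) = (\<lambda>t. c)"
proof (induction i)
  case 0
  show ?case by (auto simp: E_0 avg_def fun_eq_iff card_fiber')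
qed (simp add: E_Suc)

lemma E_idem [simp]: "E i (E i \<phi>) = E i \<phi>"
  using E_mult[of i "\<lambda>t. 1" \<phi>] by simp

lemma T_comb: "T i (\<lambda>t. a * \<phi> t + b * \<psi> t) = (\<lambda>t. a * T i \<phi> t + b * T i \<psi> t)"
  by (auto simp: T_def E_comb fun_eq_iff diff_divide_distrib add_divide_distrib algebra_simps)

lemma T_const [simp]: "T i (\<lambda>t. c) = (\<lambda>t. c)"
  using q_ge_2 by (auto simp: T_def fun_eq_iff field_simps)

text \<open>The mean over the q other triangles in the panel: positivity becomes visible, which the
  minus sign in the definition of \<open>T\<close> hides.\<close>

lemma T_apply_0:
  assumes "(x, y, z) \<in> \<Delta>"
  shows "T 0 \<phi> (x, y, z) = (\<Sum>x'\<in>fiber y z - {x}. \<phi> (x', y, z)) / q"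
  using assms by (simp add: T_def E_0 avg_def sum_diff1 add_nonneg_eq_0_iff)

lemma T_mono: "(\<And>t. \<phi> t \<le> \<psi> t) \<Longrightarrow> T i \<phi> t \<le> T i \<psi> t"
proof (induction i arbitrary: \<phi> \<psi> t)
  case 0
  show ?case
  proof (cases "t \<in> \<Delta>")
    case True
    then show ?thesis
      using 0 by (cases t) (auto simp: T_apply_0 intro!: divide_right_mono sum_mono)
  qed (use 0 in \<open>simp add: T_outside\<close>)
next
  case (Suc i)
  obtain x y z where t: "t = (x, y, z)" by (cases t)
  have "rot (rot \<phi>) s \<le> rot (rot \<psi>) s" for s using Suc.prems by (cases s) auto
  from Suc.IH[OF this] t show ?case by (simp add: T_Suc)
qed

section \<open>Reduction to the link and the braid relation\<close>

lemma E_1_apply: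
  assumes "(x, y, z) \<in> \<Delta>"
  shows "E (Suc 0) \<phi> (x, y, z) = flag_geometry.line_avg (flags z) q (\<lambda>(x, y). \<phi> (x, y, z)) x"
proof -
  interpret flag_geometry "flags z" q by (rule flag_geometry_flags)
  have "lns x = fiber z x" by (simp add: lns_def fiber_rotate)
  then show ?thesis
    using rotate[OF assms] by (simp add: E_Suc E_0 avg_def line_avg_def add.commute)
qed

lemma E_0_apply:
  assumes "(x, y, z) \<in> \<Delta>"
  shows "E 0 \<phi> (x, y, z) = flag_geometry.point_avg (flags z) q (\<lambda>(x, y). \<phi> (x, y, z)) y"
proof -
  interpret flag_geometry "flags z" q by (rule flag_geometry_flags)
  have "pts y = fiber y z" by (auto simp: pts_def)
  then show ?thesis
    using assms by (simp add: E_0 avg_def point_avg_def add.commute)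
qed

text \<open>At a triangle with third vertex z, both sides equal the sum of \<phi> over all flags at
  z, divided by (1 + q)^3.\<close>

lemma E_braid_0:
  "E 0 (E 1 (E 0 \<phi>)) t - q / (1 + real q)\<^sup>2 * E 0 \<phi> t
   = E 1 (E 0 (E 1 \<phi>)) t - q / (1 + real q)\<^sup>2 * E 1 \<phi> t"
proof (cases "t \<in> \<Delta>")
  case True
  obtain x y z where t: "t = (x, y, z)" by (cases t)
  interpret F: flag_geometry "flags z" q by (rule flag_geometry_flags)
  let ?\<phi> = "\<lambda>(x, y). \<phi> (x, y, z)"
  have xyz: "(x, y, z) \<in> \<Delta>" using True t by simp
  then have ends: "x \<in> fst ` flags z" "y \<in> snd ` flags z" using F.flag_ends[of x y] by auto
  have l: "F.line_avg \<phi> x = F.line_avg \<psi> x" if "\<And>t. t \<in> flags z \<Longrightarrow> \<phi> t = \<psi> t" for \<phi> \<psi> x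
    using that by (auto simp: F.line_avg_def F.lns_def intro!: sum.cong arg_cong2[where f = "(/)"])
  have p: "F.point_avg \<phi> y = F.point_avg \<psi> y" if "\<And>t. t \<in> flags z \<Longrightarrow> \<phi> t = \<psi> t" for \<phi> \<psi> y
    using that by (auto simp: F.point_avg_def F.pts_def intro!: sum.cong arg_cong2[where f = "(/)"])
  have "E 0 (E 1 (E 0 \<phi>)) t
      = F.point_avg (\<lambda>(x, y). F.line_avg (\<lambda>(x, y). F.point_avg ?\<phi> y) x) y"
    unfolding t One_nat_def E_0_apply[OF xyz]
    by (auto intro!: p l simp: E_1_apply E_0_apply)
  also have "\<dots> = (\<Sum>t\<in>flags z. ?\<phi> t) / (1 + real q) ^ 3 + q / (1 + real q)\<^sup>2 * F.point_avg ?\<phi> y"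
    using F.point_line_point_avg[OF ends(2), of ?\<phi>] by (simp add: F.point_avg_def)
  finally have 1: "E 0 (E 1 (E 0 \<phi>)) t - q / (1 + real q)\<^sup>2 * E 0 \<phi> t
      = (\<Sum>t\<in>flags z. ?\<phi> t) / (1 + real q) ^ 3"
    by (simp add: t E_0_apply[OF xyz])
  have "E 1 (E 0 (E 1 \<phi>)) t
      = F.line_avg (\<lambda>(x, y). F.point_avg (\<lambda>(x, y). F.line_avg ?\<phi> x) y) x"
    unfolding t One_nat_def E_1_apply[OF xyz]
    by (auto intro!: p l simp: E_1_apply E_0_apply)
  also have "\<dots> = (\<Sum>t\<in>flags z. ?\<phi> t) / (1 + real q) ^ 3 + q / (1 + real q)\<^sup>2 * F.line_avg ?\<phi> x"
    using F.line_point_line_avg[OF ends(1), of ?\<phi>] by (simp add: F.line_avg_def)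
  finally have 2: "E 1 (E 0 (E 1 \<phi>)) t - q / (1 + real q)\<^sup>2 * E 1 \<phi> t
      = (\<Sum>t\<in>flags z. ?\<phi> t) / (1 + real q) ^ 3"
    by (simp add: t E_1_apply[OF xyz])
  from 1 2 show ?thesis by simp
qed (simp add: E_outside)

lemma T_braid_0: "T 0 (T 1 (T 0 \<phi>)) = T 1 (T 0 (T 1 \<phi>))"
proof
  fix t
  define a b k where "a = (1 + real q) / q" and "b = - 1 / real q" and "k = q / (1 + real q)\<^sup>2"
  have T: "T i \<phi> = (\<lambda>t. a * E i \<phi> t + b * \<phi> t)" for i \<phi>
    by (auto simp: T_def fun_eq_iff diff_divide_distrib a_def b_def)
  \<comment> \<open>The normalization satisfies a^2 k + a b + b^2 = 0. This cancels the multiples of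
    \<open>E 0\<close> and \<open>E 1\<close> that remain after \<open>E_braid_0\<close> has
    exchanged the cubic terms.\<close>
  have "Q / n * (Q / n * (n / Q\<^sup>2)) = 1 / n" if "Q \<noteq> 0" "n \<noteq> 0" for Q n :: real
    using that by (simp add: power2_eq_square)
  from this[of "1 + real q" q] have "a * (a * k) = 1 / q"
    using q_ge_2 by (simp add: a_def k_def)
  moreover have "a * b + b * b = - 1 / q"
    using q_ge_2 by (simp add: a_def b_def field_simps)
  ultimately have abk: "a * (a * k) + a * b + b * b = 0" by simp
  define A where "A = E 0 \<phi> t"
  define B where "B = E 1 \<phi> t"
  have eq: "E 0 (E 1 (E 0 \<phi>)) t = E 1 (E 0 (E 1 \<phi>)) t + k * (A - B)"
    using E_braid_0[of \<phi> t] by (simp add: k_def A_def B_def algebra_simps)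
  have "T 0 (T 1 (T 0 \<phi>)) t - T 1 (T 0 (T 1 \<phi>)) t
      = a * (a * a) * (E 0 (E 1 (E 0 \<phi>)) t - E 1 (E 0 (E 1 \<phi>)) t)
      + a * (a * b + b * b) * (A - B)"
    by (simp add: T E_comb A_def B_def) (simp add: algebra_simps)
  also have "\<dots> = a * (A - B) * (a * (a * k) + a * b + b * b)"
    unfolding eq by (simp add: algebra_simps)
  finally show "T 0 (T 1 (T 0 \<phi>)) t = T 1 (T 0 (T 1 \<phi>)) t" by (simp add: abk)
qed

lemma T_braid: "T i (T (Suc i) (T i \<phi>)) = T (Suc i) (T i (T (Suc i) \<phi>))"
proof (induction i arbitrary: \<phi>)
  case 0
  show ?case using T_braid_0 by simp
next
  case (Suc i)
  from arg_cong[OF Suc[of "rot (rot \<phi>)"], of rot] show ?case by (simp add: rot_T)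
qed

text \<open>The quadratic Hecke relation (T - 1)(T + 1/q) = 0, in the normalization that fixes
  constants.\<close>

lemma T_T: "T i (T i \<phi>) t = 1 / q * \<phi> t + (1 - 1 / q) * T i \<phi> t"
proof -
  define a b where "a = (1 + real q) / q" and "b = - 1 / real q"
  have T: "T i \<phi> = (\<lambda>t. a * E i \<phi> t + b * \<phi> t)" for \<phi>
    by (auto simp: T_def fun_eq_iff diff_divide_distrib a_def b_def)
  have ab: "a + b = 1" using q_ge_2 by (simp add: a_def b_def field_simps)
  have "T i (T i \<phi>) t = a * ((a + b) * E i \<phi> t) + b * (a * E i \<phi> t + b * \<phi> t)"
    by (simp add: T E_comb algebra_simps)
  also have "\<dots> = a * E i \<phi> t * (1 + b) + b * b * \<phi> t"
    by (simp add: ab algebra_simps)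
  also have "\<dots> = (1 + b) * T i \<phi> t + (b * b - b * (1 + b)) * \<phi> t"
    by (simp add: T algebra_simps)
  finally show ?thesis by (simp add: b_def algebra_simps)
qed

text \<open>The quadratic relation expresses \<phi> through \<open>T i \<phi>\<close> and
  \<open>T i (T i \<phi>)\<close>.\<close>

lemma T_inject: "T i \<phi> = T i \<psi> \<longleftrightarrow> \<phi> = \<psi>"
proof
  assume eq: "T i \<phi> = T i \<psi>"
  show "\<phi> = \<psi>"
  proof
    fix t
    show "\<phi> t = \<psi> t"
      using T_T[of i \<phi> t] T_T[of i \<psi> t] eq q_ge_2 by (simp add: field_simps)
  qed
qed simp

lemma T_minus: "T i \<phi> t - \<phi> t = (1 + real q) / q * (E i \<phi> t - \<phi> t)"
  using q_ge_2 by (simp add: T_def field_simps)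

lemma T_fixed_iff: "T i \<phi> = \<phi> \<longleftrightarrow> E i \<phi> = \<phi>"
proof -
  have "T i \<phi> t = \<phi> t \<longleftrightarrow> E i \<phi> t = \<phi> t" for t
    using T_minus[of i \<phi> t] q_ge_2 by auto
  then show ?thesis by (auto simp: fun_eq_iff)
qed

end

section \<open>Spectral gap\<close>

context triangle_system
begin

lemma bij_betw_rotate: "bij_betw (\<lambda>(x, y, z). (y, z, x)) \<Delta> \<Delta>"
  by (rule bij_betwI[where g = "\<lambda>(x, y, z). (z, x, y)"]) (use rotate in auto)

lemma has_sum_rot: "(rot h has_sum S) \<Delta> \<longleftrightarrow> (h has_sum S) \<Delta>"
  using has_sum_reindex_bij_betw[OF bij_betw_rotate, of h S]
  by (simp add: rot_def case_prod_unfold)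

text \<open>Double counting of the pairs of triangles in a common panel: the relation is symmetric
  and every triangle has q + 1 partners, itself included. Nonnegativity yields summability over the
  pairs.\<close>

lemma has_sum_avg_nonneg:
  assumes "(h has_sum S) \<Delta>" and nonneg: "\<And>t. t \<in> \<Delta> \<Longrightarrow> h t \<ge> 0"
  shows "(avg h has_sum S) \<Delta>"
proof -
  define cls where "cls = (\<lambda>(x :: 'a, y, z). (\<lambda>x'. (x', y, z)) ` fiber y z)"
  have fin: "finite (cls t)" for t by (auto simp: cls_def split: prod.splits)
  have card: "card (cls t) = q + 1" if "t \<in> \<Delta>" for t
    using that by (auto simp: cls_def card_fiber' card_image inj_on_def split: prod.splits)
  have sub: "cls t \<subseteq> \<Delta>" for t by (auto simp: cls_def split: prod.splits)
  have sym: "t' \<in> cls t \<and> t \<in> \<Delta> \<longleftrightarrow> t \<in> cls t' \<and> t' \<in> \<Delta>" for t t'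
    by (auto simp: cls_def split: prod.splits)
  define H where "H = (\<lambda>(t' :: 'a \<times> 'a \<times> 'a, t :: 'a \<times> 'a \<times> 'a). h t')"
  have 1: "((\<lambda>t. H (t', t)) has_sum (1 + real q) * h t') (cls t')" if "t' \<in> \<Delta>" for t'
    using that fin by (intro has_sum_finiteI) (simp_all add: H_def card algebra_simps)
  have 2: "((\<lambda>t'. (1 + real q) * h t') has_sum (1 + real q) * S) \<Delta>"
    by (rule has_sum_cmult_right[OF assms(1)])
  have "H summable_on Sigma \<Delta> cls"
    by (rule summable_on_SigmaI[OF 1]) (use 2 sub nonneg in \<open>auto simp: H_def summable_on_def\<close>)
  with 1 2 have "(H has_sum (1 + real q) * S) (Sigma \<Delta> cls)"
    by (intro has_sum_SigmaI) auto
  moreover have swap: "prod.swap p \<in> Sigma \<Delta> cls" if "p \<in> Sigma \<Delta> cls" for p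
    using that sym[of "fst p" "snd p"] by (cases p) (simp del: split_paired_All)
  have "bij_betw prod.swap (Sigma \<Delta> cls) (Sigma \<Delta> cls)"
    by (intro bij_betwI[where g = prod.swap] Pi_I swap) (simp_all)
  ultimately have "((\<lambda>p. H (prod.swap p)) has_sum (1 + real q) * S) (Sigma \<Delta> cls)"
    by (subst has_sum_reindex_bij_betw)
  then have "((\<lambda>t. \<Sum>t'\<in>cls t. h t') has_sum (1 + real q) * S) \<Delta>"
    by (rule has_sum_SigmaD) (auto simp: H_def fin intro: has_sum_finiteI)
  from has_sum_cmult_right[OF this, of "1 / (1 + real q)"]
  have "((\<lambda>t. (\<Sum>t'\<in>cls t. h t') / (1 + real q)) has_sum S) \<Delta>" by simp
  moreover have "(\<Sum>t'\<in>cls t. h t') / (1 + real q) = avg h t" if "t \<in> \<Delta>" for t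
    using that by (cases t) (simp add: cls_def avg_def sum.reindex inj_on_def)
  ultimately show ?thesis by (simp cong: has_sum_cong)
qed

lemma has_sum_E:
  assumes "(h has_sum S) \<Delta>"
  shows "(E i h has_sum S) \<Delta>"
proof -
  have "(E 0 h has_sum S) \<Delta>" if "(h has_sum S) \<Delta>" for h S
  proof -
    \<comment> \<open>A general h is the difference of the nonnegative functions |h| + h and
      |h|.\<close>
    have "(\<lambda>t. \<bar>h t\<bar>) summable_on \<Delta>"
      using that summable_on_iff_abs_summable_on_real[of h \<Delta>] by (auto simp: summable_on_def)
    then obtain A where A: "((\<lambda>t. \<bar>h t\<bar>) has_sum A) \<Delta>" by (auto simp: summable_on_def)
    from has_sum_avg_nonneg[OF has_sum_add[OF A that]] has_sum_avg_nonneg[OF A]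
    have "(avg (\<lambda>t. \<bar>h t\<bar> + h t) has_sum (A + S)) \<Delta>" "(avg (\<lambda>t. \<bar>h t\<bar>) has_sum A) \<Delta>"
      by simp_all
    from has_sum_add[OF this(1) has_sum_cmult_right[OF this(2), of "- 1"]] show ?thesis by (simp add: E_add flip: E_0)
  qed
  with assms show ?thesis
    by (induction i arbitrary: h) (auto simp: E_Suc has_sum_rot)
qed

section \<open>Inner product on finitely supported functions\<close>

text \<open>Values outside \<open>\<Delta>\<close> are left free, since \<open>inner_sum\<close>
  does not see them.\<close>

definition fin_supp :: "('a \<times> 'a \<times> 'a \<Rightarrow> real) \<Rightarrow> bool" where
  "fin_supp \<phi> \<longleftrightarrow> finite {t \<in> \<Delta>. \<phi> t \<noteq> 0}"

definition inner_sum :: "('a \<times> 'a \<times> 'a \<Rightarrow> real) \<Rightarrow> ('a \<times> 'a \<times> 'a \<Rightarrow> real) \<Rightarrow> real" where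
  "inner_sum \<phi> \<psi> = (\<Sum>\<^sub>\<infinity>t\<in>\<Delta>. \<phi> t * \<psi> t)"

abbreviation sq_norm :: "('a \<times> 'a \<times> 'a \<Rightarrow> real) \<Rightarrow> real" where
  "sq_norm \<phi> \<equiv> inner_sum \<phi> \<phi>"

lemma fin_supp_comb [intro]: "fin_supp \<phi> \<Longrightarrow> fin_supp \<psi> \<Longrightarrow> fin_supp (\<lambda>t. a * \<phi> t + b * \<psi> t)"
  unfolding fin_supp_def
  by (rule finite_subset[of _ "{t \<in> \<Delta>. \<phi> t \<noteq> 0} \<union> {t \<in> \<Delta>. \<psi> t \<noteq> 0}"]) auto

lemma fin_supp_rot: "fin_supp \<phi> \<Longrightarrow> fin_supp (rot \<phi>)"
  unfolding fin_supp_def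
  by (rule finite_subset[of _ "(\<lambda>(x, y, z). (z, x, y)) ` {t \<in> \<Delta>. \<phi> t \<noteq> 0}"])
    (use rotate in \<open>auto simp: image_iff\<close>)

lemma fin_supp_E [intro]: "fin_supp \<phi> \<Longrightarrow> fin_supp (E i \<phi>)"
proof (induction i arbitrary: \<phi>)
  case 0
  have "{t \<in> \<Delta>. avg \<phi> t \<noteq> 0}
      \<subseteq> (\<Union>(x, y, z)\<in>{t \<in> \<Delta>. \<phi> t \<noteq> 0}. (\<lambda>x'. (x', y, z)) ` fiber y z)"
  proof clarify
    fix x y z assume "(x, y, z) \<in> \<Delta>" "avg \<phi> (x, y, z) \<noteq> 0"
    moreover from this obtain x' where "x' \<in> fiber y z" "\<phi> (x', y, z) \<noteq> 0"
      by (auto simp: avg_def elim: sum.not_neutral_contains_not_neutral)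
    ultimately show "(x, y, z) \<in> (\<Union>(x, y, z)\<in>{t \<in> \<Delta>. \<phi> t \<noteq> 0}. (\<lambda>x'. (x', y, z)) ` fiber y z)"
      by force
  qed
  moreover have "finite \<dots>" using 0 by (auto simp: fin_supp_def)
  ultimately show ?case unfolding fin_supp_def E_0 by (rule finite_subset)
qed (simp add: E_Suc fin_supp_rot)

lemma summable_on_fin_supp: "fin_supp \<phi> \<Longrightarrow> (\<lambda>t. \<phi> t * \<psi> t) summable_on \<Delta>"
  by (rule finite_nonzero_values_imp_summable_on)
    (auto simp: fin_supp_def elim!: rev_finite_subset)

lemma inner_sum_commute: "inner_sum \<phi> \<psi> = inner_sum \<psi> \<phi>"
  by (simp add: inner_sum_def mult.commute)

lemma inner_sum_comb_left:
  assumes "fin_supp \<phi>" "fin_supp \<psi>"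
  shows "inner_sum (\<lambda>t. a * \<phi> t + b * \<psi> t) \<eta> = a * inner_sum \<phi> \<eta> + b * inner_sum \<psi> \<eta>"
  using assms
  by (simp add: inner_sum_def distrib_right mult.assoc infsum_add infsum_cmult_right
      summable_on_cmult_right summable_on_fin_supp)

lemma inner_sum_comb_right:
  assumes "fin_supp \<phi>" "fin_supp \<psi>"
  shows "inner_sum \<eta> (\<lambda>t. a * \<phi> t + b * \<psi> t) = a * inner_sum \<eta> \<phi> + b * inner_sum \<eta> \<psi>"
  using inner_sum_comb_left[OF assms, of a b \<eta>] by (simp add: inner_sum_commute)

lemma inner_sum_rot: "inner_sum (rot \<phi>) (rot \<psi>) = inner_sum \<phi> \<psi>"
proof -
  have "(\<lambda>t. rot \<phi> t * rot \<psi> t) = rot (\<lambda>t. \<phi> t * \<psi> t)" by auto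
  then show ?thesis
    using infsum_eqI'[of "rot (\<lambda>t. \<phi> t * \<psi> t)" \<Delta> "\<lambda>t. \<phi> t * \<psi> t" \<Delta>]
    by (simp add: inner_sum_def has_sum_rot)
qed

text \<open>\<open>E i\<close> behaves like a conditional expectation: it preserves sums and factors
  of the form \<open>E i \<phi>\<close> can be pulled out of it. So it is an orthogonal
  projection.\<close>

lemma inner_sum_E:
  assumes "fin_supp \<psi>"
  shows "inner_sum (E i \<phi>) \<psi> = inner_sum (E i \<phi>) (E i \<psi>)"
proof -
  have "((\<lambda>t. \<psi> t * E i \<phi> t) has_sum inner_sum \<psi> (E i \<phi>)) \<Delta>"
    using summable_on_fin_supp[OF assms] by (simp add: inner_sum_def)
  from has_sum_E[OF this, of i] show ?thesis
    by (simp add: E_mult inner_sum_def mult.commute has_sum_iff)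
qed

lemma sq_norm_nonneg: "sq_norm \<phi> \<ge> 0"
  by (simp add: inner_sum_def infsum_nonneg)

lemma sum_squares_le_sq_norm:
  assumes "fin_supp \<phi>" "finite F" "F \<subseteq> \<Delta>"
  shows "(\<Sum>t\<in>F. (\<phi> t)\<^sup>2) \<le> sq_norm \<phi>"
  unfolding inner_sum_def power2_eq_square
  by (rule finite_sum_le_infsum) (use assms in \<open>auto intro: summable_on_fin_supp\<close>)

lemma square_le_sq_norm: "fin_supp \<phi> \<Longrightarrow> t \<in> \<Delta> \<Longrightarrow> (\<phi> t)\<^sup>2 \<le> sq_norm \<phi>"
  using sum_squares_le_sq_norm[of \<phi> "{t}"] by simp

lemma sq_norm_add_le:
  assumes "fin_supp \<phi>" "fin_supp \<psi>"
  shows "sq_norm (\<lambda>t. \<phi> t + a * \<psi> t) \<le> 2 * sq_norm \<phi> + 2 * a\<^sup>2 * sq_norm \<psi>"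
proof -
  have *: "sq_norm (\<lambda>t. 1 * \<phi> t + b * \<psi> t) = sq_norm \<phi> + 2 * b * inner_sum \<phi> \<psi> + b\<^sup>2 * sq_norm \<psi>" for b
    using assms
    by (simp only: inner_sum_comb_left inner_sum_comb_right fin_supp_comb
          inner_sum_commute[of \<psi> \<phi>])
      (simp add: power2_eq_square algebra_simps)
  show ?thesis
    using *[of a] *[of "- a"] sq_norm_nonneg[of "\<lambda>t. 1 * \<phi> t + (- a) * \<psi> t"]
    by (simp add: algebra_simps)
qed

section \<open>Deviations, Laplacian and Garland's inequality\<close>

definition dev :: "nat \<Rightarrow> ('a \<times> 'a \<times> 'a \<Rightarrow> real) \<Rightarrow> 'a \<times> 'a \<times> 'a \<Rightarrow> real" where
  "dev i \<phi> = (\<lambda>t. \<phi> t - E i \<phi> t)"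

lemma dev_comb_E: "dev i \<phi> = (\<lambda>t. 1 * \<phi> t + (- 1) * E i \<phi> t)"
  by (simp add: dev_def)

lemma dev_comb: "dev i (\<lambda>t. a * \<phi> t + b * \<psi> t) = (\<lambda>t. a * dev i \<phi> t + b * dev i \<psi> t)"
  by (simp add: dev_def E_comb algebra_simps)

lemma dev_Suc: "dev (Suc i) \<phi> = rot (dev i (rot (rot \<phi>)))"
  using rot_comb[of 1 "rot (rot \<phi>)" "- 1" "E i (rot (rot \<phi>))"]
  by (simp add: dev_comb_E E_Suc)

lemma fin_supp_dev [intro]: "fin_supp \<phi> \<Longrightarrow> fin_supp (dev i \<phi>)"
  unfolding dev_comb_E by (intro fin_supp_comb fin_supp_E)

lemma inner_sum_dev:
  assumes "fin_supp \<phi>" "fin_supp \<psi>"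
  shows "inner_sum (dev i \<phi>) \<psi> = inner_sum (dev i \<phi>) (dev i \<psi>)"
proof -
  have "inner_sum (dev i \<phi>) (E i \<psi>) = 0"
    using assms inner_sum_E[of \<phi> i \<psi>] inner_sum_comb_left[of \<phi> "E i \<phi>" 1 "- 1" "E i \<psi>"]
    by (simp add: dev_def fin_supp_E inner_sum_commute)
  moreover have "inner_sum (dev i \<phi>) (dev i \<psi>) = inner_sum (dev i \<phi>) \<psi> - inner_sum (dev i \<phi>) (E i \<psi>)"
    using assms inner_sum_comb_right[of \<psi> "E i \<psi>" "dev i \<phi>" 1 "- 1"]
    by (simp add: dev_comb_E[of i \<psi>] fin_supp_E)
  ultimately show ?thesis by simp
qed

lemma sq_norm_dev_le:
  assumes "fin_supp \<phi>"
  shows "sq_norm (dev i \<phi>) \<le> sq_norm \<phi>"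
proof -
  have "sq_norm (E i \<phi>) = sq_norm \<phi> - sq_norm (dev i \<phi>)"
  proof -
    have "E i \<phi> = (\<lambda>t. 1 * \<phi> t + (- 1) * dev i \<phi> t)" by (simp add: dev_def)
    then show ?thesis
      using assms inner_sum_dev[OF assms assms, of i]
      by (simp only: inner_sum_comb_left inner_sum_comb_right fin_supp_comb fin_supp_dev
          inner_sum_commute[of \<phi> "dev i \<phi>"]) simp
  qed
  then show ?thesis using sq_norm_nonneg[of "E i \<phi>"] by simp
qed

lemma deviation_inequality_0:
  assumes "fin_supp \<psi>"
  shows "0 \<le> 2 * inner_sum (dev 0 \<psi>) (dev 1 \<psi>) + 12 / 25 * (sq_norm (dev 0 \<psi>) + sq_norm (dev 1 \<psi>))"
proof -
  define h where "h t = 2 * (dev 0 \<psi> t * dev 1 \<psi> t) + 12 / 25 * ((dev 0 \<psi> t)\<^sup>2 + (dev 1 \<psi> t)\<^sup>2)" for t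
  define Z where "Z = (\<lambda>(x, y, z). z) ` {t \<in> \<Delta>. h t \<noteq> 0}"
  have "finite ({t \<in> \<Delta>. dev 0 \<psi> t \<noteq> 0} \<union> {t \<in> \<Delta>. dev 1 \<psi> t \<noteq> 0})"
    using fin_supp_dev[OF assms] by (simp add: fin_supp_def)
  then have "finite {t \<in> \<Delta>. h t \<noteq> 0}"
    by (rule rev_finite_subset) (auto simp: h_def)
  then have Z: "finite Z" by (simp add: Z_def)
  \<comment> \<open>The support of h is enlarged to full links, because the local inequality
    concerns the sum over all flags at z.\<close>
  define R where "R = (\<lambda>(z, x, y). (x, y, z)) ` (SIGMA z:Z. flags z)"
  have R: "finite R" "R \<subseteq> \<Delta>" using Z finite_flags by (auto simp: R_def)
  have R0: "h t = 0" if "t \<in> \<Delta> - R" for t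
  proof (rule ccontr)
    assume "h t \<noteq> 0"
    obtain x y z where t: "t = (x, y, z)" by (cases t)
    with that \<open>h t \<noteq> 0\<close> have "z \<in> Z" unfolding Z_def by force
    with that t have "(z, x, y) \<in> (SIGMA z:Z. flags z)" by simp
    then have "t \<in> R" unfolding R_def t by (rule image_eqI[rotated]) simp
    with that show False by simp
  qed
  have "(\<Sum>\<^sub>\<infinity>t\<in>\<Delta>. h t) = (\<Sum>t\<in>R. h t)"
    by (rule infsumI[OF has_sum_finite_neutralI[OF R R0 refl]])
  also have "\<dots> = (\<Sum>(z, x, y)\<in>(SIGMA z:Z. flags z). h (x, y, z))"
    unfolding R_def by (subst sum.reindex) (auto simp: inj_on_def case_prod_unfold)
  also have "\<dots> = (\<Sum>z\<in>Z. \<Sum>(x, y)\<in>flags z. h (x, y, z))"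
    using Z finite_flags by (subst sum.Sigma) (auto simp: case_prod_unfold)
  also have "\<dots> \<ge> 0"
  proof (rule sum_nonneg)
    fix z
    interpret F: flag_geometry "flags z" q by (rule flag_geometry_flags)
    let ?\<psi> = "\<lambda>(x, y). \<psi> (x, y, z)"
    have "(\<Sum>(x, y)\<in>flags z. h (x, y, z)) = (\<Sum>(x, y)\<in>flags z.
      2 * ((?\<psi> (x, y) - F.point_avg ?\<psi> y) * (?\<psi> (x, y) - F.line_avg ?\<psi> x))
      + 12 / 25 * ((?\<psi> (x, y) - F.point_avg ?\<psi> y)\<^sup>2 + (?\<psi> (x, y) - F.line_avg ?\<psi> x)\<^sup>2))"
      by (intro sum.cong) (auto simp: h_def dev_def E_0_apply E_1_apply)
    then show "0 \<le> (\<Sum>(x, y)\<in>flags z. h (x, y, z))"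
      using F.deviation_inequality[OF q_ge_2, of ?\<psi>] by simp
  qed
  finally have "0 \<le> (\<Sum>\<^sub>\<infinity>t\<in>\<Delta>. h t)" .
  also have "(\<Sum>\<^sub>\<infinity>t\<in>\<Delta>. h t)
      = 2 * inner_sum (dev 0 \<psi>) (dev 1 \<psi>) + 12 / 25 * (sq_norm (dev 0 \<psi>) + sq_norm (dev 1 \<psi>))"
    unfolding h_def inner_sum_def power2_eq_square using assms
    by (subst infsum_add infsum_cmult_right |
        (intro summable_on_cmult_right summable_on_add summable_on_fin_supp fin_supp_dev; assumption))+
      simp
  finally show ?thesis .
qed

lemma deviation_inequality:
  assumes "fin_supp \<psi>"
  shows "0 \<le> 2 * inner_sum (dev i \<psi>) (dev (Suc i) \<psi>)
    + 12 / 25 * (sq_norm (dev i \<psi>) + sq_norm (dev (Suc i) \<psi>))"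
  using assms
proof (induction i arbitrary: \<psi>)
  case 0
  then show ?case using deviation_inequality_0 by simp
next
  case (Suc i)
  from Suc.IH[OF fin_supp_rot[OF fin_supp_rot[OF Suc.prems]]] show ?case
    by (simp only: dev_Suc[of i \<psi>] dev_Suc[of "Suc i" \<psi>] inner_sum_rot)
qed

definition energy :: "('a \<times> 'a \<times> 'a \<Rightarrow> real) \<Rightarrow> real" where
  "energy \<psi> = sq_norm (dev 0 \<psi>) + sq_norm (dev 1 \<psi>) + sq_norm (dev 2 \<psi>)"

text \<open>The sum of the three deviations. The factors 1 give it the shape to which
  \<open>inner_sum_comb_left\<close> and \<open>inner_sum_comb_right\<close> apply as rewrite
  rules.\<close>

definition laplace :: "('a \<times> 'a \<times> 'a \<Rightarrow> real) \<Rightarrow> 'a \<times> 'a \<times> 'a \<Rightarrow> real" where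
  "laplace \<psi> = (\<lambda>t. 1 * (1 * dev 0 \<psi> t + 1 * dev 1 \<psi> t) + 1 * dev 2 \<psi> t)"

text \<open>Since \<open>laplace\<close> is 3 minus the sum of the three averages, this is their
  mean (E 0 + E 1 + E 2) / 3, a step of a random walk on triangles.\<close>

definition smooth :: "('a \<times> 'a \<times> 'a \<Rightarrow> real) \<Rightarrow> 'a \<times> 'a \<times> 'a \<Rightarrow> real" where
  "smooth \<psi> = (\<lambda>t. 1 * \<psi> t + (- 1 / 3) * laplace \<psi> t)"

lemma fin_supp_laplace [intro]: "fin_supp \<psi> \<Longrightarrow> fin_supp (laplace \<psi>)"
  unfolding laplace_def by (intro fin_supp_comb fin_supp_dev)

lemma fin_supp_smooth [intro]: "fin_supp \<psi> \<Longrightarrow> fin_supp (smooth \<psi>)"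
  unfolding smooth_def by (intro fin_supp_comb fin_supp_laplace)

lemma laplace_comb: "laplace (\<lambda>t. a * \<phi> t + b * \<psi> t) = (\<lambda>t. a * laplace \<phi> t + b * laplace \<psi> t)"
  by (simp add: laplace_def dev_comb algebra_simps)

lemma inner_sum_laplace:
  assumes "fin_supp \<phi>" "fin_supp \<psi>"
  shows "inner_sum (laplace \<phi>) \<psi> = inner_sum (dev 0 \<phi>) (dev 0 \<psi>) + inner_sum (dev 1 \<phi>) (dev 1 \<psi>)
    + inner_sum (dev 2 \<phi>) (dev 2 \<psi>)"
  unfolding laplace_def using assms
  by (simp only: inner_sum_comb_left fin_supp_comb fin_supp_dev inner_sum_dev[symmetric]) simp

lemma inner_sum_laplace_right:
  assumes "fin_supp \<phi>" "fin_supp \<psi>"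
  shows "inner_sum \<phi> (laplace \<psi>) = inner_sum (laplace \<phi>) \<psi>"
  using inner_sum_laplace[OF assms] inner_sum_laplace[OF assms(2,1)] by (simp add: inner_sum_commute)

lemma inner_sum_smooth_right:
  assumes "fin_supp \<phi>" "fin_supp \<psi>"
  shows "inner_sum \<phi> (smooth \<psi>) = inner_sum (smooth \<phi>) \<psi>"
  unfolding smooth_def using assms
  by (simp only: inner_sum_comb_left inner_sum_comb_right fin_supp_laplace inner_sum_laplace_right)

lemma energy_eq: "fin_supp \<psi> \<Longrightarrow> energy \<psi> = inner_sum (laplace \<psi>) \<psi>"
  by (simp add: energy_def inner_sum_laplace)

lemma energy_le_sq_norm: "fin_supp \<psi> \<Longrightarrow> energy \<psi> \<le> 3 * sq_norm \<psi>"
  using sq_norm_dev_le[of \<psi>] by (smt (verit) energy_def)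

lemma energy_nonneg: "energy \<psi> \<ge> 0"
  by (simp add: energy_def sq_norm_nonneg)

text \<open>Each squared deviation occurs in two of the three cyclic pairs, so the cross terms cost
  at most 2 * 12/25 of the energy and 1/25 remains. In spectral language, the Laplacian has no
  spectrum strictly between 0 and 1/25; the kernel is not excluded yet.\<close>

lemma sq_norm_laplace_ge:
  assumes "fin_supp \<psi>"
  shows "energy \<psi> / 25 \<le> sq_norm (laplace \<psi>)"
proof -
  have D3: "dev 3 \<psi> = dev 0 \<psi>" by (simp add: dev_def E_add_3 numeral_3_eq_3)
  have "sq_norm (laplace \<psi>) = energy \<psi> + 2 * inner_sum (dev 0 \<psi>) (dev 1 \<psi>)
      + 2 * inner_sum (dev 1 \<psi>) (dev 2 \<psi>) + 2 * inner_sum (dev 2 \<psi>) (dev 0 \<psi>)"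
    unfolding laplace_def energy_def using assms
    by (simp only: inner_sum_comb_left inner_sum_comb_right fin_supp_comb fin_supp_dev
        inner_sum_commute[of "dev 1 \<psi>" "dev 0 \<psi>"] inner_sum_commute[of "dev 2 \<psi>" "dev 1 \<psi>"]
        inner_sum_commute[of "dev 0 \<psi>" "dev 2 \<psi>"]) simp
  moreover note deviation_inequality[OF assms, of 0, folded One_nat_def]
  moreover have "0 \<le> 2 * inner_sum (dev 1 \<psi>) (dev 2 \<psi>) + 12 / 25 * (sq_norm (dev 1 \<psi>) + sq_norm (dev 2 \<psi>))"
    using deviation_inequality[OF assms, of 1] by (simp add: numeral_2_eq_2)
  moreover have "0 \<le> 2 * inner_sum (dev 2 \<psi>) (dev 0 \<psi>) + 12 / 25 * (sq_norm (dev 2 \<psi>) + sq_norm (dev 0 \<psi>))"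
    using deviation_inequality[OF assms, of 2] D3 by simp
  ultimately show ?thesis unfolding energy_def by argo
qed

text \<open>With L the Laplacian, the new energy is the quadratic form of L (1 - L/3)^2. The bound L
  \<le> 3 lets the cubic term undo only half of the gain 2/3 L^2, and the rest is at least 1/3 *
  1/25 = 1/75 of the energy.\<close>

lemma energy_smooth_le:
  assumes "fin_supp \<psi>"
  shows "energy (smooth \<psi>) \<le> 74 / 75 * energy \<psi>"
proof -
  have "energy (smooth \<psi>) = energy \<psi> - 2 / 3 * sq_norm (laplace \<psi>) + 1 / 9 * energy (laplace \<psi>)"
    using assms
    by (simp only: energy_eq fin_supp_smooth fin_supp_laplace)
      (simp only: smooth_def laplace_comb inner_sum_comb_left inner_sum_comb_right fin_supp_laplace
        inner_sum_laplace_right[of "laplace \<psi>" \<psi>], simp add: inner_sum_commute field_simps)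
  then show ?thesis
    using energy_le_sq_norm[OF fin_supp_laplace[OF assms]] sq_norm_laplace_ge[OF assms] by linarith
qed

lemma sq_norm_smooth:
  assumes "fin_supp \<psi>"
  shows "sq_norm (smooth \<psi>) = sq_norm \<psi> - 2 / 3 * energy \<psi> + 1 / 9 * sq_norm (laplace \<psi>)"
  using assms
  by (simp only: energy_eq)
    (simp only: smooth_def inner_sum_comb_left inner_sum_comb_right fin_supp_laplace,
      simp add: inner_sum_commute field_simps)


end

context triangle_system
begin

section \<open>Decay of iterated smoothing along components\<close>

definition adjacent :: "(('a \<times> 'a \<times> 'a) \<times> ('a \<times> 'a \<times> 'a)) set" where
  "adjacent = {(t, t'). t \<in> \<Delta> \<and> t' \<in> \<Delta> \<and> (case (t, t') of ((x, y, z), (x', y', z')) \<Rightarrow>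
     y = y' \<and> z = z' \<or> x = x' \<and> z = z' \<or> x = x' \<and> y = y')}"

lemma E_adjacent:
  assumes "(t, t') \<in> adjacent"
  shows "\<exists>i<3. \<forall>\<phi>. E i \<phi> t = E i \<phi> t'"
proof -
  obtain x y z x' y' z' where t: "t = (x, y, z)" "t' = (x', y', z')" by (cases t, cases t')
  have \<Delta>: "(x, y, z) \<in> \<Delta>" "(x', y', z') \<in> \<Delta>" using assms t by (auto simp: adjacent_def)
  have \<Delta>': "(y, z, x) \<in> \<Delta>" "(y', z', x') \<in> \<Delta>" "(z, x, y) \<in> \<Delta>" "(z', x', y') \<in> \<Delta>"
    using \<Delta> rotate by blast+
  consider "y = y'" "z = z'" | "x = x'" "z = z'" | "x = x'" "y = y'"
    using assms t by (auto simp: adjacent_def)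
  then show ?thesis
  proof cases
    case 1
    with \<Delta> have "E 0 \<phi> t = E 0 \<phi> t'" for \<phi> by (simp add: t E_0 avg_def)
    then show ?thesis by (intro exI[of _ 0]) auto
  next
    case 2
    with \<Delta>' have "E 1 \<phi> t = E 1 \<phi> t'" for \<phi> by (simp add: t E_Suc E_0 avg_def)
    then show ?thesis by (intro exI[of _ 1]) auto
  next
    case 3
    with \<Delta>' have "E 2 \<phi> t = E 2 \<phi> t'" for \<phi> by (simp add: t numeral_2_eq_2 E_Suc E_0 avg_def)
    then show ?thesis by (intro exI[of _ 2]) auto
  qed
qed

lemma sq_norm_dev_le_energy: "i < 3 \<Longrightarrow> sq_norm (dev i \<psi>) \<le> energy \<psi>"
  using sq_norm_nonneg[of "dev 0 \<psi>"] sq_norm_nonneg[of "dev 1 \<psi>"] sq_norm_nonneg[of "dev 2 \<psi>"]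
  by (auto simp: energy_def less_Suc_eq numeral_3_eq_3 numeral_2_eq_2)

lemma smooth_pow:
  assumes "fin_supp \<psi>"
  shows "fin_supp ((smooth ^^ n) \<psi>)"
    and "energy ((smooth ^^ n) \<psi>) \<le> (74 / 75) ^ n * energy \<psi>"
    and "sq_norm ((smooth ^^ n) \<psi>) \<le> sq_norm \<psi>"
    and "sq_norm \<psi> \<le> sq_norm ((smooth ^^ n) \<psi>) + 50 * (1 - (74 / 75) ^ n) * energy \<psi>"
    and "fin_supp \<phi> \<Longrightarrow> inner_sum \<phi> ((smooth ^^ n) \<psi>) = inner_sum ((smooth ^^ n) \<phi>) \<psi>"
proof -
  show fs: "fin_supp ((smooth ^^ n) \<psi>)" for n
    using assms by (induction n) auto
  show e: "energy ((smooth ^^ n) \<psi>) \<le> (74 / 75) ^ n * energy \<psi>" for n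
  proof (induction n)
    case (Suc n)
    then show ?case using energy_smooth_le[OF fs, of n] by simp
  qed simp
  show "sq_norm ((smooth ^^ n) \<psi>) \<le> sq_norm \<psi>"
  proof (induction n)
    case (Suc n)
    have "sq_norm (laplace \<phi>) \<le> 3 * energy \<phi>" if "fin_supp \<phi>" for \<phi>
    proof -
      have *: "inner_sum (laplace \<phi>) (laplace \<phi>) \<le> (energy (laplace \<phi>) / 3 + 3 * energy \<phi>) / 2"
      proof -
        \<comment> \<open>Together with L \<le> 3, positivity of the energy at this combination
          gives L^2 \<le> 3 L without a square root of the Laplacian L.\<close>
        have "0 \<le> energy (\<lambda>t. 3 * \<phi> t + (- 1) * laplace \<phi> t)" by (rule energy_nonneg)
        also have "\<dots> = 9 * energy \<phi> - 6 * sq_norm (laplace \<phi>) + energy (laplace \<phi>)"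
          using that
          by (simp only: energy_eq fin_supp_comb fin_supp_laplace)
            (simp only: laplace_comb inner_sum_comb_left inner_sum_comb_right fin_supp_laplace
              inner_sum_laplace_right[of "laplace \<phi>" \<phi>], simp add: inner_sum_commute field_simps)
        finally show ?thesis by simp
      qed
      then show ?thesis using energy_le_sq_norm[OF fin_supp_laplace[OF that]] by argo
    qed
    from this[OF fs[of n]] show ?case
      using Suc sq_norm_smooth[OF fs, of n] energy_nonneg[of "(smooth ^^ n) \<psi>"] by simp
  qed simp
  \<comment> \<open>A step loses at most 2/3 of the current energy, and the energies decay with
    ratio 74/75; the geometric series sums to 2/3 * 75 = 50.\<close>
  show "sq_norm \<psi> \<le> sq_norm ((smooth ^^ n) \<psi>) + 50 * (1 - (74 / 75) ^ n) * energy \<psi>"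
  proof (induction n)
    case (Suc n)
    show ?case
      using Suc sq_norm_smooth[OF fs, of n] e[of n] sq_norm_nonneg[of "laplace ((smooth ^^ n) \<psi>)"]
      by (simp add: algebra_simps)
  qed simp
  show "inner_sum \<phi> ((smooth ^^ n) \<psi>) = inner_sum ((smooth ^^ n) \<phi>) \<psi>" if "fin_supp \<phi>"
    using that
  proof (induction n arbitrary: \<phi>)
    case (Suc n)
    have "inner_sum \<phi> (smooth ((smooth ^^ n) \<psi>)) = inner_sum (smooth \<phi>) ((smooth ^^ n) \<psi>)"
      using Suc.prems fs by (rule inner_sum_smooth_right)
    also have "\<dots> = inner_sum ((smooth ^^ n) (smooth \<phi>)) \<psi>"
      using Suc.prems by (intro Suc.IH fin_supp_smooth)
    finally show ?case by (simp add: funpow_swap1)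
  qed simp
qed

text \<open>Adjacent triangles have one of the averages \<open>E i\<close> in common, so their
  values differ by a difference of two deviations, and these are controlled by the decaying
  energy.\<close>

lemma smooth_pow_adjacent:
  assumes "fin_supp \<psi>" "(t, t') \<in> adjacent\<^sup>*"
  shows "(\<lambda>n. (smooth ^^ n) \<psi> t - (smooth ^^ n) \<psi> t') \<longlonglongrightarrow> 0"
  using assms(2)
proof induction
  case (step s s')
  obtain i where i: "i < 3" "\<And>\<phi>. E i \<phi> s = E i \<phi> s'" using E_adjacent[OF step(2)] by blast
  have lim: "(\<lambda>n. sqrt ((74 / 75) ^ n * energy \<psi>)) \<longlonglongrightarrow> 0"
    using tendsto_real_sqrt[OF tendsto_mult_left_zero[OF LIMSEQ_power_zero[of "74 / 75 :: real"]]]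
    by simp
  have bound: "norm (dev i ((smooth ^^ n) \<psi>) r) \<le> sqrt ((74 / 75) ^ n * energy \<psi>)" if "r \<in> \<Delta>" for n r
  proof -
    have "(dev i ((smooth ^^ n) \<psi>) r)\<^sup>2 \<le> (74 / 75) ^ n * energy \<psi>"
      using square_le_sq_norm[OF fin_supp_dev[OF smooth_pow(1)[OF assms(1)]] that, of i n]
        sq_norm_dev_le_energy[OF i(1), of "(smooth ^^ n) \<psi>"] smooth_pow(2)[OF assms(1), of n]
      by (rule order_trans[OF _ order_trans])
    then show ?thesis using real_le_rsqrt[of "norm (dev i ((smooth ^^ n) \<psi>) r)"] by simp
  qed
  have D0: "(\<lambda>n. dev i ((smooth ^^ n) \<psi>) r) \<longlonglongrightarrow> 0" if "r \<in> \<Delta>" for r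
    using order_trans[OF bound[OF that] abs_ge_self]
    by (intro tendsto_0_le[OF lim, where K = 1] always_eventually) simp
  have "s \<in> \<Delta>" "s' \<in> \<Delta>" using step(2) by (auto simp: adjacent_def)
  from tendsto_diff[OF D0[OF this(1)] D0[OF this(2)]]
  have "(\<lambda>n. (smooth ^^ n) \<psi> s - (smooth ^^ n) \<psi> s') \<longlonglongrightarrow> 0"
    by (simp add: dev_def i(2)[of "(smooth ^^ _) \<psi>"])
  from tendsto_add[OF step.IH this] show ?case by simp
qed simp

text \<open>If the values at t stayed away from 0, they would do so simultaneously at arbitrarily
  many triangles of the infinite component of t, against the bounded square norm.\<close>

lemma smooth_pow_tendsto_0:
  assumes "fin_supp \<psi>" "t \<in> \<Delta>" and inf: "infinite (adjacent\<^sup>* `` {t})"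
  shows "(\<lambda>n. (smooth ^^ n) \<psi> t) \<longlonglongrightarrow> 0"
proof (rule LIMSEQ_I)
  fix r :: real assume "r > 0"
  define C where "C = 2 * sq_norm \<psi> + 1"
  obtain K :: nat where K: "C / r\<^sup>2 < K" using reals_Archimedean2 by blast
  obtain F where F: "F \<subseteq> adjacent\<^sup>* `` {t}" "finite F" "card F = K"
    using infinite_arbitrarily_large[OF inf, of K] by auto
  have "s \<in> \<Delta>" if "(t, s) \<in> adjacent\<^sup>*" for s
    using that assms(2) by induction (auto simp: adjacent_def)
  with F have "F \<subseteq> \<Delta>" by auto
  have "(\<lambda>n. \<Sum>s\<in>F. 2 * ((smooth ^^ n) \<psi> t - (smooth ^^ n) \<psi> s)\<^sup>2) \<longlonglongrightarrow> (\<Sum>s\<in>F. 2 * 0\<^sup>2)"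
    using F by (intro tendsto_intros smooth_pow_adjacent assms) auto
  then have "eventually (\<lambda>n. (\<Sum>s\<in>F. 2 * ((smooth ^^ n) \<psi> t - (smooth ^^ n) \<psi> s)\<^sup>2) < 1) sequentially"
    by (rule order_tendstoD) simp
  then obtain N where N: "\<And>n. n \<ge> N \<Longrightarrow> (\<Sum>s\<in>F. 2 * ((smooth ^^ n) \<psi> t - (smooth ^^ n) \<psi> s)\<^sup>2) < 1"
    by (auto simp: eventually_sequentially)
  have "norm ((smooth ^^ n) \<psi> t - 0) < r" if "n \<ge> N" for n
  proof -
    let ?u = "(smooth ^^ n) \<psi>"
    have sq: "(?u t)\<^sup>2 \<le> 2 * (?u t - ?u s)\<^sup>2 + 2 * (?u s)\<^sup>2" for s
    proof -
      have "0 \<le> (?u t - 2 * ?u s)\<^sup>2" by simp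
      then show ?thesis by (simp add: power2_eq_square algebra_simps)
    qed
    have "K * (?u t)\<^sup>2 = (\<Sum>s\<in>F. (?u t)\<^sup>2)" using F by simp
    also have "\<dots> \<le> (\<Sum>s\<in>F. 2 * (?u t - ?u s)\<^sup>2 + 2 * (?u s)\<^sup>2)"
      by (intro sum_mono sq)
    also have "\<dots> = (\<Sum>s\<in>F. 2 * (?u t - ?u s)\<^sup>2) + 2 * (\<Sum>s\<in>F. (?u s)\<^sup>2)"
      by (simp add: sum.distrib sum_distrib_left)
    also have "\<dots> \<le> 1 + 2 * sq_norm \<psi>"
      using N[OF that] sum_squares_le_sq_norm[OF smooth_pow(1)[OF assms(1)] F(2) \<open>F \<subseteq> \<Delta>\<close>, of n]
        smooth_pow(3)[OF assms(1), of n] by linarith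
    finally have "K * (?u t)\<^sup>2 \<le> C" by (simp add: C_def)
    also have "C < K * r\<^sup>2" using K \<open>r > 0\<close> by (simp add: field_simps)
    finally have "(?u t)\<^sup>2 < r\<^sup>2" by (simp add: mult_less_cancel_left)
    then show ?thesis using \<open>r > 0\<close> power2_less_imp_less[of "\<bar>?u t\<bar>" r] by simp
  qed
  then show "\<exists>N. \<forall>n\<ge>N. norm ((smooth ^^ n) \<psi> t - 0) < r" by blast
qed

end

locale infinite_triangle_system = triangle_system +
  assumes infinite_component: "t \<in> \<Delta> \<Longrightarrow> infinite (adjacent\<^sup>* `` {t})"
begin

text \<open>The spectral gap proper, with trivial kernel. Self-adjointness turns the square norm of
  the n-th iterate into the inner product of the 2n-th iterate with \<psi>, so pointwise convergence
  on the finite support of \<psi> is enough.\<close>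

lemma sq_norm_le_energy:
  assumes "fin_supp \<psi>"
  shows "sq_norm \<psi> \<le> 50 * energy \<psi>"
proof -
  define S where "S = {t \<in> \<Delta>. \<psi> t \<noteq> 0}"
  have S: "finite S" "S \<subseteq> \<Delta>" using assms by (auto simp: S_def fin_supp_def)
  have eq: "sq_norm ((smooth ^^ n) \<psi>) = (\<Sum>t\<in>S. (smooth ^^ (n + n)) \<psi> t * \<psi> t)" for n
  proof -
    have "sq_norm ((smooth ^^ n) \<psi>) = inner_sum ((smooth ^^ (n + n)) \<psi>) \<psi>"
      using smooth_pow(1,5)[OF assms] by (simp add: funpow_add)
    also have "\<dots> = (\<Sum>t\<in>S. (smooth ^^ (n + n)) \<psi> t * \<psi> t)"
      unfolding inner_sum_def
      by (rule infsumI[OF has_sum_finite_neutralI[OF S _ refl]]) (auto simp: S_def)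
    finally show ?thesis .
  qed
  have "strict_mono (\<lambda>n :: nat. n + n)" by (auto simp: strict_mono_def)
  from LIMSEQ_subseq_LIMSEQ[OF smooth_pow_tendsto_0[OF assms] this]
  have "(\<lambda>n. (smooth ^^ (n + n)) \<psi> t) \<longlonglongrightarrow> 0" if "t \<in> \<Delta>" for t
    using that infinite_component by (simp add: o_def)
  with S have "(\<lambda>n. \<Sum>t\<in>S. (smooth ^^ (n + n)) \<psi> t * \<psi> t) \<longlonglongrightarrow> (\<Sum>t\<in>S. 0 * \<psi> t)"
    by (intro tendsto_intros) auto
  then have "(\<lambda>n. sq_norm ((smooth ^^ n) \<psi>) + 50 * energy \<psi>) \<longlonglongrightarrow> 0 + 50 * energy \<psi>"
    by (intro tendsto_intros) (simp add: eq)
  moreover have "sq_norm \<psi> \<le> sq_norm ((smooth ^^ n) \<psi>) + 50 * energy \<psi>" for n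
  proof -
    have "50 * (1 - (74 / 75) ^ n) * energy \<psi> \<le> 50 * energy \<psi>"
      using energy_nonneg[of \<psi>] by (intro mult_right_mono) auto
    then show ?thesis using smooth_pow(4)[OF assms, of n] by simp
  qed
  ultimately show ?thesis using LIMSEQ_le_const[of _ "0 + 50 * energy \<psi>" "sq_norm \<psi>"] by auto
qed

end

context triangle_system
begin

section \<open>Products of the \<open>T i\<close> contract square norms\<close>

lemma T_comb_dev: "T i \<phi> = (\<lambda>t. 1 * \<phi> t + (- (1 + 1 / q)) * dev i \<phi> t)"
  using q_ge_2 by (auto simp: T_def dev_def fun_eq_iff field_simps)

lemma fin_supp_T [intro]: "fin_supp \<phi> \<Longrightarrow> fin_supp (T i \<phi>)"
  unfolding T_comb_dev by (intro fin_supp_comb fin_supp_dev)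

lemma sq_norm_T_le:
  assumes "fin_supp \<phi>"
  shows "sq_norm (T i \<phi>) \<le> sq_norm \<phi> - 3 / 4 * sq_norm (dev i \<phi>)"
proof -
  define c where "c = 1 + 1 / real q"
  have c: "1 \<le> c" "c \<le> 3 / 2" using q_ge_2 by (auto simp: c_def field_simps)
  have "sq_norm (T i \<phi>) = sq_norm \<phi> - (2 * c - c * c) * sq_norm (dev i \<phi>)"
    unfolding T_comb_dev c_def[symmetric] using assms inner_sum_dev[OF assms assms, of i]
    by (simp only: inner_sum_comb_left inner_sum_comb_right fin_supp_dev
          inner_sum_commute[of \<phi> "dev i \<phi>"]) (simp add: algebra_simps)
  \<comment> \<open>The product is 2 c - c^2 - 3/4; the bound 3/4 is attained at c = 3/2, that is,
    at q = 2.\<close>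
  moreover have "(3 / 2 - c) * (c - 1 / 2) \<ge> 0" using c by simp
  then have "3 / 4 * sq_norm (dev i \<phi>) \<le> (2 * c - c * c) * sq_norm (dev i \<phi>)"
    by (intro mult_right_mono sq_norm_nonneg) (simp add: algebra_simps, argo)
  ultimately show ?thesis by simp
qed

lemma sq_norm_dev_le_T:
  assumes "fin_supp \<phi>"
  shows "sq_norm (dev j \<phi>) \<le> 2 * sq_norm (dev j (T i \<phi>)) + 9 / 2 * sq_norm (dev i \<phi>)"
proof -
  define c where "c = 1 + 1 / real q"
  have c: "0 \<le> c" "c \<le> 3 / 2" using q_ge_2 by (auto simp: c_def field_simps)
  have "\<phi> = (\<lambda>t. 1 * T i \<phi> t + c * dev i \<phi> t)"
    by (auto simp: T_comb_dev c_def fun_eq_iff algebra_simps)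
  then have "dev j \<phi> = dev j (\<lambda>t. 1 * T i \<phi> t + c * dev i \<phi> t)"
    by (rule arg_cong)
  then have "dev j \<phi> = (\<lambda>t. dev j (T i \<phi>) t + c * dev j (dev i \<phi>) t)"
    unfolding dev_comb by simp
  then have "sq_norm (dev j \<phi>) \<le> 2 * sq_norm (dev j (T i \<phi>)) + 2 * c\<^sup>2 * sq_norm (dev j (dev i \<phi>))"
    using assms by (simp add: sq_norm_add_le fin_supp_dev fin_supp_T)
  also have "2 * c\<^sup>2 * sq_norm (dev j (dev i \<phi>)) \<le> 2 * (3 / 2)\<^sup>2 * sq_norm (dev i \<phi>)"
    using c assms by (intro mult_mono power_mono sq_norm_dev_le fin_supp_dev sq_norm_nonneg) auto
  finally show ?thesis by (simp add: power2_eq_square)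
qed

end

context infinite_triangle_system
begin

text \<open>If no factor lost norm, all deviations would be small, against the gap. Quantitatively
  the losses u, v, w bound the energy by 10 u + 11 v + 4 w, hence the square norm of \<psi> by 550
  (u + v + w), while 3/4 (u + v + w) is lost. The constant 2999/3000 is generous. The second
  hypothesis lets i, j, k be the three positions in any order.\<close>

lemma sq_norm_T_T_T_le:
  assumes "fin_supp \<psi>" and "energy \<psi> = sq_norm (dev i \<psi>) + sq_norm (dev j \<psi>) + sq_norm (dev k \<psi>)"
  shows "sq_norm (T i (T j (T k \<psi>))) \<le> 2999 / 3000 * sq_norm \<psi>"
proof -
  define u v w where "u = sq_norm (dev k \<psi>)" and "v = sq_norm (dev j (T k \<psi>))"
    and "w = sq_norm (dev i (T j (T k \<psi>)))"
  note fs = assms(1) fin_supp_T[OF assms(1), of k] fin_supp_T[OF fin_supp_T[OF assms(1), of k], of j]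
  have "u \<ge> 0" "v \<ge> 0" "w \<ge> 0" by (auto simp: u_def v_def w_def sq_norm_nonneg)
  moreover have "sq_norm (T i (T j (T k \<psi>))) \<le> sq_norm \<psi> - 3 / 4 * (u + v + w)"
    using sq_norm_T_le[OF fs(1), of k] sq_norm_T_le[OF fs(2), of j] sq_norm_T_le[OF fs(3), of i]
    unfolding u_def v_def w_def by argo
  moreover have "sq_norm (dev j \<psi>) \<le> 2 * v + 9 / 2 * u"
    using sq_norm_dev_le_T[OF fs(1), of j k] by (simp add: u_def v_def)
  moreover have "sq_norm (dev i \<psi>) \<le> 2 * sq_norm (dev i (T k \<psi>)) + 9 / 2 * u"
    using sq_norm_dev_le_T[OF fs(1), of i k] by (simp add: u_def)
  moreover have "sq_norm (dev i (T k \<psi>)) \<le> 2 * w + 9 / 2 * v"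
    using sq_norm_dev_le_T[OF fs(2), of i j] by (simp add: w_def v_def)
  moreover have "sq_norm \<psi> \<le> 50 * energy \<psi>" by (rule sq_norm_le_energy[OF assms(1)])
  ultimately show ?thesis unfolding assms(2) u_def[symmetric] by argo
qed

lemma sq_norm_T_210_le:
  assumes "fin_supp \<psi>"
  shows "sq_norm (T 2 (T 1 (T 0 \<psi>))) \<le> 2999 / 3000 * sq_norm \<psi>"
  using assms by (intro sq_norm_T_T_T_le) (simp_all add: energy_def)

lemma sq_norm_T_120_le:
  assumes "fin_supp \<psi>"
  shows "sq_norm (T 1 (T 2 (T 0 \<psi>))) \<le> 2999 / 3000 * sq_norm \<psi>"
  using assms by (intro sq_norm_T_T_T_le) (simp_all add: energy_def)

end

section \<open>Averaging operators on \<open>\<ell>\<^sup>p\<close>\<close>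

text \<open>Convexity with weights 1 - s and s. It serves as triangle inequality for p-th power
  sums: the free weight can bring one of the two factors as close to 1 as desired.\<close>

lemma powr_add_le:
  fixes a b p s :: real
  assumes "p > 1" "0 < s" "s < 1"
  shows "\<bar>a + b\<bar> powr p \<le> (1 - s) powr (1 - p) * \<bar>a\<bar> powr p + s powr (1 - p) * \<bar>b\<bar> powr p"
proof (cases "a = 0 \<or> b = 0")
  case True
  have "1 \<le> r powr (1 - p)" if "0 < r" "r < 1" for r
    using powr_mono'[of "1 - p" 0 r] that assms by simp
  from this[of s] this[of "1 - s"] True assms show ?thesis
    by (auto simp: mult_le_cancel_right1)
next
  case False
  have "\<bar>a + b\<bar> powr p \<le> ((1 - s) * (\<bar>a\<bar> / (1 - s)) + s * (\<bar>b\<bar> / s)) powr p"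
    using assms by (intro powr_mono2) auto
  also have "\<dots> \<le> (1 - s) * (\<bar>a\<bar> / (1 - s)) powr p + s * (\<bar>b\<bar> / s) powr p"
    using convex_onD[OF powr_convex[of p], of s "\<bar>a\<bar> / (1 - s)" "\<bar>b\<bar> / s"] assms False by auto
  also have "\<dots> = (1 - s) powr (1 - p) * \<bar>a\<bar> powr p + s powr (1 - p) * \<bar>b\<bar> powr p"
    using assms by (simp add: powr_divide powr_diff)
  finally show ?thesis .
qed

context triangle_system
begin

text \<open>Doubly stochastic kernels with finite rows, described by what they do rather than by
  matrix entries: this list of properties passes directly to compositions.\<close>

definition averaging :: "(('a \<times> 'a \<times> 'a \<Rightarrow> real) \<Rightarrow> 'a \<times> 'a \<times> 'a \<Rightarrow> real) \<Rightarrow> bool" where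
  "averaging M \<longleftrightarrow>
    (\<forall>a b \<phi> \<psi>. M (\<lambda>t. a * \<phi> t + b * \<psi> t) = (\<lambda>t. a * M \<phi> t + b * M \<psi> t)) \<and>
    (\<forall>\<phi> \<psi> t. (\<forall>t. \<phi> t \<le> \<psi> t) \<longrightarrow> M \<phi> t \<le> M \<psi> t) \<and>
    M (\<lambda>t. 1) = (\<lambda>t. 1) \<and>
    (\<forall>t. \<exists>S. finite S \<and> (\<forall>\<phi> \<psi>. (\<forall>s\<in>S. \<phi> s = \<psi> s) \<longrightarrow> M \<phi> t = M \<psi> t)) \<and>
    (\<forall>\<phi> \<psi>. (\<forall>t. (\<lambda>n :: nat. \<phi> n t) \<longlonglongrightarrow> \<psi> t) \<longrightarrow> (\<forall>t. (\<lambda>n. M (\<phi> n) t) \<longlonglongrightarrow> M \<psi> t)) \<and>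
    (\<forall>\<phi>. fin_supp \<phi> \<longrightarrow> fin_supp (M \<phi>)) \<and>
    (\<forall>\<phi> S. (\<phi> has_sum S) \<Delta> \<longrightarrow> (M \<phi> has_sum S) \<Delta>)"

lemma
  assumes "averaging M"
  shows averaging_comb: "M (\<lambda>t. a * \<phi> t + b * \<psi> t) = (\<lambda>t. a * M \<phi> t + b * M \<psi> t)"
    and averaging_mono: "(\<And>t. \<phi> t \<le> \<psi> t) \<Longrightarrow> M \<phi> t \<le> M \<psi> t"
    and averaging_one: "M (\<lambda>t. 1) = (\<lambda>t. 1)"
    and averaging_local: "\<exists>S. finite S \<and> (\<forall>\<phi> \<psi>. (\<forall>s\<in>S. \<phi> s = \<psi> s) \<longrightarrow> M \<phi> t = M \<psi> t)"
    and averaging_lim: "(\<And>t. (\<lambda>n. \<eta> n t) \<longlonglongrightarrow> \<psi> t) \<Longrightarrow> (\<lambda>n. M (\<eta> n) t) \<longlonglongrightarrow> M \<psi> t"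
    and averaging_fin_supp: "fin_supp \<phi> \<Longrightarrow> fin_supp (M \<phi>)"
    and averaging_has_sum: "(\<phi> has_sum S) \<Delta> \<Longrightarrow> (M \<phi> has_sum S) \<Delta>"
  subgoal by (rule assms[unfolded averaging_def, THEN conjunct1, rule_format])
  subgoal by (rule assms[unfolded averaging_def, THEN conjunct2, THEN conjunct1, rule_format])
  subgoal by (rule assms[unfolded averaging_def, THEN conjunct2, THEN conjunct2, THEN conjunct1, rule_format])
  subgoal by (rule assms[unfolded averaging_def, THEN conjunct2, THEN conjunct2, THEN conjunct2, THEN conjunct1, rule_format])
  subgoal by (rule assms[unfolded averaging_def, THEN conjunct2, THEN conjunct2, THEN conjunct2, THEN conjunct2, THEN conjunct1, rule_format])
  subgoal by (rule assms[unfolded averaging_def, THEN conjunct2, THEN conjunct2, THEN conjunct2, THEN conjunct2, THEN conjunct2, THEN conjunct1, rule_format])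
  subgoal by (rule assms[unfolded averaging_def, THEN conjunct2, THEN conjunct2, THEN conjunct2, THEN conjunct2, THEN conjunct2, THEN conjunct2, rule_format])
  done

lemma averaging_comp:
  assumes M: "averaging M" and N: "averaging N"
  shows "averaging (\<lambda>\<phi>. M (N \<phi>))"
  unfolding averaging_def
proof (intro conjI allI impI)
  fix t
  obtain S where S: "finite S" "\<And>\<phi> \<psi>. (\<forall>s\<in>S. \<phi> s = \<psi> s) \<longrightarrow> M \<phi> t = M \<psi> t"
    using averaging_local[OF M] by blast
  obtain R where R: "\<And>s. finite (R s)" "\<And>s \<phi> \<psi>. (\<forall>r\<in>R s. \<phi> r = \<psi> r) \<longrightarrow> N \<phi> s = N \<psi> s"
    using averaging_local[OF N] by metis
  show "\<exists>S. finite S \<and> (\<forall>\<phi> \<psi>. (\<forall>s\<in>S. \<phi> s = \<psi> s) \<longrightarrow> M (N \<phi>) t = M (N \<psi>) t)"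
    using S R by (intro exI[of _ "\<Union>s\<in>S. R s"]) auto
next
  fix a b \<phi> \<psi>
  show "M (N (\<lambda>t. a * \<phi> t + b * \<psi> t)) = (\<lambda>t. a * M (N \<phi>) t + b * M (N \<psi>) t)"
    unfolding averaging_comb[OF N] averaging_comb[OF M] ..
next
  show "M (N (\<lambda>t. 1)) = (\<lambda>t. 1)" unfolding averaging_one[OF N] averaging_one[OF M] ..
next
  fix \<phi> :: "nat \<Rightarrow> 'a \<times> 'a \<times> 'a \<Rightarrow> real" and \<psi> t
  assume "\<forall>t. (\<lambda>n. \<phi> n t) \<longlonglongrightarrow> \<psi> t"
  then show "(\<lambda>n. M (N (\<phi> n)) t) \<longlonglongrightarrow> M (N \<psi>) t"
    by (intro averaging_lim[OF M] averaging_lim[OF N]) (rule spec)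
next
  fix \<phi> assume "fin_supp \<phi>"
  then show "fin_supp (M (N \<phi>))"
    by (intro averaging_fin_supp[OF M] averaging_fin_supp[OF N])
next
  fix \<phi> :: "'a \<times> 'a \<times> 'a \<Rightarrow> real" and S assume "(\<phi> has_sum S) \<Delta>"
  then show "(M (N \<phi>) has_sum S) \<Delta>"
    by (intro averaging_has_sum[OF M] averaging_has_sum[OF N])
next
  fix \<phi> \<psi> :: "'a \<times> 'a \<times> 'a \<Rightarrow> real" and t assume "\<forall>t. \<phi> t \<le> \<psi> t"
  then show "M (N \<phi>) t \<le> M (N \<psi>) t"
    by (intro averaging_mono[OF M] averaging_mono[OF N]) (rule spec)
qed

lemma averaging_rot: "averaging rot"
  unfolding averaging_def
proof (intro conjI allI impI)
  fix t :: "'a \<times> 'a \<times> 'a"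
  obtain x y z where t: "t = (x, y, z)" by (cases t)
  show "\<exists>S. finite S \<and> (\<forall>\<phi> \<psi>. (\<forall>s\<in>S. \<phi> s = \<psi> s) \<longrightarrow> rot \<phi> t = rot \<psi> t)"
    by (intro exI[of _ "{(y, z, x)}"]) (auto simp: t)
qed (simp_all add: rot_comb has_sum_rot fin_supp_rot, auto simp: rot_def)

lemma averaging_T_0: "averaging (T 0)"
  unfolding averaging_def
proof (intro conjI allI impI)
  fix t :: "'a \<times> 'a \<times> 'a"
  obtain x y z where t: "t = (x, y, z)" by (cases t)
  show "\<exists>S. finite S \<and> (\<forall>\<phi> \<psi>. (\<forall>s\<in>S. \<phi> s = \<psi> s) \<longrightarrow> T 0 \<phi> t = T 0 \<psi> t)"
    by (intro exI[of _ "insert t ((\<lambda>x'. (x', y, z)) ` fiber y z)"])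
      (auto simp: t T_def E_0 avg_def intro!: sum.cong arg_cong2[where f = "(/)"] arg_cong2[where f = "(-)"])
next
  fix \<phi> :: "nat \<Rightarrow> 'a \<times> 'a \<times> 'a \<Rightarrow> real" and \<psi> t
  assume lim: "\<forall>t. (\<lambda>n. \<phi> n t) \<longlonglongrightarrow> \<psi> t"
  have "(\<lambda>n. avg (\<phi> n) t) \<longlonglongrightarrow> avg \<psi> t"
    by (cases t) (use lim in \<open>auto simp: avg_def intro!: tendsto_intros\<close>)
  then show "(\<lambda>n. T 0 (\<phi> n) t) \<longlonglongrightarrow> T 0 \<psi> t"
    unfolding T_def E_0 using lim[THEN spec, of t] q_ge_2
    by (intro tendsto_divide tendsto_diff tendsto_mult tendsto_const) simp_all
next
  fix \<phi> :: "'a \<times> 'a \<times> 'a \<Rightarrow> real" and S assume S: "(\<phi> has_sum S) \<Delta>"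
  have "T 0 \<phi> = (\<lambda>t. (1 + real q) / q * E 0 \<phi> t + (- 1 / q) * \<phi> t)"
    by (auto simp: T_def fun_eq_iff diff_divide_distrib)
  moreover have "(1 + real q) / q * S + (- 1 / q) * S = S"
    using q_ge_2 by (simp add: field_simps)
  ultimately show "(T 0 \<phi> has_sum S) \<Delta>"
    using has_sum_add[OF has_sum_cmult_right[OF has_sum_E[OF S, of 0], of "(1 + real q) / q"]
        has_sum_cmult_right[OF S, of "- 1 / q"]] by simp
next
  fix \<phi> \<psi> :: "'a \<times> 'a \<times> 'a \<Rightarrow> real" and t assume "\<forall>t. \<phi> t \<le> \<psi> t"
  then show "T 0 \<phi> t \<le> T 0 \<psi> t" by (intro T_mono) (rule spec)
qed (simp_all add: T_comb fin_supp_T)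

lemma averaging_T: "averaging (T i)"
proof (induction i)
  case (Suc i)
  have "T (Suc i) = (\<lambda>\<phi>. rot (T i (rot (rot \<phi>))))" by (auto simp: T_Suc fun_eq_iff)
  with averaging_comp[OF averaging_rot averaging_comp[OF Suc averaging_comp[OF averaging_rot averaging_rot]]]
  show ?case by simp
qed (rule averaging_T_0)

lemma averaging_diff:
  assumes "averaging M"
  shows "M (\<lambda>t. \<phi> t - \<psi> t) = (\<lambda>t. M \<phi> t - M \<psi> t)"
  using averaging_comb[OF assms, of 1 \<phi> "- 1" \<psi>] by simp

lemma averaging_add:
  assumes "averaging M"
  shows "M (\<lambda>t. \<phi> t + \<psi> t) = (\<lambda>t. M \<phi> t + M \<psi> t)"
  using averaging_comb[OF assms, of 1 \<phi> 1 \<psi>] by simp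

lemma averaging_zero:
  assumes "averaging M"
  shows "M (\<lambda>t. 0) = (\<lambda>t. 0)"
  using averaging_comb[OF assms, of 0 "\<lambda>t. 0" 0 "\<lambda>t. 0"] by simp

lemma averaging_nonneg:
  assumes "averaging M" "\<And>t. \<phi> t \<ge> 0"
  shows "M \<phi> t \<ge> 0"
  using averaging_mono[OF assms(1), of "\<lambda>t. 0" \<phi> t] assms(2) averaging_zero[OF assms(1)] by simp

lemma averaging_abs_le:
  assumes "averaging M"
  shows "\<bar>M \<phi> t\<bar> \<le> M (\<lambda>t. \<bar>\<phi> t\<bar>) t"
proof -
  have "M (\<lambda>t. (- 1) * \<phi> t + 0 * \<phi> t) t \<le> M (\<lambda>t. \<bar>\<phi> t\<bar>) t"
    by (rule averaging_mono[OF assms]) auto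
  then have "- M \<phi> t \<le> M (\<lambda>t. \<bar>\<phi> t\<bar>) t" unfolding averaging_comb[OF assms] by simp
  moreover have "M \<phi> t \<le> M (\<lambda>t. \<bar>\<phi> t\<bar>) t" by (rule averaging_mono[OF assms]) auto
  ultimately show ?thesis by linarith
qed

text \<open>Young's inequality holds at each point after division by \<open>A\<close> and
  \<open>B\<close>, and positivity of \<open>M\<close> carries it over to the averages. The
  \<epsilon> keeps the divisors positive and tends to 0 at the end.\<close>

lemma averaging_Hoelder:
  assumes M: "averaging M" and nonneg: "\<And>t. a t \<ge> 0" "\<And>t. b t \<ge> 0"
    and \<alpha>\<beta>: "\<alpha> > 0" "\<beta> > 0" "\<alpha> + \<beta> = 1"
  shows "M (\<lambda>t. a t powr \<alpha> * b t powr \<beta>) t \<le> M a t powr \<alpha> * M b t powr \<beta>"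
proof -
  have pos: "M a t \<ge> 0" "M b t \<ge> 0" by (rule averaging_nonneg[OF M]; rule nonneg)+
  have "M (\<lambda>t. a t powr \<alpha> * b t powr \<beta>) t \<le> (M a t + \<epsilon>) powr \<alpha> * (M b t + \<epsilon>) powr \<beta>"
    if "\<epsilon> > 0" for \<epsilon>
  proof -
    define A B where "A = M a t + \<epsilon>" and "B = M b t + \<epsilon>"
    have AB: "A > 0" "B > 0" using pos that by (simp_all add: A_def B_def)
    define C where "C = A powr \<alpha> * B powr \<beta>"
    have C: "C > 0" using AB by (simp add: C_def)
    have "a s powr \<alpha> * b s powr \<beta> \<le> (C * \<alpha> / A) * a s + (C * \<beta> / B) * b s" for s
    proof (cases "a s = 0 \<or> b s = 0")
      case True
      then show ?thesis
        using AB C \<alpha>\<beta> nonneg[of s] by (auto intro!: divide_nonneg_pos mult_nonneg_nonneg)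
    next
      case False
      then have "(a s / A) powr \<alpha> * (b s / B) powr \<beta> \<le> \<alpha> * (a s / A) + \<beta> * (b s / B)"
        using AB \<alpha>\<beta> nonneg[of s] by (intro Youngs_inequality_0) auto
      then have "C * ((a s / A) powr \<alpha> * (b s / B) powr \<beta>) \<le> C * (\<alpha> * (a s / A) + \<beta> * (b s / B))"
        using C by simp
      then show ?thesis
        using AB nonneg[of s] by (simp add: C_def powr_divide algebra_simps)
    qed
    then have "M (\<lambda>t. a t powr \<alpha> * b t powr \<beta>) t \<le> (C * \<alpha> / A) * M a t + (C * \<beta> / B) * M b t"
      unfolding averaging_comb[OF M, symmetric, THEN fun_cong] by (rule averaging_mono[OF M])
    also have "\<dots> \<le> (C * \<alpha> / A) * A + (C * \<beta> / B) * B"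
      using AB C \<alpha>\<beta> that by (intro add_mono mult_left_mono) (auto simp: A_def B_def)
    also have "\<dots> = C * (\<alpha> + \<beta>)" using AB by (simp add: algebra_simps)
    finally show ?thesis by (simp add: \<alpha>\<beta>(3) C_def A_def B_def)
  qed
  then have "eventually (\<lambda>\<epsilon>. M (\<lambda>t. a t powr \<alpha> * b t powr \<beta>) t
      \<le> (M a t + \<epsilon>) powr \<alpha> * (M b t + \<epsilon>) powr \<beta>) (at_right 0)"
    by (auto simp: eventually_at_right_field intro: exI[of _ 1])
  moreover have "((\<lambda>\<epsilon>. (M a t + \<epsilon>) powr \<alpha> * (M b t + \<epsilon>) powr \<beta>)
      \<longlongrightarrow> (M a t + 0) powr \<alpha> * (M b t + 0) powr \<beta>) (at_right 0)"
    using pos \<alpha>\<beta>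
    by (intro tendsto_mult tendsto_powr2 tendsto_add tendsto_const tendsto_ident_at)
      (auto simp: eventually_at_right_field intro!: exI[of _ 1])
  ultimately show ?thesis
    using tendsto_lowerbound[of _ "M a t powr \<alpha> * M b t powr \<beta>" "at_right (0 :: real)"] by simp
qed

lemma averaging_powr_le:
  assumes M: "averaging M" and nonneg: "\<And>t. a t \<ge> 0" and "r \<ge> 1"
  shows "M a t powr r \<le> M (\<lambda>t. a t powr r) t"
proof (cases "r = 1")
  case True
  then show ?thesis using nonneg averaging_nonneg[OF M nonneg] by simp
next
  case False
  with assms have r: "r > 1" by simp
  have a: "(\<lambda>t. a t) = (\<lambda>t. (a t powr r) powr (1 / r) * 1 powr (1 - 1 / r))"
    using nonneg r by (simp add: powr_powr)
  have "M a t \<le> M (\<lambda>t. a t powr r) t powr (1 / r) * M (\<lambda>t. 1) t powr (1 - 1 / r)"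
    by (subst a) (rule averaging_Hoelder[OF M], use r in auto)
  then have "M a t \<le> M (\<lambda>t. a t powr r) t powr (1 / r)"
    by (simp add: averaging_one[OF M])
  then have "M a t powr r \<le> (M (\<lambda>t. a t powr r) t powr (1 / r)) powr r"
    using r averaging_nonneg[OF M nonneg] by (intro powr_mono2) auto
  then show ?thesis using r averaging_nonneg[OF M, of "\<lambda>t. a t powr r"] by (simp add: powr_powr)
qed

section \<open>Power sums and the passage from l^2 to l^p\<close>

definition lp :: "real \<Rightarrow> ('a \<times> 'a \<times> 'a \<Rightarrow> real) \<Rightarrow> bool" where
  "lp p \<phi> \<longleftrightarrow> (\<lambda>t. \<bar>\<phi> t\<bar> powr p) summable_on \<Delta>"

definition pow_sum :: "real \<Rightarrow> ('a \<times> 'a \<times> 'a \<Rightarrow> real) \<Rightarrow> real" where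
  "pow_sum p \<phi> = (\<Sum>\<^sub>\<infinity>t\<in>\<Delta>. \<bar>\<phi> t\<bar> powr p)"

lemma pow_sum_nonneg: "pow_sum p \<phi> \<ge> 0"
  by (simp add: pow_sum_def infsum_nonneg)

lemma has_sum_lp: "lp p \<phi> \<Longrightarrow> ((\<lambda>t. \<bar>\<phi> t\<bar> powr p) has_sum pow_sum p \<phi>) \<Delta>"
  by (simp add: lp_def pow_sum_def)

lemma sum_le_pow_sum:
  assumes "lp p \<phi>" "finite F" "F \<subseteq> \<Delta>"
  shows "(\<Sum>t\<in>F. \<bar>\<phi> t\<bar> powr p) \<le> pow_sum p \<phi>"
  using finite_sum_le_has_sum[OF has_sum_lp[OF assms(1)] assms(2,3)] by simp

lemma lpI:
  assumes "\<And>F. finite F \<Longrightarrow> F \<subseteq> \<Delta> \<Longrightarrow> (\<Sum>t\<in>F. \<bar>\<phi> t\<bar> powr p) \<le> C"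
  shows "lp p \<phi>" "pow_sum p \<phi> \<le> C"
proof -
  show "lp p \<phi>" unfolding lp_def
    by (rule nonneg_bdd_above_summable_on) (use assms in \<open>auto intro!: bdd_aboveI[of _ C]\<close>)
  then show "pow_sum p \<phi> \<le> C"
    unfolding lp_def pow_sum_def by (rule infsum_le_finite_sums) (use assms in auto)
qed

lemma lp_le:
  assumes "lp p \<psi>" and "\<And>t. t \<in> \<Delta> \<Longrightarrow> \<bar>\<phi> t\<bar> \<le> \<bar>\<psi> t\<bar>" and "p > 0"
  shows "lp p \<phi>"
  using assms(1) unfolding lp_def
  by (rule summable_on_comparison_test) (use assms in \<open>auto intro: powr_mono2\<close>)

lemma
  assumes "p > 1" "0 < s" "s < 1" "lp p \<phi>" "lp p \<psi>"
  shows lp_add': "lp p (\<lambda>t. \<phi> t + \<psi> t)"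
    and pow_sum_add_le: "pow_sum p (\<lambda>t. \<phi> t + \<psi> t)
      \<le> (1 - s) powr (1 - p) * pow_sum p \<phi> + s powr (1 - p) * pow_sum p \<psi>"
proof -
  have sum: "((\<lambda>t. (1 - s) powr (1 - p) * \<bar>\<phi> t\<bar> powr p + s powr (1 - p) * \<bar>\<psi> t\<bar> powr p)
      has_sum (1 - s) powr (1 - p) * pow_sum p \<phi> + s powr (1 - p) * pow_sum p \<psi>) \<Delta>"
    using assms by (intro has_sum_add has_sum_cmult_right has_sum_lp)
  show lp: "lp p (\<lambda>t. \<phi> t + \<psi> t)"
    unfolding lp_def using has_sum_imp_summable[OF sum]
    by (rule summable_on_comparison_test) (use powr_add_le assms in auto)
  show "pow_sum p (\<lambda>t. \<phi> t + \<psi> t)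
      \<le> (1 - s) powr (1 - p) * pow_sum p \<phi> + s powr (1 - p) * pow_sum p \<psi>"
    by (rule has_sum_mono[OF has_sum_lp[OF lp] sum]) (use powr_add_le assms in auto)
qed

lemma lp_add: "p > 1 \<Longrightarrow> lp p \<phi> \<Longrightarrow> lp p \<psi> \<Longrightarrow> lp p (\<lambda>t. \<phi> t + \<psi> t)"
  by (rule lp_add'[of p "1 / 2"]) auto

lemma lp_uminus: "lp p (\<lambda>t. - \<phi> t) \<longleftrightarrow> lp p \<phi>"
  by (simp add: lp_def)

lemma lp_diff: "p > 1 \<Longrightarrow> lp p \<phi> \<Longrightarrow> lp p \<psi> \<Longrightarrow> lp p (\<lambda>t. \<phi> t - \<psi> t)"
  using lp_add[of p \<phi> "\<lambda>t. - \<psi> t"] by (simp add: lp_uminus)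

lemma lp_averaging:
  assumes M: "averaging M" and "p > 1" "lp p \<phi>"
  shows "lp p (M \<phi>)"
proof -
  have "M (\<lambda>t. \<bar>\<phi> t\<bar> powr p) summable_on \<Delta>"
    using averaging_has_sum[OF M has_sum_lp[OF assms(3)]] by (rule has_sum_imp_summable)
  moreover have "\<bar>M \<phi> t\<bar> powr p \<le> M (\<lambda>t. \<bar>\<phi> t\<bar> powr p) t" for t
  proof -
    have "\<bar>M \<phi> t\<bar> powr p \<le> M (\<lambda>t. \<bar>\<phi> t\<bar>) t powr p"
      using assms averaging_abs_le[OF M] by (intro powr_mono2) auto
    also have "\<dots> \<le> M (\<lambda>t. \<bar>\<phi> t\<bar> powr p) t"
      using assms by (intro averaging_powr_le) auto
    finally show ?thesis .
  qed
  ultimately show ?thesis unfolding lp_def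
    by (rule summable_on_comparison_test) auto
qed

text \<open>The p-th power of the norm bound that Riesz-Thorin would give from the squared norm
  \<theta> on l^2: interpolation with l^infinity for p \<ge> 2 and with l^1 for p < 2.\<close>

definition rate :: "real \<Rightarrow> real \<Rightarrow> real" where
  "rate p \<theta> = (if p \<ge> 2 then \<theta> else \<theta> powr (p - 1))"

lemma rate_bounds:
  assumes "p > 1" "0 < \<theta>" "\<theta> < 1"
  shows "0 < rate p \<theta>" "rate p \<theta> < 1"
  using assms powr_less_mono2[of "p - 1" \<theta> 1] by (auto simp: rate_def)

text \<open>
  Contraction on \<open>\<ell>\<^sup>2\<close> gives contraction on \<open>\<ell>\<^sup>p\<close>: apply it to \<open>\<psi> powr (p / 2)\<close> and use
  Jensen's (for \<open>p \<ge> 2\<close>) or Hoelder's (for \<open>p < 2\<close>) inequality for the averages.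
\<close>

lemma pow_sum_averaging_fin_supp:
  assumes M: "averaging M" and \<theta>: "0 < \<theta>" "\<theta> < 1" and "p > 1"
    and contr: "\<And>u. fin_supp u \<Longrightarrow> sq_norm (M u) \<le> \<theta> * sq_norm u"
    and \<psi>: "fin_supp \<psi>" "\<And>t. \<psi> t \<ge> 0" and F: "finite F" "F \<subseteq> \<Delta>"
  shows "(\<Sum>t\<in>F. M \<psi> t powr p) \<le> rate p \<theta> * pow_sum p \<psi>"
proof -
  define u where "u t = \<psi> t powr (p / 2)" for t
  have u: "fin_supp u" "u t \<ge> 0" for t using \<psi> by (auto simp: fin_supp_def u_def)
  have Mu: "M u t \<ge> 0" "M \<psi> t \<ge> 0" for t using u \<psi> by (auto intro: averaging_nonneg[OF M])
  have u2: "u t * u t = \<psi> t powr p" for t using \<psi>(2)[of t] by (simp add: u_def flip: powr_add)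
  have U: "sq_norm u = pow_sum p \<psi>"
    using \<psi>(2) by (simp add: inner_sum_def pow_sum_def u2)
  have "(\<Sum>t\<in>F. (M u t)\<^sup>2) \<le> \<theta> * pow_sum p \<psi>"
    using sum_squares_le_sq_norm[OF averaging_fin_supp[OF M u(1)] F] contr[OF u(1)] U by simp
  note MuF = this
  show ?thesis
  proof (cases "p \<ge> 2")
    case True
    have "M \<psi> t powr p \<le> (M u t)\<^sup>2" for t
    proof -
      have "M \<psi> t powr (p / 2) \<le> M u t"
        unfolding u_def using True \<psi> by (intro averaging_powr_le[OF M]) auto
      then have "(M \<psi> t powr (p / 2))\<^sup>2 \<le> (M u t)\<^sup>2" by (intro power_mono) auto
      then show ?thesis using Mu by (simp add: power2_eq_square flip: powr_add)
    qed
    then have "(\<Sum>t\<in>F. M \<psi> t powr p) \<le> (\<Sum>t\<in>F. (M u t)\<^sup>2)" by (rule sum_mono)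
    with MuF True show ?thesis by (simp add: rate_def)
  next
    case False
    define v where "v t = \<psi> t powr p" for t
    have v: "v t \<ge> 0" for t by (simp add: v_def)
    have Mv: "M v t \<ge> 0" for t by (intro averaging_nonneg[OF M] v)
    have vsum: "(v has_sum pow_sum p \<psi>) \<Delta>"
    proof -
      have "lp p \<psi>" unfolding lp_def
        by (rule finite_nonzero_values_imp_summable_on) (use \<psi> in \<open>simp add: fin_supp_def\<close>)
      from has_sum_lp[OF this] \<psi> show ?thesis by (simp add: v_def[abs_def])
    qed
    \<comment> \<open>Dividing the square by \<theta> balances the two terms: summed over F, both (M
      u)^2 / \<theta> and M v are at most \<open>pow_sum p \<psi>\<close>, and p - 1 and 2 - p are
      weights with sum 1.\<close>
    have pt: "M \<psi> t powr p \<le> \<theta> powr (p - 1) * ((p - 1) * ((M u t)\<^sup>2 / \<theta>) + (2 - p) * M v t)" for t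
    proof (cases "M \<psi> t = 0")
      case True
      have "0 \<le> \<theta> powr (p - 1) * ((p - 1) * ((M u t)\<^sup>2 / \<theta>) + (2 - p) * M v t)"
        using \<open>p > 1\<close> False \<theta> Mv by (intro mult_nonneg_nonneg add_nonneg_nonneg) auto
      then show ?thesis using True by simp
    next
      case nonzero: False
      \<comment> \<open>Chosen so that \<psi> is u to the power \<alpha> times v to the power
        \<beta>, between u in l^2 and v in l^1, and that p-th powers produce the exponents p - 1 of
        (M u)^2 and 2 - p of M v.\<close>
      define \<alpha> \<beta> where "\<alpha> = 2 * (p - 1) / p" and "\<beta> = (2 - p) / p"
      have \<alpha>\<beta>: "\<alpha> > 0" "\<beta> > 0" "\<alpha> + \<beta> = 1" "\<alpha> * p = 2 * (p - 1)" "\<beta> * p = 2 - p"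
        "p / 2 * \<alpha> + p * \<beta> = 1"
        using \<open>p > 1\<close> False by (auto simp: \<alpha>_def \<beta>_def field_simps)
      have "\<psi> s = u s powr \<alpha> * v s powr \<beta>" for s
        using \<psi>(2)[of s] \<alpha>\<beta>(6) by (simp add: u_def v_def powr_powr flip: powr_add)
      then have "M \<psi> t \<le> M u t powr \<alpha> * M v t powr \<beta>"
        using averaging_Hoelder[OF M u(2) v \<alpha>\<beta>(1-3)] by presburger
      moreover have "0 < M \<psi> t" using Mu(2)[of t] nonzero by simp
      ultimately have le: "M \<psi> t powr p \<le> (M u t powr \<alpha> * M v t powr \<beta>) powr p"
        and "0 < M u t powr \<alpha> * M v t powr \<beta>"
        using \<open>p > 1\<close> by (auto intro: powr_mono2)
      then have pos: "M u t > 0" "M v t > 0"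
        using Mu(1)[of t] Mv[of t] by (auto simp: zero_less_mult_iff order_less_le)
      have "(M u t powr \<alpha> * M v t powr \<beta>) powr p = M u t powr (2 * (p - 1)) * M v t powr (2 - p)"
        using pos \<alpha>\<beta> by (simp add: powr_mult powr_powr)
      also have "M u t powr (2 * (p - 1)) = \<theta> powr (p - 1) * ((M u t)\<^sup>2 / \<theta>) powr (p - 1)"
      proof -
        have "M u t powr (2 * (p - 1)) = (M u t powr 2) powr (p - 1)" by (simp add: powr_powr)
        then show ?thesis using pos \<theta> by (simp add: powr_divide)
      qed
      also have "\<theta> powr (p - 1) * ((M u t)\<^sup>2 / \<theta>) powr (p - 1) * M v t powr (2 - p)
          = \<theta> powr (p - 1) * (((M u t)\<^sup>2 / \<theta>) powr (p - 1) * M v t powr (2 - p))"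
        by simp
      also have "\<dots> \<le> \<theta> powr (p - 1) * ((p - 1) * ((M u t)\<^sup>2 / \<theta>) + (2 - p) * M v t)"
        using \<open>p > 1\<close> False pos \<theta> by (intro mult_left_mono Youngs_inequality_0) auto
      finally show ?thesis using le by simp
    qed
    have "(\<Sum>t\<in>F. M v t) \<le> pow_sum p \<psi>"
      by (rule finite_sum_le_has_sum[OF averaging_has_sum[OF M vsum] F]) (rule Mv)
    have "(\<Sum>t\<in>F. M \<psi> t powr p)
        \<le> (\<Sum>t\<in>F. \<theta> powr (p - 1) * ((p - 1) / \<theta> * (M u t)\<^sup>2 + (2 - p) * M v t))"
      using pt by (intro sum_mono) simp
    also have "\<dots> = \<theta> powr (p - 1) * ((p - 1) / \<theta> * (\<Sum>t\<in>F. (M u t)\<^sup>2) + (2 - p) * (\<Sum>t\<in>F. M v t))"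
      by (simp only: sum.distrib sum_distrib_left[symmetric])
    also have "\<dots> \<le> \<theta> powr (p - 1) * ((p - 1) / \<theta> * (\<theta> * pow_sum p \<psi>) + (2 - p) * pow_sum p \<psi>)"
      using \<open>p > 1\<close> False \<theta> MuF \<open>(\<Sum>t\<in>F. M v t) \<le> pow_sum p \<psi>\<close>
      by (intro mult_left_mono add_mono) auto
    also have "(p - 1) / \<theta> * (\<theta> * pow_sum p \<psi>) + (2 - p) * pow_sum p \<psi> = pow_sum p \<psi>"
      using \<theta> by (simp, simp add: algebra_simps)
    finally show ?thesis using False by (simp add: rate_def)
  qed
qed

text \<open>On a finite set F, \<open>M \<phi>\<close> depends on finitely many values of \<phi>, so
  a cutoff reduces the claim to finite support.\<close>

lemma pow_sum_averaging_le:
  assumes M: "averaging M" and \<theta>: "0 < \<theta>" "\<theta> < 1" and "p > 1"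
    and contr: "\<And>u. fin_supp u \<Longrightarrow> sq_norm (M u) \<le> \<theta> * sq_norm u"
    and \<phi>: "lp p \<phi>"
  shows "pow_sum p (M \<phi>) \<le> rate p \<theta> * pow_sum p \<phi>"
proof (rule lpI(2))
  fix F assume F: "finite F" "F \<subseteq> \<Delta>"
  obtain R where R: "\<And>s. finite (R s)" "\<And>s \<phi> \<psi>. (\<forall>r\<in>R s. \<phi> r = \<psi> r) \<longrightarrow> M \<phi> s = M \<psi> s"
    using averaging_local[OF M] by metis
  define S where "S = (\<Union>t\<in>F. R t)"
  have "finite S" using F R by (auto simp: S_def)
  define \<psi> where "\<psi> t = (if t \<in> S then \<bar>\<phi> t\<bar> else 0)" for t
  have fs: "fin_supp \<psi>" unfolding fin_supp_def
    by (rule finite_subset[OF _ \<open>finite S\<close>]) (auto simp: \<psi>_def)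
  have "\<bar>M \<phi> t\<bar> powr p \<le> M \<psi> t powr p" if "t \<in> F" for t
  proof -
    have "M (\<lambda>t. \<bar>\<phi> t\<bar>) t = M \<psi> t"
      using R(2)[of t "\<lambda>t. \<bar>\<phi> t\<bar>" \<psi>] that by (auto simp: \<psi>_def S_def)
    then show ?thesis using averaging_abs_le[OF M, of \<phi> t] \<open>p > 1\<close> by (intro powr_mono2) auto
  qed
  then have "(\<Sum>t\<in>F. \<bar>M \<phi> t\<bar> powr p) \<le> (\<Sum>t\<in>F. M \<psi> t powr p)" by (rule sum_mono)
  also have "\<dots> \<le> rate p \<theta> * pow_sum p \<psi>"
    by (rule pow_sum_averaging_fin_supp[OF M \<theta> \<open>p > 1\<close> contr fs _ F]) (simp_all add: \<psi>_def)
  also have "pow_sum p \<psi> = (\<Sum>t\<in>S \<inter> \<Delta>. \<bar>\<phi> t\<bar> powr p)"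
    unfolding pow_sum_def
    by (rule infsumI[OF has_sum_finite_neutralI[where B = "S \<inter> \<Delta>"]])
      (use \<open>finite S\<close> in \<open>auto simp: \<psi>_def\<close>)
  also have "rate p \<theta> * (\<Sum>t\<in>S \<inter> \<Delta>. \<bar>\<phi> t\<bar> powr p) \<le> rate p \<theta> * pow_sum p \<phi>"
    using \<open>finite S\<close> rate_bounds[OF \<open>p > 1\<close> \<theta>] by (intro mult_left_mono sum_le_pow_sum \<phi>) auto
  finally show "(\<Sum>t\<in>F. \<bar>M \<phi> t\<bar> powr p) \<le> rate p \<theta> * pow_sum p \<phi>" .
qed

end

section \<open>Translations and invariant functions\<close>

text \<open>A weight s close to 1 keeps the contracted term of \<open>pow_sum_add_le\<close> below
  1. The witness turns s powr (1 - p) into 1 / r, with r halfway between \<theta> and 1.\<close>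

lemma exists_convex_weight:
  fixes p \<theta> :: real
  assumes "p > 1" "0 < \<theta>" "\<theta> < 1"
  obtains s where "0 < s" "s < 1" "s powr (1 - p) * \<theta> < 1"
proof
  define r where "r = (1 + \<theta>) / 2"
  define s where "s = r powr (1 / (p - 1))"
  have r: "0 < r" "r < 1" "\<theta> < r" using assms by (auto simp: r_def)
  show "0 < s" using r by (simp add: s_def)
  show "s < 1" using r assms powr_less_mono2[of "1 / (p - 1)" r 1] by (simp add: s_def)
  have "(1 / (p - 1)) * (1 - p) = - 1" using assms by (simp add: field_simps)
  then have "s powr (1 - p) = 1 / r" using r by (simp only: s_def powr_powr) (simp add: powr_minus_divide)
  then show "s powr (1 - p) * \<theta> < 1" using r by simp
qed

context triangle_system
begin

text \<open>The Neumann series of \<xi>, summed pointwise so that completeness of l^p is not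
  invoked. Its membership in l^p comes from a uniform bound on the partial sums, passed to the limit
  on finite sets as in Fatou's lemma.\<close>

lemma solve_averaging:
  assumes M: "averaging M" and \<theta>: "0 < \<theta>" "\<theta> < 1" and p: "p > 1"
    and contr: "\<And>\<phi>. lp p \<phi> \<Longrightarrow> pow_sum p (M \<phi>) \<le> \<theta> * pow_sum p \<phi>"
    and outside: "\<And>\<phi> t. t \<notin> \<Delta> \<Longrightarrow> M \<phi> t = \<phi> t"
    and \<xi>: "lp p \<xi>" "\<And>t. t \<notin> \<Delta> \<Longrightarrow> \<xi> t = 0"
  obtains \<eta> where "lp p \<eta>" "\<And>t. \<eta> t - M \<eta> t = \<xi> t"
proof
  define X where "X n = (M ^^ n) \<xi>" for n
  define S where "S n t = (\<Sum>k<n. X k t)" for n t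
  define \<eta> where "\<eta> t = (\<Sum>n. X n t)" for t
  have lpX: "lp p (X n)" "pow_sum p (X n) \<le> \<theta> ^ n * pow_sum p \<xi>" for n
  proof (induction n)
    case (Suc n)
    show "lp p (X (Suc n))" using lp_averaging[OF M p Suc(1)] by (simp add: X_def)
    show "pow_sum p (X (Suc n)) \<le> \<theta> ^ Suc n * pow_sum p \<xi>"
    proof -
      have "pow_sum p (M (X n)) \<le> \<theta> * pow_sum p (X n)" by (rule contr[OF Suc(1)])
      also have "\<dots> \<le> \<theta> * (\<theta> ^ n * pow_sum p \<xi>)"
        by (rule mult_left_mono[OF Suc(2)]) (use \<theta> in simp)
      finally show ?thesis by (simp add: X_def mult.assoc)
    qed
  qed (use \<xi> in \<open>simp_all add: X_def\<close>)
  have "summable (\<lambda>n. X n t)" for t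
  proof (cases "t \<in> \<Delta>")
    case True
    define r where "r = \<theta> powr (1 / p)"
    have r: "0 < r" "r < 1" using \<theta> p powr_less_mono2[of "1 / p" \<theta> 1] by (auto simp: r_def)
    have le: "norm (X n t) \<le> r ^ n * pow_sum p \<xi> powr (1 / p)" for n
    proof -
      have "\<bar>X n t\<bar> powr p \<le> \<theta> ^ n * pow_sum p \<xi>"
        using sum_le_pow_sum[OF lpX(1)[of n], of "{t}"] lpX(2)[of n] True by simp
      then have "(\<bar>X n t\<bar> powr p) powr (1 / p) \<le> (\<theta> ^ n * pow_sum p \<xi>) powr (1 / p)"
        using p by (intro powr_mono2) auto
      also have "\<dots> = r ^ n * pow_sum p \<xi> powr (1 / p)"
        using \<theta> pow_sum_nonneg[of p \<xi>]
        by (simp add: powr_mult r_def powr_powr mult.commute flip: powr_realpow)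
      finally show ?thesis using p by (simp add: powr_powr)
    qed
    have sm: "summable (\<lambda>n. r ^ n * pow_sum p \<xi> powr (1 / p))"
      using r by (intro summable_mult2 summable_geometric) auto
    show ?thesis by (rule summable_comparison_test'[OF sm le])
  next
    case False
    have "X n t = 0" for n
    proof (induction n)
      case 0
      show ?case using \<xi>(2)[OF False] by (simp add: X_def)
    next
      case (Suc n)
      have "X (Suc n) t = M (X n) t" by (simp add: X_def)
      with Suc outside[OF False] show ?case by simp
    qed
    then show ?thesis by simp
  qed
  then have S_lim: "(\<lambda>n. S n t) \<longlonglongrightarrow> \<eta> t" for t
    unfolding S_def \<eta>_def by (rule summable_LIMSEQ)
  have MS: "M (S n) t = S (Suc n) t - \<xi> t" for n t
  proof -
    have "M (S n) = (\<lambda>t. \<Sum>k<n. X (Suc k) t)"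
    proof (induction n)
      case 0
      then show ?case using averaging_zero[OF M] by (simp add: S_def)
    next
      case (Suc n)
      have "S (Suc n) = (\<lambda>t. S n t + X n t)" by (auto simp: S_def)
      then show ?case using Suc by (simp add: averaging_add[OF M] X_def)
    qed
    moreover have "X 0 t = \<xi> t" by (simp add: X_def)
    ultimately show ?thesis by (simp only: S_def sum.lessThan_Suc_shift)
  qed
  have "(\<lambda>n. M (S n) t) \<longlonglongrightarrow> M \<eta> t" for t
    by (rule averaging_lim[OF M S_lim])
  moreover have "(\<lambda>n. M (S n) t) \<longlonglongrightarrow> \<eta> t - \<xi> t" for t
    unfolding MS by (intro tendsto_diff tendsto_const LIMSEQ_Suc S_lim)
  ultimately have "M \<eta> t = \<eta> t - \<xi> t" for t by (rule LIMSEQ_unique)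
  then show "\<eta> t - M \<eta> t = \<xi> t" for t by simp
  obtain s where s: "0 < s" "s < 1" "s powr (1 - p) * \<theta> < 1"
    using exists_convex_weight[OF p \<theta>] .
  define \<rho> where "\<rho> = s powr (1 - p) * \<theta>"
  define A where "A = (1 - s) powr (1 - p) * pow_sum p \<xi>"
  \<comment> \<open>The partial sums satisfy S (n + 1) = \<xi> + M (S n), so their power sums are
    governed by the map x \<mapsto> A + \<rho> x; K is its fixed point.\<close>
  define K where "K = A / (1 - \<rho>)"
  have \<rho>: "0 \<le> \<rho>" "\<rho> < 1" using s \<theta> by (auto simp: \<rho>_def)
  have K: "K \<ge> 0" "A + \<rho> * K = K"
  proof -
    have "A \<ge> 0" using pow_sum_nonneg[of p \<xi>] by (simp add: A_def)
    then show "K \<ge> 0" using \<rho> by (simp add: K_def)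
    have "(1 - \<rho>) * K = A" using \<rho> by (simp add: K_def)
    then show "A + \<rho> * K = K" by (simp add: left_diff_distrib)
  qed
  have lpS: "lp p (S n)" "pow_sum p (S n) \<le> K" for n
  proof (induction n)
    case 0
    show "lp p (S 0)" "pow_sum p (S 0) \<le> K" using K by (simp_all add: S_def lp_def pow_sum_def)
  next
    case (Suc n)
    have eq: "S (Suc n) = (\<lambda>t. \<xi> t + M (S n) t)" by (simp add: MS)
    note lpM = lp_averaging[OF M p Suc(1)]
    show "lp p (S (Suc n))" unfolding eq by (rule lp_add[OF p \<xi>(1) lpM])
    have "pow_sum p (S (Suc n)) \<le> A + s powr (1 - p) * pow_sum p (M (S n))"
      unfolding eq A_def by (rule pow_sum_add_le[OF p s(1,2) \<xi>(1) lpM])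
    also have "\<dots> \<le> A + s powr (1 - p) * (\<theta> * K)"
      using order_trans[OF contr[OF Suc(1)] mult_left_mono[OF Suc(2), of \<theta>]] \<theta>
      by (intro add_left_mono mult_left_mono) auto
    also have "\<dots> = K" using K(2) by (simp add: \<rho>_def)
    finally show "pow_sum p (S (Suc n)) \<le> K" .
  qed
  show "lp p \<eta>"
  proof (rule lpI(1))
    fix F assume F: "finite F" "F \<subseteq> \<Delta>"
    have "(\<lambda>n. \<Sum>t\<in>F. \<bar>S n t\<bar> powr p) \<longlonglongrightarrow> (\<Sum>t\<in>F. \<bar>\<eta> t\<bar> powr p)"
      using p by (intro tendsto_sum tendsto_powr2 tendsto_rabs S_lim tendsto_const) auto
    moreover have "(\<Sum>t\<in>F. \<bar>S n t\<bar> powr p) \<le> K" for n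
      using sum_le_pow_sum[OF lpS(1) F, of n] lpS(2)[of n] by linarith
    ultimately show "(\<Sum>t\<in>F. \<bar>\<eta> t\<bar> powr p) \<le> K" by (intro LIMSEQ_le_const2) auto
  qed
qed

lemma fixed_by_contraction:
  assumes "\<theta> < 1" "lp p \<phi>" "pow_sum p (M \<phi>) \<le> \<theta> * pow_sum p \<phi>" "M \<phi> = \<phi>" "t \<in> \<Delta>"
  shows "\<phi> t = 0"
proof -
  have "(1 - \<theta>) * pow_sum p \<phi> \<le> 0" using assms by (simp add: algebra_simps)
  then have "pow_sum p \<phi> = 0"
    using assms pow_sum_nonneg[of p \<phi>] by (simp add: mult_le_0_iff)
  then show ?thesis using sum_le_pow_sum[OF assms(2), of "{t}"] assms by simp
qed

section \<open>Relations between the translations\<close>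

lemma rot_T_numeral [simp]:
  "rot (T 0 \<phi>) = T 1 (rot \<phi>)" "rot (T 1 \<phi>) = T 2 (rot \<phi>)"
  "rot (T (Suc 0) \<phi>) = T 2 (rot \<phi>)" "rot (T 2 \<phi>) = T 0 (rot \<phi>)"
  by (simp_all add: rot_T numeral_2_eq_2 T_add_3)

lemma T_braid_12: "T 1 (T 2 (T 1 \<phi>)) = T 2 (T 1 (T 2 \<phi>))"
  using T_braid[of 1 \<phi>] by (simp add: numeral_2_eq_2)

lemma T_braid_20: "T 2 (T 0 (T 2 \<phi>)) = T 0 (T 2 (T 0 \<phi>))"
  using T_braid[of 2 \<phi>] by (simp add: numeral_2_eq_2 T_add_3)

text \<open>
  The translations by the two fundamental coweights: straight walks along the edges of
  either type, thickened to strips of triangles.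
\<close>

definition \<tau>1 :: "('a \<times> 'a \<times> 'a \<Rightarrow> real) \<Rightarrow> 'a \<times> 'a \<times> 'a \<Rightarrow> real" where
  "\<tau>1 \<phi> = T 2 (T 1 (rot \<phi>))"

definition \<tau>2 :: "('a \<times> 'a \<times> 'a \<Rightarrow> real) \<Rightarrow> 'a \<times> 'a \<times> 'a \<Rightarrow> real" where
  "\<tau>2 \<phi> = T 1 (T 2 (rot (rot \<phi>)))"

lemma \<tau>1_cubed: "\<tau>1 (\<tau>1 (\<tau>1 \<phi>)) = T 2 (T 1 (T 0 (T 2 (T 1 (T 0 \<phi>)))))"
  by (simp add: \<tau>1_def del: One_nat_def)

lemma \<tau>2_cubed: "\<tau>2 (\<tau>2 (\<tau>2 \<phi>)) = T 1 (T 2 (T 0 (T 1 (T 2 (T 0 \<phi>)))))"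
  by (simp add: \<tau>2_def del: One_nat_def)

lemma \<tau>_commute: "\<tau>1 (\<tau>2 \<phi>) = \<tau>2 (\<tau>1 \<phi>)"
  by (simp add: \<tau>1_def \<tau>2_def T_braid_12 del: One_nat_def)

lemma T_1_\<tau>1: "\<tau>1 (T 1 \<phi>) = T 1 (\<tau>1 \<phi>)"
  by (simp add: \<tau>1_def T_braid_12 del: One_nat_def)

lemma T_2_\<tau>2: "\<tau>2 (T 2 \<phi>) = T 2 (\<tau>2 \<phi>)"
  by (simp add: \<tau>2_def T_braid_12 del: One_nat_def)

lemma averaging_\<tau>1: "averaging \<tau>1"
  unfolding \<tau>1_def[abs_def]
  by (rule averaging_comp[OF averaging_T averaging_comp[OF averaging_T averaging_rot]])

lemma averaging_\<tau>2: "averaging \<tau>2"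
  unfolding \<tau>2_def[abs_def]
  by (rule averaging_comp[OF averaging_T averaging_comp[OF averaging_T
          averaging_comp[OF averaging_rot averaging_rot]]])

definition close :: "real \<Rightarrow> ('a \<times> 'a \<times> 'a \<Rightarrow> real) \<Rightarrow> ('a \<times> 'a \<times> 'a \<Rightarrow> real) \<Rightarrow> bool" where
  "close p \<phi> \<psi> \<longleftrightarrow> lp p (\<lambda>t. \<phi> t - \<psi> t)"

lemma close_refl [simp]: "close p \<phi> \<phi>"
  by (simp add: close_def lp_def)

lemma close_sym: "close p \<phi> \<psi> \<Longrightarrow> close p \<psi> \<phi>"
  using lp_uminus[of p "\<lambda>t. \<phi> t - \<psi> t"] by (simp add: close_def)

lemma close_trans: "p > 1 \<Longrightarrow> close p \<phi> \<psi> \<Longrightarrow> close p \<psi> \<eta> \<Longrightarrow> close p \<phi> \<eta>"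
  using lp_add[of p "\<lambda>t. \<phi> t - \<psi> t" "\<lambda>t. \<psi> t - \<eta> t"] by (simp add: close_def)

lemma close_trans': "p > 1 \<Longrightarrow> close p \<phi> \<eta> \<Longrightarrow> close p \<psi> \<eta> \<Longrightarrow> close p \<phi> \<psi>"
  by (rule close_trans[OF _ _ close_sym])

lemma close_averaging: "averaging M \<Longrightarrow> p > 1 \<Longrightarrow> close p \<phi> \<psi> \<Longrightarrow> close p (M \<phi>) (M \<psi>)"
  using lp_averaging[of M p "\<lambda>t. \<phi> t - \<psi> t"] by (simp add: close_def averaging_diff)

lemma close_T: "p > 1 \<Longrightarrow> close p (T i \<phi>) \<phi> \<Longrightarrow> close p \<psi> \<phi> \<Longrightarrow> close p (T i \<psi>) \<phi>"
  using close_trans[OF _ close_averaging[OF averaging_T]] by blast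

text \<open>
  On functions of the first vertex, \<open>\<tau>1\<^sup>2\<close> and \<open>\<tau>2\<close> differ by an injective operator applied to
  \<open>T 0 (T 2 u) - T 2 u\<close>, where \<open>u = rot (rot g)\<close>.
\<close>

lemma T_0_fixed:
  assumes "\<tau>1 (\<tau>1 g) = \<tau>2 g" "T 1 g = g" "T 2 g = g"
  shows "T 0 g = g"
proof -
  define u where "u = rot (rot g)"
  have "rot (rot (T 1 g)) = rot (rot g)" "rot (rot (T 2 g)) = rot (rot g)"
    using assms by simp_all
  then have u: "T 0 u = u" "T 1 u = u" by (simp_all add: u_def)
  have "T 2 (T 1 (T 0 (T 2 u))) = T 1 (T 2 u)"
    using assms(1) by (simp add: \<tau>1_def \<tau>2_def u_def del: One_nat_def)
  also have "\<dots> = T 2 (T 1 (T 2 u))" using T_braid_12[of u] u by simp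
  finally have "T 0 (T 2 u) = T 2 u" by (simp add: T_inject)
  then have "T 2 (T 2 u) = T 2 u" using T_braid_20[of u] u by simp
  then have "rot (T 2 u) = rot u" by (simp add: T_inject)
  then show ?thesis by (simp add: u_def)
qed

end

section \<open>From almost invariant to invariant functions\<close>

context infinite_triangle_system
begin

lemma
  assumes "p > 1"
  shows pow_sum_\<tau>1_le: "lp p \<phi> \<Longrightarrow> pow_sum p (\<tau>1 (\<tau>1 (\<tau>1 \<phi>))) \<le> rate p (2999 / 3000) * pow_sum p \<phi>"
    and pow_sum_\<tau>2_le: "lp p \<phi> \<Longrightarrow> pow_sum p (\<tau>2 (\<tau>2 (\<tau>2 \<phi>))) \<le> rate p (2999 / 3000) * pow_sum p \<phi>"
proof -
  define W1 where "W1 \<phi> = T 2 (T 1 (T 0 \<phi>))" for \<phi>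
  define W2 where "W2 \<phi> = T 1 (T 2 (T 0 \<phi>))" for \<phi>
  have av: "averaging W1" "averaging W2"
    unfolding W1_def[abs_def] W2_def[abs_def]
    by (rule averaging_comp[OF averaging_T averaging_comp[OF averaging_T averaging_T]])+
  \<comment> \<open>Each cube is a product W W. One factor supplies the contraction; of the other it
    is enough that it does not increase the norm.\<close>
  have le: "sq_norm (W (W u)) \<le> 2999 / 3000 * sq_norm u"
    if W: "averaging W" "\<And>u. fin_supp u \<Longrightarrow> sq_norm (W u) \<le> 2999 / 3000 * sq_norm u"
      and u: "fin_supp u" for W u
  proof -
    have "sq_norm (W (W u)) \<le> 2999 / 3000 * sq_norm (W u)"
      by (intro W averaging_fin_supp[OF W(1)] u)
    also have "\<dots> \<le> sq_norm (W u)" using sq_norm_nonneg[of "W u"] by simp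
    also have "\<dots> \<le> 2999 / 3000 * sq_norm u" by (intro W u)
    finally show ?thesis .
  qed
  have *: "pow_sum p (W (W \<phi>)) \<le> rate p (2999 / 3000) * pow_sum p \<phi>"
    if W: "averaging W" "\<And>u. fin_supp u \<Longrightarrow> sq_norm (W u) \<le> 2999 / 3000 * sq_norm u"
      and "lp p \<phi>" for W \<phi>
    by (rule pow_sum_averaging_le[OF averaging_comp[OF W(1) W(1)] _ _ assms le[OF W] \<open>lp p \<phi>\<close>]) simp_all
  show "pow_sum p (\<tau>1 (\<tau>1 (\<tau>1 \<phi>))) \<le> rate p (2999 / 3000) * pow_sum p \<phi>" if "lp p \<phi>"
  proof -
    have "\<tau>1 (\<tau>1 (\<tau>1 \<phi>)) = W1 (W1 \<phi>)" unfolding W1_def by (rule \<tau>1_cubed)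
    moreover have "sq_norm (W1 u) \<le> 2999 / 3000 * sq_norm u" if "fin_supp u" for u
      unfolding W1_def by (rule sq_norm_T_210_le[OF that])
    ultimately show ?thesis using *[OF av(1) _ that] by simp
  qed
  show "pow_sum p (\<tau>2 (\<tau>2 (\<tau>2 \<phi>))) \<le> rate p (2999 / 3000) * pow_sum p \<phi>" if "lp p \<phi>"
  proof -
    have "\<tau>2 (\<tau>2 (\<tau>2 \<phi>)) = W2 (W2 \<phi>)" unfolding W2_def by (rule \<tau>2_cubed)
    moreover have "sq_norm (W2 u) \<le> 2999 / 3000 * sq_norm u" if "fin_supp u" for u
      unfolding W2_def by (rule sq_norm_T_120_le[OF that])
    ultimately show ?thesis using *[OF av(2) _ that] by simp
  qed
qed

theorem exists_close_invariant:
  assumes p: "p > 1" and v: "T 1 v = v" "T 2 v = v" "close p (T 0 v) v"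
  obtains g where "close p g v" "E 0 g = g" "E 1 g = g" "E 2 g = g"
proof -
  define \<theta> where "\<theta> = rate p (2999 / 3000)"
  have \<theta>: "0 < \<theta>" "\<theta> < 1" using rate_bounds[OF p, of "2999 / 3000"] by (auto simp: \<theta>_def)
  define M1 where "M1 \<phi> = \<tau>1 (\<tau>1 (\<tau>1 \<phi>))" for \<phi>
  define M2 where "M2 \<phi> = \<tau>2 (\<tau>2 (\<tau>2 \<phi>))" for \<phi>
  have M1: "averaging M1" unfolding M1_def[abs_def] 
    by (rule averaging_comp[OF averaging_\<tau>1 averaging_comp[OF averaging_\<tau>1 averaging_\<tau>1]])
  have M2: "averaging M2" unfolding M2_def[abs_def] 
    by (rule averaging_comp[OF averaging_\<tau>2 averaging_comp[OF averaging_\<tau>2 averaging_\<tau>2]])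
  have contr: "pow_sum p (M1 \<phi>) \<le> \<theta> * pow_sum p \<phi>" "pow_sum p (M2 \<phi>) \<le> \<theta> * pow_sum p \<phi>"
    if "lp p \<phi>" for \<phi>
    using pow_sum_\<tau>1_le[OF p that] pow_sum_\<tau>2_le[OF p that] by (simp_all add: M1_def M2_def \<theta>_def)
  have unique: "a = b"
    if "averaging M" "\<And>\<phi>. lp p \<phi> \<Longrightarrow> pow_sum p (M \<phi>) \<le> \<theta> * pow_sum p \<phi>"
      "close p a b" "M a = a" "M b = b" "\<And>t. t \<notin> \<Delta> \<Longrightarrow> a t = b t" for a b M
  proof
    fix t
    have fixed: "M (\<lambda>t. a t - b t) = (\<lambda>t. a t - b t)"
      by (simp only: averaging_diff[OF that(1)] that(4,5))
    show "a t = b t"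
    proof (cases "t \<in> \<Delta>")
      case True
      note c = that(3)[unfolded close_def]
      have "(\<lambda>t. a t - b t) t = 0"
        by (rule fixed_by_contraction[where M = M, OF \<theta>(2) c that(2)[OF c] fixed True])
      then show ?thesis by simp
    qed (rule that(6))
  qed
  note unique1 = unique[OF M1 contr(1)] and unique2 = unique[OF M2 contr(2)]
  have cT: "close p (T i a) v" if "close p a v" "i \<in> {0, 1, 2}" for i a
    by (rule close_T[OF p _ that(1)]) (use that v in auto)
  have "close p (M1 v) v"
    unfolding M1_def \<tau>1_cubed by (intro cT close_refl) auto
  then have \<xi>: "lp p (\<lambda>t. M1 v t - v t)" by (simp add: close_def)
  have out1: "M1 \<phi> t = \<phi> t" if "t \<notin> \<Delta>" for \<phi> t
    using that by (simp add: M1_def \<tau>1_cubed T_outside)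
  obtain \<eta> where \<eta>: "lp p \<eta>" "\<And>t. \<eta> t - M1 \<eta> t = M1 v t - v t"
    by (rule solve_averaging[OF M1 \<theta> p contr(1) out1 \<xi>]) (auto simp: out1)
  define g where "g t = v t + \<eta> t" for t
  have M1g: "M1 g = g"
  proof
    fix t
    have "M1 g = (\<lambda>t. M1 v t + M1 \<eta> t)" unfolding g_def[abs_def] by (rule averaging_add[OF M1])
    then show "M1 g t = g t" using \<eta>(2)[of t] by (simp add: g_def)
  qed
  have gv: "close p g v" using \<eta>(1) by (simp add: close_def g_def)
  note cong = close_averaging[OF _ p]
  have via_v: "close p (M g) (N g)" if "averaging M" "averaging N" "close p (M v) (N v)" for M N
    by (rule close_trans'[OF p close_trans[OF p cong[OF that(1) gv] that(3)] cong[OF that(2) gv]])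

  have T1g: "T 1 g = g"
  proof (rule unique1)
    show "close p (T 1 g) g"
      by (rule close_trans'[OF p cong[OF averaging_T gv, of 1, unfolded v(1)] gv])
    show "M1 (T 1 g) = T 1 g" using M1g by (simp only: M1_def T_1_\<tau>1)
  qed (use M1g in \<open>auto simp: T_outside\<close>)

  \<comment> \<open>Both sides rotate v by the same amount, since \<open>\<tau>1\<close> rotates
    once and \<open>\<tau>2\<close> twice. They are therefore words in the \<open>T i\<close>
    applied to one rotated function u, which every \<open>T i\<close> moves only within l^p. In
    \<open>c1\<close> the four rotations of the left side count as one.\<close>
  have c2: "close p (\<tau>1 (\<tau>1 v)) (\<tau>2 v)"
  proof -
    define u where "u = rot (rot v)"
    have "rot (rot (T 1 v)) = u" "rot (rot (T 2 v)) = u" using v by (simp_all add: u_def)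
    moreover have "close p (rot (rot (T 0 v))) u"
      unfolding u_def by (rule cong[OF averaging_rot cong[OF averaging_rot v(3)]])
    ultimately have u0: "close p (T i u) u" if "i \<in> {0, 1, 2}" for i
      using that by (auto simp: u_def)
    have u: "close p (T i a) u" if "close p a u" "i \<in> {0, 1, 2}" for i a
      by (rule close_T[OF p u0[OF that(2)] that(1)])
    have eq: "\<tau>1 (\<tau>1 v) = T 2 (T 1 (T 0 (T 2 u)))" "\<tau>2 v = T 1 (T 2 u)"
      by (simp_all add: \<tau>1_def \<tau>2_def u_def del: One_nat_def)
    have "close p (T 2 (T 1 (T 0 (T 2 u)))) u" "close p (T 1 (T 2 u)) u"
      by (intro u close_refl; simp)+
    then show ?thesis unfolding eq by (rule close_trans'[OF p])
  qed
  have c1: "close p (\<tau>2 (\<tau>2 v)) (\<tau>1 v)"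
  proof -
    define u where "u = rot v"
    have "rot (T 1 v) = u" "rot (T 2 v) = u" using v by (simp_all add: u_def)
    moreover have "close p (rot (T 0 v)) u"
      unfolding u_def by (rule cong[OF averaging_rot v(3)])
    ultimately have u0: "close p (T i u) u" if "i \<in> {0, 1, 2}" for i
      using that by (auto simp: u_def)
    have u: "close p (T i a) u" if "close p a u" "i \<in> {0, 1, 2}" for i a
      by (rule close_T[OF p u0[OF that(2)] that(1)])
    have eq: "\<tau>2 (\<tau>2 v) = T 1 (T 2 (T 0 (T 1 u)))" "\<tau>1 v = T 2 (T 1 u)"
      by (simp_all add: \<tau>1_def \<tau>2_def u_def del: One_nat_def)
    have "close p (T 1 (T 2 (T 0 (T 1 u)))) u" "close p (T 2 (T 1 u)) u"
      by (intro u close_refl; simp)+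
    then show ?thesis unfolding eq by (rule close_trans'[OF p])
  qed

  have \<tau>11: "\<tau>1 (\<tau>1 g) = \<tau>2 g"
  proof (rule unique1)
    show "close p (\<tau>1 (\<tau>1 g)) (\<tau>2 g)"
      by (rule via_v[OF averaging_comp[OF averaging_\<tau>1 averaging_\<tau>1] averaging_\<tau>2 c2])
    show "M1 (\<tau>1 (\<tau>1 g)) = \<tau>1 (\<tau>1 g)" using M1g by (simp add: M1_def)
    show "M1 (\<tau>2 g) = \<tau>2 g" using M1g by (simp only: M1_def \<tau>_commute)
  qed (simp_all add: contr \<tau>1_def \<tau>2_def T_outside del: One_nat_def)
  have \<tau>22: "\<tau>2 (\<tau>2 g) = \<tau>1 g"
  proof (rule unique1)
    show "close p (\<tau>2 (\<tau>2 g)) (\<tau>1 g)"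
      by (rule via_v[OF averaging_comp[OF averaging_\<tau>2 averaging_\<tau>2] averaging_\<tau>1 c1])
    show "M1 (\<tau>2 (\<tau>2 g)) = \<tau>2 (\<tau>2 g)" using M1g by (simp only: M1_def \<tau>_commute)
    show "M1 (\<tau>1 g) = \<tau>1 g" using M1g by (simp add: M1_def)
  qed (simp_all add: contr \<tau>1_def \<tau>2_def T_outside del: One_nat_def)
  \<comment> \<open>On g the two relations turn the cube of \<open>\<tau>2\<close> into the cube of
    \<open>\<tau>1\<close>. This makes the contraction \<open>M2\<close>, which commutes with
    \<open>T 2\<close>, usable.\<close>
  have "M2 g = \<tau>1 (\<tau>2 g)" by (simp add: M2_def \<tau>22 \<tau>_commute)
  also have "\<dots> = g" using M1g by (simp add: M1_def flip: \<tau>11)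
  finally have M2g: "M2 g = g" .
  have T2g: "T 2 g = g"
  proof (rule unique2)
    show "close p (T 2 g) g"
      by (rule close_trans'[OF p cong[OF averaging_T gv, of 2, unfolded v(2)] gv])
    show "M2 (T 2 g) = T 2 g" using M2g by (simp only: M2_def T_2_\<tau>2)
  qed (use M2g in \<open>auto simp: T_outside\<close>)
  have "T 0 g = g" by (rule T_0_fixed[OF \<tau>11 T1g T2g])
  with T1g T2g gv show thesis by (intro that) (simp_all add: T_fixed_iff)
qed

end

section \<open>Links and triangles of a building\<close>

context projective_plane
begin

lemma line_of_points:
  "p \<in> P \<Longrightarrow> q \<in> P \<Longrightarrow> p \<noteq> q \<Longrightarrow> \<exists>l\<in>L. incident p l \<and> incident q l"
  using unique_line by blast

lemma line_eq:
  assumes "l \<in> L" "m \<in> L" "p \<in> P" "q \<in> P" "p \<noteq> q"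
    and "incident p l" "incident q l" "incident p m" "incident q m"
  shows "l = m"
  using unique_line[OF assms(3-5)] assms by blast

lemma another_point:
  assumes "l \<in> L"
  shows "\<exists>a\<in>P. a \<noteq> p \<and> incident a l"
  using three_points[OF assms] by metis

lemma third_point:
  assumes "l \<in> L"
  shows "\<exists>c\<in>P. c \<noteq> a \<and> c \<noteq> b \<and> incident c l"
  using three_points[OF assms] by metis

text \<open>A third point on a line joining a point of l to a point of m, both different from the
  intersection of l and m, lies on neither.\<close>

lemma point_off_lines:
  assumes "l \<in> L" "m \<in> L"
  shows "\<exists>p\<in>P. \<not> incident p l \<and> \<not> incident p m"
proof -
  have *: "\<exists>p\<in>P. \<not> incident p l \<and> \<not> incident p m" if lm: "l \<in> L" "m \<in> L" "l \<noteq> m" for l m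
  proof -
    obtain x where x: "x \<in> P" "incident x l" "incident x m" using unique_point[OF lm] by blast
    obtain a where a: "a \<in> P" "a \<noteq> x" "incident a l" using another_point[OF lm(1)] by blast
    obtain b where b: "b \<in> P" "b \<noteq> x" "incident b m" using another_point[OF lm(2)] by blast
    have am: "\<not> incident a m" using line_eq[OF lm(1,2) x(1) a(1)] x a lm(3) by blast
    have bl: "\<not> incident b l" using line_eq[OF lm(1,2) x(1) b(1)] x b lm(3) by blast
    have "a \<noteq> b" using am b by blast
    then obtain n where n: "n \<in> L" "incident a n" "incident b n"
      using line_of_points a b by blast
    obtain c where c: "c \<in> P" "c \<noteq> a" "c \<noteq> b" "incident c n" using third_point[OF n(1)] by blast
    have "\<not> incident c l" using line_eq[OF n(1) lm(1) a(1) c(1)] n a c bl by blast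
    moreover have "\<not> incident c m" using line_eq[OF n(1) lm(2) b(1) c(1)] n b c am by blast
    ultimately show ?thesis using c by blast
  qed
  show ?thesis
  proof (cases "l = m")
    case True
    obtain l' m' where "l' \<in> L" "m' \<in> L" "l' \<noteq> m'" using two_lines by blast
    then obtain n where "n \<in> L" "n \<noteq> l" by metis
    with *[of n l] assms True show ?thesis by blast
  qed (use * assms in blast)
qed

lemma line_off_point:
  assumes "p \<in> P"
  shows "\<exists>l\<in>L. \<not> incident p l"
proof -
  obtain l m where lm: "l \<in> L" "m \<in> L" "l \<noteq> m" using two_lines by blast
  obtain a where a: "a \<in> P" "a \<noteq> p" "incident a l" using another_point[OF lm(1)] by blast
  obtain b where b: "b \<in> P" "b \<noteq> p" "incident b m" using another_point[OF lm(2)] by blast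
  show ?thesis
  proof (rule ccontr)
    assume "\<not> ?thesis"
    then have all: "incident p l" if "l \<in> L" for l using that by blast
    have bl: "\<not> incident b l" using line_eq[OF lm(1,2) assms b(1)] all lm b by blast
    then have "a \<noteq> b" using a by blast
    then obtain n where n: "n \<in> L" "incident a n" "incident b n"
      using line_of_points a b by blast
    then show False using line_eq[OF n(1) lm(1) assms a(1)] all lm(1) a bl by blast
  qed
qed

text \<open>The perspectivity with center p: a line through p corresponds to its intersection with
  l.\<close>

lemma card_pencil:
  assumes "p \<in> P" "l \<in> L" "\<not> incident p l"
  shows "card {m\<in>L. incident p m} = card {r\<in>P. incident r l}"
proof -
  have "\<exists>!m. m \<in> L \<and> incident p m \<and> incident r m" if "r \<in> P" "incident r l" for r
    using unique_line[of p r] that assms by blast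
  then obtain j where j: "\<And>r. r \<in> P \<Longrightarrow> incident r l \<Longrightarrow> j r \<in> L \<and> incident p (j r) \<and> incident r (j r)"
    and j': "\<And>r m. r \<in> P \<Longrightarrow> incident r l \<Longrightarrow> m \<in> L \<Longrightarrow> incident p m \<Longrightarrow> incident r m \<Longrightarrow> m = j r"
    by metis
  have "bij_betw j {r\<in>P. incident r l} {m\<in>L. incident p m}"
    unfolding bij_betw_def
  proof
    show "inj_on j {r\<in>P. incident r l}"
    proof (rule inj_onI, clarify)
      fix r s assume r: "r \<in> P" "incident r l" and s: "s \<in> P" "incident s l" and "j r = j s"
      then have "incident r (j r)" "incident s (j r)" "j r \<in> L" "incident p (j r)"
        using j[of r] j[of s] by auto
      then show "r = s" using line_eq[OF assms(2) _ r(1) s(1) _ r(2) s(2), of "j r"] assms(3) by blast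
    qed
    show "j ` {r\<in>P. incident r l} = {m\<in>L. incident p m}"
    proof
      show "j ` {r\<in>P. incident r l} \<subseteq> {m\<in>L. incident p m}" using j by auto
      show "{m\<in>L. incident p m} \<subseteq> j ` {r\<in>P. incident r l}"
      proof clarify
        fix m assume m: "m \<in> L" "incident p m"
        then obtain r where r: "r \<in> P" "incident r l" "incident r m"
          using unique_point[OF assms(2) m(1)] assms(3) by blast
        then show "m \<in> j ` {r\<in>P. incident r l}" using j'[OF r(1,2) m r(3)] by blast
      qed
    qed
  qed
  then show ?thesis by (simp add: bij_betw_same_card)
qed

text \<open>Two lines are compared through a point off both, whose pencil is in bijection with
  either.\<close>

lemma plane_order:
  obtains n where "\<And>l. l \<in> L \<Longrightarrow> card {r\<in>P. incident r l} = n"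
    and "\<And>p. p \<in> P \<Longrightarrow> card {m\<in>L. incident p m} = n"
proof -
  obtain l0 where l0: "l0 \<in> L" using two_lines by blast
  show ?thesis
  proof (rule that)
    show lines: "card {r\<in>P. incident r l} = card {r\<in>P. incident r l0}" if l: "l \<in> L" for l
      using point_off_lines[OF l l0] card_pencil[OF _ l] card_pencil[OF _ l0] by metis
    show "card {m\<in>L. incident p m} = card {r\<in>P. incident r l0}" if "p \<in> P" for p
      using line_off_point[OF that] card_pencil[OF that] lines by metis
  qed
qed

end

lemma type3_neq: "t + 1 \<noteq> (t :: 3)" "t + 2 \<noteq> (t :: 3)" "t + 1 \<noteq> (t + 2 :: 3)"
  by simp_all

lemma type3_cases: "a = t \<or> a = t + 1 \<or> a = t + (2 :: 3)"
proof -
  have "card {t, t + 1, t + 2} = card (UNIV :: 3 set)" using type3_neq[of t] by simp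
  then have "{t, t + 1, t + 2} = UNIV" by (intro card_subset_eq) auto
  then show ?thesis by blast
qed

lemma type3_add: "t + 1 + 2 = (t :: 3)" "t + 1 + 1 = t + (2 :: 3)" "t + 2 + 1 = (t :: 3)" "t + 2 + 2 = t + (1 :: 3)"
  by simp_all

section \<open>Links of vertices\<close>

locale locally_finite_building = A2_tilde_building X vtype
  for X :: "'a set set" and vtype +
  assumes locally_finite: "locally_finite X"
begin

lemma subsimplex: "s \<in> X \<Longrightarrow> t \<subseteq> s \<Longrightarrow> t \<noteq> {} \<Longrightarrow> t \<in> X"
  using complex unfolding abstract_simplicial_complex_def by blast

lemma vertex_iff: "v \<in> vertices X \<longleftrightarrow> {v} \<in> X"
proof
  assume "v \<in> vertices X"
  then obtain s where "s \<in> X" "v \<in> s" by (auto simp: vertices_def)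
  then show "{v} \<in> X" by (intro subsimplex[OF \<open>s \<in> X\<close>]) auto
qed (auto simp: vertices_def)

definition nbrs :: "'a \<Rightarrow> 'a set" where "nbrs v = {x. x \<noteq> v \<and> {v, x} \<in> X}"

text \<open>Read in the link of v, \<open>third v x\<close> is the set of neighbours of x
  there.\<close>

definition third :: "'a \<Rightarrow> 'a \<Rightarrow> 'a set" where
  "third x y = {z. x \<noteq> y \<and> z \<noteq> x \<and> z \<noteq> y \<and> {x, y, z} \<in> X}"

lemma nbrs_iff: "x \<in> nbrs v \<longleftrightarrow> (v, x) \<in> oriented_edges X"
  by (auto simp: nbrs_def oriented_edges_def)

lemma nbrs_sym: "x \<in> nbrs v \<longleftrightarrow> v \<in> nbrs x"
  by (auto simp: nbrs_def insert_commute)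

lemma nbrs_vertex: "x \<in> nbrs v \<Longrightarrow> v \<in> vertices X" "x \<in> nbrs v \<Longrightarrow> x \<in> vertices X"
  by (auto simp: nbrs_def vertices_def)

lemma third_sym: "third x y = third y x"
  by (auto simp: third_def insert_commute)

lemma third_rotate: "z \<in> third x y \<longleftrightarrow> x \<in> third y z"
  by (auto simp: third_def insert_commute)

lemma third_nbrs: "z \<in> third x y \<Longrightarrow> z \<in> nbrs x" "z \<in> third x y \<Longrightarrow> y \<in> nbrs x"
  using subsimplex[of "{x, y, z}"] by (auto simp: third_def nbrs_def)

lemma vtype_nbrs: "x \<in> nbrs v \<Longrightarrow> vtype x \<noteq> vtype v"
  using vtype_adjacent[of v x] by (auto simp: nbrs_iff)

text \<open>Restates the plane structure without reference to the isomorphism: types tell points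
  from lines. Two points of the link have a common neighbour, the line joining them, whose type
  differs from theirs and from that of v; as there are only three types, the two points have the
  same one. So neighbours of v of equal type are either both points or both lines.\<close>

lemma link_plane:
  assumes "v \<in> vertices X"
  obtains n where "\<And>x. x \<in> nbrs v \<Longrightarrow> card (third v x) = n" "n \<ge> 3" "nbrs v \<noteq> {}"
    and "\<And>x x'. x \<in> nbrs v \<Longrightarrow> x' \<in> nbrs v \<Longrightarrow> x \<noteq> x' \<Longrightarrow> vtype x = vtype x' \<Longrightarrow>
      \<exists>!y. y \<in> third v x \<and> y \<in> third v x'"
proof -
  obtain P :: "'a set" and L :: "'a set" and incident f where plane: "projective_plane P L incident"
    and iso: "simplicial_isomorphism f (link X v) (incidence_graph P L incident)"
    using links[OF assms] by blast
  interpret projective_plane P L incident by (rule plane)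
  have vert: "vertices (link X v) = nbrs v"
  proof
    show "nbrs v \<subseteq> vertices (link X v)"
      by (auto simp: nbrs_def vertices_def link_def intro!: exI[of _ "{_}"])
    show "vertices (link X v) \<subseteq> nbrs v"
    proof
      fix x assume "x \<in> vertices (link X v)"
      then obtain s where s: "x \<in> s" "v \<notin> s" "insert v s \<in> X"
        by (auto simp: vertices_def link_def)
      then have "{v, x} \<in> X" by (intro subsimplex[OF s(3)]) auto
      with s show "x \<in> nbrs v" by (auto simp: nbrs_def)
    qed
  qed
  have inj: "inj_on f (nbrs v)" and img: "(`) f ` link X v = incidence_graph P L incident"
    using iso by (auto simp: simplicial_isomorphism_def vert)
  have link_sub: "s \<subseteq> nbrs v" if "s \<in> link X v" for s using that vert by (auto simp: vertices_def)
  have link_iff: "s \<in> link X v \<longleftrightarrow> f ` s \<in> incidence_graph P L incident" if "s \<subseteq> nbrs v" for s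
  proof
    assume "f ` s \<in> incidence_graph P L incident"
    then obtain s' where s': "s' \<in> link X v" "f ` s = f ` s'" unfolding img[symmetric] by auto
    then have "s = s'" using inj_on_image_eq_iff[OF inj that link_sub] by blast
    with s' show "s \<in> link X v" by simp
  qed (use img in blast)
  have fP: "f x \<in> P <+> L" if "x \<in> nbrs v" for x
  proof -
    have "{x} \<in> link X v" using that by (auto simp: link_def nbrs_def)
    then have "{f x} \<in> incidence_graph P L incident" using link_iff[of "{x}"] that by simp
    then show ?thesis by (cases "f x") (auto simp: incidence_graph_def doubleton_eq_iff)
  qed
  have surj: "\<exists>x\<in>nbrs v. f x = u" if "u \<in> P <+> L" for u
  proof -
    have "{u} \<in> incidence_graph P L incident" using that by (auto simp: incidence_graph_def)
    then obtain s where s: "s \<in> link X v" "f ` s = {u}" unfolding img[symmetric] by auto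
    have "u \<in> f ` s" using s(2) by simp
    then obtain x where "x \<in> s" "f x = u" by blast
    with link_sub[OF s(1)] show ?thesis by blast
  qed
  have third_iff: "y \<in> third v x \<longleftrightarrow> y \<in> nbrs v \<and>
      (\<exists>p l. p \<in> P \<and> l \<in> L \<and> incident p l \<and> (f x = Inl p \<and> f y = Inr l \<or> f x = Inr l \<and> f y = Inl p))"
    if x: "x \<in> nbrs v" for x y
  proof (cases "y \<in> nbrs v")
    case True
    have "y \<in> third v x \<longleftrightarrow> x \<noteq> y \<and> {x, y} \<in> link X v"
      using x True by (auto simp: third_def link_def nbrs_def)
    also have "\<dots> \<longleftrightarrow> f x \<noteq> f y \<and> {f x, f y} \<in> incidence_graph P L incident"
      using link_iff[of "{x, y}"] x True inj by (auto simp: inj_on_eq_iff)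
    also have "\<dots> \<longleftrightarrow> (\<exists>p l. p \<in> P \<and> l \<in> L \<and> incident p l \<and>
        (f x = Inl p \<and> f y = Inr l \<or> f x = Inr l \<and> f y = Inl p))"
      by (auto simp: incidence_graph_def doubleton_eq_iff)
    finally show ?thesis using True by simp
  next
    case False
    then show ?thesis using third_nbrs by blast
  qed
  have third_point: "y \<in> third v x \<longleftrightarrow> y \<in> nbrs v \<and> (\<exists>l. l \<in> L \<and> incident p l \<and> f y = Inr l)"
    if "x \<in> nbrs v" "f x = Inl p" for x y p
    using third_iff[OF that(1), of y] that fP[OF that(1)] by auto
  have third_line: "y \<in> third v x \<longleftrightarrow> y \<in> nbrs v \<and> (\<exists>p. p \<in> P \<and> incident p l \<and> f y = Inl p)"
    if "x \<in> nbrs v" "f x = Inr l" for x y l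
    using third_iff[OF that(1), of y] that fP[OF that(1)] by auto
  have card_point: "card (third v x) = card {l\<in>L. incident p l}" if "x \<in> nbrs v" "f x = Inl p" for x p
  proof -
    have "f ` third v x = Inr ` {l\<in>L. incident p l}"
    proof
      show "Inr ` {l\<in>L. incident p l} \<subseteq> f ` third v x"
        using surj third_point[OF that] by (force simp: image_iff)
    qed (use third_point[OF that] in auto)
    moreover have "inj_on f (third v x)" using inj by (rule inj_on_subset) (use third_nbrs in blast)
    ultimately show ?thesis by (metis card_image inj_Inr inj_on_subset subset_UNIV)
  qed
  have card_line: "card (third v x) = card {p\<in>P. incident p l}" if "x \<in> nbrs v" "f x = Inr l" for x l
  proof -
    have "f ` third v x = Inl ` {p\<in>P. incident p l}"
    proof
      show "Inl ` {p\<in>P. incident p l} \<subseteq> f ` third v x"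
        using surj third_line[OF that] by (force simp: image_iff)
    qed (use third_line[OF that] in auto)
    moreover have "inj_on f (third v x)" using inj by (rule inj_on_subset) (use third_nbrs in blast)
    ultimately show ?thesis by (metis card_image inj_Inl inj_on_subset subset_UNIV)
  qed
  obtain n where n: "\<And>l. l \<in> L \<Longrightarrow> card {r\<in>P. incident r l} = n"
    "\<And>p. p \<in> P \<Longrightarrow> card {m\<in>L. incident p m} = n" using plane_order by blast
  have card_n: "card (third v x) = n" if "x \<in> nbrs v" for x
    using fP[OF that] card_point[OF that] card_line[OF that] n by auto
  obtain l0 where l0: "l0 \<in> L" using two_lines by blast
  then obtain x0 where x0: "x0 \<in> nbrs v" "f x0 = Inr l0" using surj by blast
  have fin: "finite (nbrs v)"
  proof -
    have "nbrs v \<subseteq> \<Union>{s\<in>X. v \<in> s}" by (auto simp: nbrs_def)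
    moreover have "finite (\<Union>{s\<in>X. v \<in> s})"
      using locally_finite assms complex
      by (intro finite_Union) (simp_all add: locally_finite_def abstract_simplicial_complex_def)
    ultimately show ?thesis by (rule finite_subset)
  qed
  \<comment> \<open>\<open>card\<close> is 0 on infinite sets, so the bound rests on the finiteness
    of P, obtained from local finiteness through \<open>fin\<close>.\<close>
  have "n \<ge> 3"
  proof -
    obtain a b c where abc: "a \<in> P" "b \<in> P" "c \<in> P" "a \<noteq> b" "b \<noteq> c" "a \<noteq> c"
      "incident a l0" "incident b l0" "incident c l0" using three_points[OF l0] by blast
    have "finite P"
    proof (rule finite_imageD)
      show "finite (Inl ` P :: ('a + 'a) set)"
        by (rule finite_subset[of _ "f ` nbrs v"]) (use surj fin in \<open>force+\<close>)
    qed auto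
    then have "card {a, b, c} \<le> card {p\<in>P. incident p l0}" using abc by (intro card_mono) auto
    then show ?thesis using abc n(1)[OF l0] by simp
  qed
  obtain \<alpha> where \<alpha>: "\<And>x p. x \<in> nbrs v \<Longrightarrow> f x = Inl p \<Longrightarrow> vtype x = \<alpha>"
  proof -
    obtain p0 where p0: "p0 \<in> P" using three_points[OF l0] by blast
    then obtain y0 where y0: "y0 \<in> nbrs v" "f y0 = Inl p0" using surj by blast
    have "vtype x = vtype y0" if x: "x \<in> nbrs v" "f x = Inl p" for x p
    proof (cases "p = p0")
      case True
      then show ?thesis using inj x y0 by (metis inj_on_eq_iff)
    next
      case False
      have "p \<in> P" using fP[OF x(1)] x by auto
      then obtain l where l: "l \<in> L" "incident p l" "incident p0 l"
        using line_of_points p0 False by blast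
      obtain y where y: "y \<in> nbrs v" "f y = Inr l" using surj l by blast
      have "y \<in> third v x" "y \<in> third v y0" using third_point x y0 y l by blast+
      then have "y \<in> nbrs x" "y \<in> nbrs y0" using third_nbrs third_rotate third_sym by blast+
      then have "vtype y \<noteq> vtype x" "vtype y \<noteq> vtype y0" by (auto dest: vtype_nbrs)
      moreover have "vtype x \<noteq> vtype v" "vtype y0 \<noteq> vtype v" "vtype y \<noteq> vtype v"
        using x y0 y vtype_nbrs by blast+
      ultimately show ?thesis
        using type3_cases[of "vtype x" "vtype v"] type3_cases[of "vtype y0" "vtype v"]
          type3_cases[of "vtype y" "vtype v"] by metis
    qed
    then show thesis using that by blast
  qed
  have \<beta>: "vtype x \<noteq> \<alpha>" if x: "x \<in> nbrs v" "f x = Inr l" for x l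
  proof -
    have "l \<in> L" using fP[OF x(1)] x by auto
    then obtain p where p: "p \<in> P" "incident p l" using three_points by blast
    then obtain y where y: "y \<in> nbrs v" "f y = Inl p" using surj by blast
    have "y \<in> third v x" using third_line[OF x] y p by blast
    then have "y \<in> nbrs x" using third_nbrs third_rotate third_sym by blast
    then show ?thesis using vtype_nbrs \<alpha>[OF y] by blast
  qed
  have "\<exists>!y. y \<in> third v x \<and> y \<in> third v x'"
    if x: "x \<in> nbrs v" "x' \<in> nbrs v" "x \<noteq> x'" "vtype x = vtype x'" for x x'
  proof (cases "f x")
    case (Inl p)
    then obtain p' where p': "f x' = Inl p'" using \<alpha>[OF x(1) Inl] \<beta>[OF x(2)] x(4) by (cases "f x'") auto
    have "p \<noteq> p'" using Inl p' x inj by (metis inj_on_eq_iff)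
    moreover have "p \<in> P" "p' \<in> P" using fP x Inl p' by force+
    ultimately obtain l where l: "l \<in> L" "incident p l" "incident p' l"
      "\<And>m. m \<in> L \<Longrightarrow> incident p m \<Longrightarrow> incident p' m \<Longrightarrow> m = l" using unique_line by metis
    obtain y where y: "y \<in> nbrs v" "f y = Inr l" using surj l(1) by blast
    show ?thesis
    proof (rule ex1I[of _ y])
      show "y \<in> third v x \<and> y \<in> third v x'"
        using third_point[OF x(1) Inl] third_point[OF x(2) p'] y l by blast
      fix y' assume "y' \<in> third v x \<and> y' \<in> third v x'"
      then obtain m m' where "y' \<in> nbrs v" "m \<in> L" "incident p m" "f y' = Inr m"
        "incident p' m'" "f y' = Inr m'"
        using third_point[OF x(1) Inl] third_point[OF x(2) p'] by blast
      then have "y' \<in> nbrs v" "f y' = f y" using l(4)[of m] y by auto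
      then show "y' = y" using inj y(1) by (metis inj_on_eq_iff)
    qed
  next
    case (Inr l)
    then obtain l' where l': "f x' = Inr l'" using \<alpha>[OF x(2)] \<beta>[OF x(1) Inr] x(4) by (cases "f x'") auto
    have "l \<noteq> l'" using Inr l' x inj by (metis inj_on_eq_iff)
    moreover have "l \<in> L" "l' \<in> L" using fP x Inr l' by force+
    ultimately obtain p where p: "p \<in> P" "incident p l" "incident p l'"
      "\<And>r. r \<in> P \<Longrightarrow> incident r l \<Longrightarrow> incident r l' \<Longrightarrow> r = p" using unique_point by metis
    obtain y where y: "y \<in> nbrs v" "f y = Inl p" using surj p(1) by blast
    show ?thesis
    proof (rule ex1I[of _ y])
      show "y \<in> third v x \<and> y \<in> third v x'"
        using third_line[OF x(1) Inr] third_line[OF x(2) l'] y p by blast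
      fix y' assume "y' \<in> third v x \<and> y' \<in> third v x'"
      then obtain m m' where "y' \<in> nbrs v" "m \<in> P" "incident m l" "f y' = Inl m"
        "incident m' l'" "f y' = Inl m'"
        using third_line[OF x(1) Inr] third_line[OF x(2) l'] by blast
      then have "y' \<in> nbrs v" "f y' = f y" using p(4)[of m] y by auto
      then show "y' = y" using inj y(1) by (metis inj_on_eq_iff)
    qed
  qed
  with card_n \<open>n \<ge> 3\<close> x0 show thesis by (intro that[of n]) auto
qed

end

text \<open>The library has this only for subsets of normed spaces.\<close>

lemma path_connected_if_simply_connected:
  fixes S :: "'a :: topological_space set"
  assumes "simply_connected S"
  shows "path_connected S"
  unfolding path_connected_def
proof (intro ballI)
  fix a b assume ab: "a \<in> S" "b \<in> S"
  have loop: "path (\<lambda>_. c)" "pathfinish (\<lambda>_. c) = pathstart (\<lambda>_. c)" "path_image (\<lambda>_. c) \<subseteq> S"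
    if "c \<in> S" for c
    using that by (auto simp: path_def pathfinish_def pathstart_def path_image_def)
  have "homotopic_loops S (\<lambda>_. a) (\<lambda>_. b)"
    using assms loop[OF ab(1)] loop[OF ab(2)] unfolding simply_connected_def by blast
  then obtain h where h: "continuous_on ({0..1 :: real} \<times> {0..1 :: real}) h" "h \<in> ({0..1} \<times> {0..1}) \<rightarrow> S"
    "\<forall>x\<in>{0..1}. h (0, x) = a" "\<forall>x\<in>{0..1}. h (1, x) = b"
    unfolding homotopic_loops by blast
  have "continuous_on {0..1} (\<lambda>t. h (t, 0))"
    by (rule continuous_on_compose2[OF h(1)]) (auto intro!: continuous_intros)
  moreover have "h (t, 0) \<in> S" if "t \<in> {0..1}" for t
    using h(2) that by auto
  ultimately show "\<exists>g. path g \<and> path_image g \<subseteq> S \<and> pathstart g = a \<and> pathfinish g = b"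
    using h(3,4)
    by (intro exI[of _ "\<lambda>t. h (t, 0)"]) (auto simp: path_def path_image_def pathstart_def pathfinish_def)
qed

section \<open>Connectedness and the order of the building\<close>

context locally_finite_building
begin

text \<open>The points of the realization with a positive coordinate in S, and those with one
  outside S, form two open sets that cover it. A point in both would lie in a simplex with an edge
  from S to its complement.\<close>

lemma vertices_connected:
  assumes S: "S \<subseteq> vertices X" "S \<noteq> {}" and step: "\<And>v w. v \<in> S \<Longrightarrow> w \<in> nbrs v \<Longrightarrow> w \<in> S"
  shows "S = vertices X"
proof (rule ccontr)
  assume "S \<noteq> vertices X"
  then obtain w0 where w0: "w0 \<in> vertices X" "w0 \<notin> S" using S by blast
  obtain v0 where v0: "v0 \<in> S" using S by blast
  let ?R = "geometric_realization X"
  define U where "U A = (\<Union>v\<in>A. {t :: 'a \<Rightarrow> real. 0 < t v})" for A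
  have op: "open (U A)" for A
    unfolding U_def by (intro open_UN ballI open_Collect_less continuous_on_const continuous_on_product_coordinates)
  have conn: "connected ?R"
    by (intro path_connected_imp_connected path_connected_if_simply_connected simply_connected)
  have disj: "U S \<inter> U (- S) \<inter> ?R = {}"
  proof (rule ccontr)
    assume "U S \<inter> U (- S) \<inter> ?R \<noteq> {}"
    then obtain t v w where t: "t \<in> ?R" "v \<in> S" "0 < t v" "w \<notin> S" "0 < t w" by (auto simp: U_def)
    then have "{v. t v \<noteq> 0} \<in> X" by (simp add: geometric_realization_def)
    then have "{v, w} \<in> X" by (rule subsimplex) (use t in auto)
    with t have "w \<in> nbrs v" by (auto simp: nbrs_def)
    with step[OF t(2)] t show False by blast
  qed
  have cover: "?R \<subseteq> U S \<union> U (- S)"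
  proof
    fix t assume t: "t \<in> ?R"
    then have "{v. t v \<noteq> 0} \<in> X" by (simp add: geometric_realization_def)
    then have "{v. t v \<noteq> 0} \<noteq> {}"
      using complex unfolding abstract_simplicial_complex_def by blast
    then obtain v where "t v \<noteq> 0" by blast
    moreover have "0 \<le> t v" using t by (auto simp: geometric_realization_def)
    ultimately have "0 < t v" by simp
    then show "t \<in> U S \<union> U (- S)" by (cases "v \<in> S") (auto simp: U_def)
  qed
  have "U S \<inter> ?R = {} \<or> U (- S) \<inter> ?R = {}"
    by (rule connectedD[OF conn op op disj cover])
  moreover have "(\<lambda>x. if x = v then 1 else 0) \<in> ?R" if "v \<in> vertices X" for v
  proof -
    have "{x. (if x = v then 1 else 0 :: real) \<noteq> 0} = {v}" by auto
    then show ?thesis using that by (simp add: geometric_realization_def vertex_iff)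
  qed
  then have "(\<lambda>x. if x = v0 then 1 else 0) \<in> U S \<inter> ?R" "(\<lambda>x. if x = w0 then 1 else 0) \<in> U (- S) \<inter> ?R"
    using v0 w0 S by (auto simp: U_def)
  ultimately show False by blast
qed

text \<open>The orders of the planes at two adjacent vertices agree, because both count the
  triangles on their common edge.\<close>

lemma building_order:
  obtains q where "q \<ge> 2" "\<And>v x. x \<in> nbrs v \<Longrightarrow> card (third v x) = q + 1"
proof -
  obtain s where "s \<in> X" "card s = 3" using dimension by (auto simp: two_dimensional_def)
  then have "s \<noteq> {}" by auto
  with \<open>s \<in> X\<close> obtain v0 where v0: "v0 \<in> vertices X" by (auto simp: vertices_def)
  obtain n where n: "\<And>x. x \<in> nbrs v0 \<Longrightarrow> card (third v0 x) = n" "n \<ge> 3" using link_plane[OF v0] by metis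
  define S where "S = {v \<in> vertices X. \<forall>x\<in>nbrs v. card (third v x) = n}"
  have "S = vertices X"
  proof (rule vertices_connected)
    show "S \<noteq> {}" using v0 n by (auto simp: S_def)
    fix v w assume v: "v \<in> S" and w: "w \<in> nbrs v"
    obtain m where m: "\<And>x. x \<in> nbrs w \<Longrightarrow> card (third w x) = m"
      using link_plane[OF nbrs_vertex(2)[OF w]] by metis
    have "m = card (third w v)" using m w nbrs_sym by blast
    also have "\<dots> = n" using v w by (simp add: S_def third_sym[of w])
    finally show "w \<in> S" using m nbrs_vertex[OF w] by (auto simp: S_def)
  qed (auto simp: S_def)
  then have "card (third v x) = (n - 1) + 1" if "x \<in> nbrs v" for v x
    using that n(2) nbrs_vertex(1)[OF that] by (auto simp: S_def)
  with n(2) show thesis by (intro that[of "n - 1"]) auto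
qed

section \<open>Typed triangles and galleries\<close>

text \<open>Every triangle of the building occurs three times, once per choice of the first vertex,
  always in the cyclic order of types. Changing one vertex preserves types, so the type of the first
  vertex is constant on components of \<open>adjacent\<close>.\<close>

definition triangles :: "('a \<times> 'a \<times> 'a) set" where
  "triangles = {(x, y, z). z \<in> third x y \<and> vtype y = vtype x + 1 \<and> vtype z = vtype x + 2}"

lemma third_type:
  assumes "z \<in> third x y" "vtype y = vtype x + 1"
  shows "vtype z = vtype x + 2"
proof -
  have "z \<in> nbrs x" "z \<in> nbrs y"
    using assms third_nbrs third_sym by blast+
  then show ?thesis using vtype_nbrs assms(2) type3_cases[of "vtype z" "vtype x"] by metis
qed

lemma triangles_iff: "(x, y, z) \<in> triangles \<longleftrightarrow> z \<in> third x y \<and> vtype y = vtype x + 1"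
  using third_type by (auto simp: triangles_def)

lemma triangles_rotate: "(x, y, z) \<in> triangles \<Longrightarrow> (y, z, x) \<in> triangles"
proof -
  assume "(x, y, z) \<in> triangles"
  then have "z \<in> third x y" "vtype y = vtype x + 1" "vtype z = vtype x + 2"
    by (auto simp: triangles_def)
  then show ?thesis by (simp add: triangles_iff third_rotate type3_add)
qed

lemma triangles_iff2: "(x, y, z) \<in> triangles \<longleftrightarrow> x \<in> third y z \<and> vtype z = vtype y + 1"
  using triangles_rotate[of x y z] triangles_rotate[of y z x] triangles_rotate[of z x y]
    triangles_iff[of y z x] by blast

lemma triangles_iff3: "(x, y, z) \<in> triangles \<longleftrightarrow> y \<in> third z x \<and> vtype x = vtype z + 1"
  using triangles_rotate[of x y z] triangles_rotate[of y z x] triangles_rotate[of z x y]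
    triangles_iff[of z x y] by blast

lemma triangle_system_triangles:
  assumes "q \<ge> 2" and q: "\<And>v x. x \<in> nbrs v \<Longrightarrow> card (third v x) = q + 1"
  shows "triangle_system triangles q"
proof
  show "(y, z, x) \<in> triangles" if "(x, y, z) \<in> triangles" for x y z
    by (rule triangles_rotate[OF that])
  show "card {x'. (x', y, z) \<in> triangles} = q + 1" if "(x, y, z) \<in> triangles" for x y z
  proof -
    have "x \<in> third y z" "vtype z = vtype y + 1" using that triangles_iff2 by blast+
    then have "{x'. (x', y, z) \<in> triangles} = third y z" "z \<in> nbrs y"
      using triangles_iff2 third_nbrs by blast+
    with q show ?thesis by simp
  qed
  show "\<exists>!a. (a, y, z) \<in> triangles \<and> (a, y', z) \<in> triangles"
    if "(x, y, z) \<in> triangles" "(x', y', z) \<in> triangles" "y \<noteq> y'" for x y z x' y'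
  proof -
    have 1: "x \<in> third y z" "vtype z = vtype y + 1" "x' \<in> third y' z" "vtype z = vtype y' + 1"
      using that triangles_iff2 by blast+
    then have y: "y \<in> nbrs z" "y' \<in> nbrs z" "vtype y = vtype y'"
      using third_nbrs third_sym by (blast, blast, metis add_right_cancel)
    then have "\<exists>!a. a \<in> third z y \<and> a \<in> third z y'"
      using link_plane[OF nbrs_vertex(1)[OF y(1)]] that(3) by metis
    then show ?thesis using 1 by (simp add: triangles_iff2 third_sym[of _ z])
  qed
  show "\<exists>!b. (x, b, z) \<in> triangles \<and> (x', b, z) \<in> triangles"
    if "(x, y, z) \<in> triangles" "(x', y', z) \<in> triangles" "x \<noteq> x'" for x y z x' y'
  proof -
    have 1: "y \<in> third z x" "vtype x = vtype z + 1" "y' \<in> third z x'" "vtype x' = vtype z + 1"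
      using that triangles_iff3 by blast+
    then have x: "x \<in> nbrs z" "x' \<in> nbrs z" "vtype x = vtype x'"
      using third_nbrs by auto
    then have "\<exists>!b. b \<in> third z x \<and> b \<in> third z x'"
      using link_plane[OF nbrs_vertex(1)[OF x(1)]] that(3) by metis
    then show ?thesis using 1 by (simp add: triangles_iff3)
  qed
qed (rule assms(1))

lemma simplex_triangle:
  assumes "z \<in> third x y"
  obtains a b c where "(a, b, c) \<in> triangles" "vtype a = \<tau>" "{a, b, c} = {x, y, z}"
proof -
  define s where "s = {x, y, z}"
  have xyz: "x \<noteq> y" "y \<noteq> z" "x \<noteq> z" "{x, y, z} \<in> X" using assms by (auto simp: third_def)
  have "vtype x \<noteq> vtype y" "vtype z \<noteq> vtype x" "vtype z \<noteq> vtype y"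
    using assms third_nbrs third_sym vtype_nbrs by metis+
  then have inj: "inj_on vtype s" by (auto simp: s_def inj_on_def)
  have card: "card s = 3" using xyz by (simp add: s_def)
  have "card (vtype ` s) = card (UNIV :: 3 set)" using card_image[OF inj] card by simp
  then have "vtype ` s = UNIV" by (intro card_subset_eq) auto
  then have "\<exists>a\<in>s. vtype a = \<sigma>" for \<sigma> by (metis UNIV_I imageE)
  then obtain g where g: "\<And>\<sigma>. g \<sigma> \<in> s" "\<And>\<sigma>. vtype (g \<sigma>) = \<sigma>" by metis
  define a b c where "a = g \<tau>" and "b = g (\<tau> + 1)" and "c = g (\<tau> + 2)"
  have types: "vtype a = \<tau>" "vtype b = \<tau> + 1" "vtype c = \<tau> + 2" by (simp_all add: a_def b_def c_def g)
  then have ne: "a \<noteq> b" "b \<noteq> c" "a \<noteq> c" using type3_neq[of \<tau>] by metis+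
  then have abc: "{a, b, c} = s"
    using card g(1) by (intro card_subset_eq) (auto simp: s_def a_def b_def c_def)
  then have "(a, b, c) \<in> triangles"
    using ne types xyz by (auto simp: triangles_def third_def s_def)
  with types abc that show thesis by (simp add: s_def)
qed

lemma nbrs_third:
  assumes "x \<in> nbrs v"
  obtains y where "y \<in> third v x"
proof -
  obtain n where "card (third v x) = n" "n \<ge> 3"
    using link_plane[OF nbrs_vertex(1)[OF assms]] assms by metis
  then have "third v x \<noteq> {}" by auto
  with that show thesis by blast
qed

lemma vertex_triangle:
  assumes "v \<in> vertices X"
  obtains b c where "(v, b, c) \<in> triangles"
proof -
  obtain x where x: "x \<in> nbrs v" using link_plane[OF assms] by blast
  obtain y where "y \<in> third v x" using nbrs_third[OF x] .
  from simplex_triangle[OF this, of "vtype v"]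
  obtain a b c where abc: "(a, b, c) \<in> triangles" "vtype a = vtype v" "{a, b, c} = {v, x, y}" by metis
  then have "vtype b = vtype a + 1" "vtype c = vtype a + 2" by (auto simp: triangles_def)
  then have "v \<noteq> b" "v \<noteq> c" using abc(2) type3_neq by metis+
  moreover have "v \<in> {a, b, c}" using abc(3) by blast
  ultimately have "a = v" by blast
  with abc that show thesis by blast
qed

lemma triangle_vertices:
  assumes "(x, y, z) \<in> triangles"
  shows "x \<in> vertices X" "y \<in> vertices X" "z \<in> vertices X"
proof -
  have "{x, y, z} \<in> X" using assms by (auto simp: triangles_def third_def)
  then show "x \<in> vertices X" "y \<in> vertices X" "z \<in> vertices X"
    unfolding vertices_def by blast+
qed

lemma adjacent_rotate:
  assumes "((x, y, z), (x', y', z')) \<in> (triangle_system.adjacent triangles)\<^sup>*" and "triangle_system triangles q"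
  shows "((y, z, x), (y', z', x')) \<in> (triangle_system.adjacent triangles)\<^sup>*"
proof -
  interpret triangle_system triangles q by fact
  define \<rho> :: "'a \<times> 'a \<times> 'a \<Rightarrow> 'a \<times> 'a \<times> 'a" where "\<rho> = (\<lambda>(x, y, z). (y, z, x))"
  have step: "(\<rho> s, \<rho> t) \<in> adjacent" if "(s, t) \<in> adjacent" for s t
    using that rotate by (cases s; cases t) (auto simp: adjacent_def \<rho>_def)
  have "(\<rho> s, \<rho> t) \<in> adjacent\<^sup>*" if "(s, t) \<in> adjacent\<^sup>*" for s t
    using that by induction (auto intro: rtrancl_into_rtrancl step)
  from this[OF assms(1)] show ?thesis by (simp add: \<rho>_def)
qed

text \<open>Gallery connectedness: triangles at a common vertex are joined inside its link, and an
  edge of the building lies in a triangle that leads from the link of one end to that of the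
  other.\<close>

lemma adjacent_triangles:
  assumes ts: "triangle_system triangles q"
    and "(x, y, z) \<in> triangles" "(x', y', z') \<in> triangles" "vtype x = vtype x'"
  shows "((x, y, z), (x', y', z')) \<in> (triangle_system.adjacent triangles)\<^sup>*"
proof -
  interpret triangle_system triangles q by fact
  \<comment> \<open>A path of flags in the link of z: the lines y and y' meet in a, and (x, y), (a,
    y), (a, y'), (x', y') change one entry at a time.\<close>
  have last: "((x, y, z), (x', y', z)) \<in> adjacent\<^sup>*"
    if t: "(x, y, z) \<in> triangles" "(x', y', z) \<in> triangles" for x y z x' y'
  proof (cases "y = y'")
    case True
    then show ?thesis using t by (auto simp: adjacent_def)
  next
    case False
    then obtain a where a: "(a, y, z) \<in> triangles" "(a, y', z) \<in> triangles" using meet[OF t] by blast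
    then have "((x, y, z), (a, y, z)) \<in> adjacent" "((a, y, z), (a, y', z)) \<in> adjacent"
      "((a, y', z), (x', y', z)) \<in> adjacent" using t by (auto simp: adjacent_def)
    then show ?thesis by (meson rtrancl.rtrancl_into_rtrancl r_into_rtrancl)
  qed
  have first: "((x, y, z), (x, y', z')) \<in> adjacent\<^sup>*"
    if "(x, y, z) \<in> triangles" "(x, y', z') \<in> triangles" for x y z y' z'
    using adjacent_rotate[OF adjacent_rotate[OF last[OF rotate[OF that(1)] rotate[OF that(2)]] ts] ts] .
  have middle: "((x, y, z), (x', y, z')) \<in> adjacent\<^sup>*"
    if "(x, y, z) \<in> triangles" "(x', y, z') \<in> triangles" for x y z x' z'
    using adjacent_rotate[OF last[OF rotate[OF rotate[OF that(1)]] rotate[OF rotate[OF that(2)]]] ts] .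
  have share: "((a, b, c), (a', b', c')) \<in> adjacent\<^sup>*"
    if t: "(a, b, c) \<in> triangles" "(a', b', c') \<in> triangles" "vtype a = vtype a'"
      and w: "w \<in> {a, b, c}" "w \<in> {a', b', c'}" for a b c a' b' c' w
  proof -
    have types: "vtype b = vtype a + 1" "vtype c = vtype a + 2" "vtype b' = vtype a + 1" "vtype c' = vtype a + 2"
      using t by (auto simp: triangles_def)
    consider "w = a" "w = a'" | "w = b" "w = b'" | "w = c" "w = c'"
      using w types t(3) type3_neq[of "vtype a"] by (metis empty_iff insert_iff)
    then show ?thesis
    proof cases
      case 1 then show ?thesis using first t by blast
    next
      case 2 then show ?thesis using middle t by blast
    next
      case 3 then show ?thesis using last t by blast
    qed
  qed
  define S where "S = {w \<in> vertices X. \<forall>a b c. (a, b, c) \<in> triangles \<and> vtype a = vtype x \<and> w \<in> {a, b, c} \<longrightarrow>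
    ((x, y, z), (a, b, c)) \<in> adjacent\<^sup>*}"
  have "S = vertices X"
  proof (rule vertices_connected)
    have "((x, y, z), (a, b, c)) \<in> adjacent\<^sup>*"
      if "(a, b, c) \<in> triangles" "vtype a = vtype x" "x \<in> {a, b, c}" for a b c
      by (rule share[OF assms(2) that(1) that(2)[symmetric] _ that(3)]) simp
    then have "x \<in> S" using triangle_vertices[OF assms(2)] by (simp add: S_def)
    then show "S \<noteq> {}" by blast
    fix v w assume v: "v \<in> S" and w: "w \<in> nbrs v"
    obtain u where "u \<in> third v w" using nbrs_third[OF w] .
    from simplex_triangle[OF this, of "vtype x"]
    obtain a b c where abc: "(a, b, c) \<in> triangles" "vtype a = vtype x" "{a, b, c} = {v, w, u}" by metis
    have 1: "((x, y, z), (a, b, c)) \<in> adjacent\<^sup>*" using v abc by (auto simp: S_def)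
    have "((x, y, z), (a', b', c')) \<in> adjacent\<^sup>*"
      if "(a', b', c') \<in> triangles" "vtype a' = vtype x" "w \<in> {a', b', c'}" for a' b' c'
    proof -
      have "w \<in> {a, b, c}" using abc(3) by blast
      then have "((a, b, c), (a', b', c')) \<in> adjacent\<^sup>*"
        using share[OF abc(1) that(1)] abc(2) that by simp
      with 1 show ?thesis by (rule rtrancl_trans)
    qed
    then show "w \<in> S" using nbrs_vertex[OF w] by (simp add: S_def)
  qed (auto simp: S_def)
  then have "x' \<in> S" using triangle_vertices[OF assms(3)] by blast
  then show ?thesis using assms(3,4) by (simp add: S_def)
qed

lemma infinite_triangles:
  assumes "infinite (vertices X)"
  shows "infinite {t \<in> triangles. vtype (fst t) = \<tau>}"
proof
  assume fin: "finite {t \<in> triangles. vtype (fst t) = \<tau>}"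
  have "vertices X \<subseteq> (\<Union>(a, b, c)\<in>{t \<in> triangles. vtype (fst t) = \<tau>}. {a, b, c})"
  proof
    fix v assume "v \<in> vertices X"
    then obtain b c where "(v, b, c) \<in> triangles" by (rule vertex_triangle)
    then have "c \<in> third v b" by (simp add: triangles_iff)
    from simplex_triangle[OF this, of \<tau>]
    obtain a' b' c' where "(a', b', c') \<in> triangles" "vtype a' = \<tau>" "{a', b', c'} = {v, b, c}" by metis
    then show "v \<in> (\<Union>(a, b, c)\<in>{t \<in> triangles. vtype (fst t) = \<tau>}. {a, b, c})"
      by (intro UN_I[of "(a', b', c')"]) auto
  qed
  moreover have "finite (\<Union>(a, b, c)\<in>{t \<in> triangles. vtype (fst t) = \<tau>}. {a, b, c})"
    using fin by auto
  ultimately show False using assms finite_subset by blast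
qed

lemma infinite_triangle_system_triangles:
  assumes "infinite (vertices X)" and ts: "triangle_system triangles q"
  shows "infinite_triangle_system triangles q"
proof -
  interpret triangle_system triangles q by fact
  show ?thesis
  proof
    fix t assume t: "t \<in> triangles"
    have "{s \<in> triangles. vtype (fst s) = vtype (fst t)} \<subseteq> adjacent\<^sup>* `` {t}"
      using adjacent_triangles[OF ts] t by (cases t) auto
    with infinite_triangles[OF assms(1)] show "infinite (adjacent\<^sup>* `` {t})"
      using finite_subset by blast
  qed
qed

end

section \<open>Vanishing of the cohomology\<close>

lemma summable_complex_parts:
  fixes u :: "'b \<Rightarrow> complex"
  assumes "p > 1"
  shows "(\<lambda>x. norm (u x) powr p) summable_on A \<longleftrightarrow>
    (\<lambda>x. \<bar>Re (u x)\<bar> powr p) summable_on A \<and> (\<lambda>x. \<bar>Im (u x)\<bar> powr p) summable_on A"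
proof (intro iffI conjI)
  assume *: "(\<lambda>x. norm (u x) powr p) summable_on A"
  show "(\<lambda>x. \<bar>Re (u x)\<bar> powr p) summable_on A"
    by (rule summable_on_comparison_test[OF *]) (use assms abs_Re_le_cmod in \<open>auto intro: powr_mono2\<close>)
  show "(\<lambda>x. \<bar>Im (u x)\<bar> powr p) summable_on A"
    by (rule summable_on_comparison_test[OF *]) (use assms abs_Im_le_cmod in \<open>auto intro: powr_mono2\<close>)
next
  assume *: "(\<lambda>x. \<bar>Re (u x)\<bar> powr p) summable_on A \<and> (\<lambda>x. \<bar>Im (u x)\<bar> powr p) summable_on A"
  define C where "C = (1 / 2 :: real) powr (1 - p)"
  have "(\<lambda>x. C * \<bar>Re (u x)\<bar> powr p + C * \<bar>Im (u x)\<bar> powr p) summable_on A"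
    using * by (intro summable_on_add summable_on_cmult_right) auto
  moreover have "norm (u x) powr p \<le> C * \<bar>Re (u x)\<bar> powr p + C * \<bar>Im (u x)\<bar> powr p" for x
  proof -
    have "norm (u x) powr p \<le> \<bar>\<bar>Re (u x)\<bar> + \<bar>Im (u x)\<bar>\<bar> powr p"
      using assms cmod_le[of "u x"] by (intro powr_mono2) auto
    also have "\<dots> \<le> C * \<bar>Re (u x)\<bar> powr p + C * \<bar>Im (u x)\<bar> powr p"
      using powr_add_le[OF assms, of "1 / 2" "\<bar>Re (u x)\<bar>" "\<bar>Im (u x)\<bar>"] by (simp add: C_def)
    finally show ?thesis .
  qed
  ultimately show "(\<lambda>x. norm (u x) powr p) summable_on A"
    by (rule summable_on_comparison_test) auto
qed

lemma norm_diff_powr_le: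
  fixes a b :: complex
  assumes "p > 1"
  shows "norm (a - b) powr p \<le> (1 / 2) powr (1 - p) * norm a powr p + (1 / 2) powr (1 - p) * norm b powr p"
proof -
  have "norm (a - b) powr p \<le> \<bar>norm a + norm b\<bar> powr p"
    using assms norm_triangle_ineq4[of a b] by (intro powr_mono2) auto
  also have "\<dots> \<le> (1 / 2) powr (1 - p) * norm a powr p + (1 / 2) powr (1 - p) * norm b powr p"
    using powr_add_le[OF assms, of "1 / 2" "norm a" "norm b"] by simp
  finally show ?thesis .
qed

context locally_finite_building
begin

text \<open>An oriented edge is the first side of q + 1 typed triangles if its types increase by 1,
  and of none otherwise.\<close>

lemma summable_edges_triangles:
  fixes g :: "'a \<times> 'a \<Rightarrow> real"
  assumes "g summable_on oriented_edges X" "\<And>e. g e \<ge> 0"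
    and q: "\<And>v x. x \<in> nbrs v \<Longrightarrow> card (third v x) = q + 1"
  shows "(\<lambda>(x, y, z). g (x, y)) summable_on triangles"
proof -
  define A where "A = {(x, y) \<in> oriented_edges X. vtype y = vtype x + 1}"
  define B where "B = (\<lambda>(x, y). third x y)"
  have card: "card (B e) = q + 1" if "e \<in> A" for e
    using that q by (auto simp: A_def B_def nbrs_iff)
  have fin: "finite (B e)" if "e \<in> A" for e
    using card[OF that] by (intro card_ge_0_finite) simp
  have "g summable_on A"
    by (rule summable_on_subset_banach[OF assms(1)]) (auto simp: A_def)
  then have "(\<lambda>e. (real q + 1) * g e) summable_on A" by (rule summable_on_cmult_right)
  then have "(\<lambda>(e, z). g e) summable_on Sigma A B"
    by (rule summable_on_SigmaI[rotated])
      (use card fin assms(2) in \<open>auto intro!: has_sum_finiteI simp: algebra_simps\<close>)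
  moreover have "bij_betw (\<lambda>((x, y), z). (x, y, z)) (Sigma A B) triangles"
  proof (rule bij_betwI[where g = "\<lambda>(x, y, z). ((x, y), z)"])
    show "(\<lambda>(x, y, z). ((x, y), z)) \<in> triangles \<rightarrow> Sigma A B"
      using third_nbrs by (auto simp: triangles_iff A_def B_def simp flip: nbrs_iff)
  qed (auto simp: A_def B_def triangles_iff)
  ultimately show ?thesis
    using summable_on_reindex_bij_betw[of "\<lambda>((x, y), z). (x, y, z)" "Sigma A B" triangles
        "\<lambda>(x, y, z). g (x, y)"] by (simp add: case_prod_unfold)
qed

lemma real_potential:
  fixes h :: "'a \<Rightarrow> real"
  assumes inf: "infinite (vertices X)" and p: "p > 1"
    and h: "(\<lambda>(x, y). \<bar>h y - h x\<bar> powr p) summable_on oriented_edges X"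
  obtains c where "(\<lambda>x. \<bar>h x - c\<bar> powr p) summable_on vertices X"
proof -
  obtain q where "q \<ge> 2" and q: "\<And>v x. x \<in> nbrs v \<Longrightarrow> card (third v x) = q + 1"
    using building_order by blast
  then have ts: "triangle_system triangles q" by (intro triangle_system_triangles)
  interpret infinite_triangle_system triangles q
    by (rule infinite_triangle_system_triangles[OF inf ts])
  define v where "v = (\<lambda>(x :: 'a, y :: 'a, z :: 'a). h x)"
  \<comment> \<open>w does not depend on the first vertex, so \<open>T 0\<close> fixes it. Since v =
    d + w, the change of v under \<open>T 0\<close> equals that of d, which lies in l^p.\<close>
  define w where "w = (\<lambda>(x :: 'a, y :: 'a, z :: 'a). h y)"
  define d where "d = (\<lambda>(x :: 'a, y :: 'a, z :: 'a). h x - h y)"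
  have lpd: "lp p d"
  proof -
    have "(\<lambda>(x, y, z). \<bar>h y - h x\<bar> powr p) summable_on triangles"
      using summable_edges_triangles[OF h _ q] by (simp add: case_prod_unfold)
    then show ?thesis by (simp add: lp_def d_def case_prod_unfold abs_minus_commute)
  qed
  have "E 0 w = w"
    by (auto simp: fun_eq_iff E_0 avg_def w_def card_fiber')
  then have T0w: "T 0 w = w" by (simp add: T_fixed_iff)
  have "E 1 v = v"
  proof
    fix t show "E 1 v t = v t"
    proof (cases "t \<in> triangles")
      case True
      obtain x y z where t: "t = (x, y, z)" by (cases t)
      with True have "(y, z, x) \<in> triangles" using triangles_rotate by blast
      then show ?thesis by (simp add: t E_Suc E_0 avg_def v_def card_fiber')
    qed (simp add: E_outside)
  qed
  moreover have "E 2 v = v"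
  proof
    fix t show "E 2 v t = v t"
    proof (cases "t \<in> triangles")
      case True
      obtain x y z where t: "t = (x, y, z)" by (cases t)
      with True have "(z, x, y) \<in> triangles" using triangles_rotate by blast
      then show ?thesis by (simp add: t numeral_2_eq_2 E_Suc E_0 avg_def v_def card_fiber')
    qed (simp add: E_outside)
  qed
  ultimately have v12: "T 1 v = v" "T 2 v = v" by (simp_all only: T_fixed_iff)
  have "v = (\<lambda>t. d t + w t)" by (auto simp: v_def d_def w_def)
  then have "T 0 v = (\<lambda>t. T 0 d t + w t)" using averaging_add[OF averaging_T, of 0 d w] T0w by simp
  then have "T 0 v t - v t = T 0 d t - d t" for t
    by (simp add: \<open>v = (\<lambda>t. d t + w t)\<close>)
  then have "close p (T 0 v) v"
    using lp_diff[OF p lp_averaging[OF averaging_T p lpd] lpd] by (simp add: close_def)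
  then obtain g where g: "close p g v" "E 0 g = g" "E 1 g = g" "E 2 g = g"
    using exists_close_invariant[OF p v12] by blast
  have g_adj: "g s = g t" if "(s, t) \<in> adjacent\<^sup>*" for s t
    using that
  proof induction
    case (step t t')
    obtain i where "i < 3" "\<And>\<phi>. E i \<phi> t = E i \<phi> t'" using E_adjacent[OF step(2)] by blast
    moreover from this have "E i g = g" using g by (auto simp: less_Suc_eq numeral_3_eq_3 numeral_2_eq_2)
    ultimately have "g t = g t'" by metis
    with step show ?case by simp
  qed simp
  define r where "r \<tau> = (SOME t. t \<in> triangles \<and> vtype (fst t) = \<tau>)" for \<tau>
  define c where "c \<tau> = g (r \<tau>)" for \<tau>
  have gc: "g t = c (vtype (fst t))" if "t \<in> triangles" for t
  proof -
    have "r (vtype (fst t)) \<in> triangles \<and> vtype (fst (r (vtype (fst t)))) = vtype (fst t)"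
      unfolding r_def by (rule someI[where x = t]) (use that in simp)
    then have "(t, r (vtype (fst t))) \<in> adjacent\<^sup>*"
      using adjacent_triangles[OF ts] that
      by (cases t; cases "r (vtype (fst t))") auto
    then show ?thesis unfolding c_def by (rule g_adj)
  qed
  define k where "k = (\<lambda>(x :: 'a, y :: 'a, z :: 'a). h x - c (vtype x))"
  have lpk: "lp p k"
  proof (rule lp_le)
    show "lp p (\<lambda>t. g t - v t)" using g(1) by (simp add: close_def)
    show "\<bar>k t\<bar> \<le> \<bar>g t - v t\<bar>" if "t \<in> triangles" for t
      using gc[OF that] by (cases t) (simp add: k_def v_def)
  qed (use p in simp)
  \<comment> \<open>Invariance leaves one constant for each type of the first vertex. On triangles
    of first type \<tau> the l^p function m below equals c (\<tau> + 1) - c \<tau>, and there are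
    infinitely many of them.\<close>
  have c_Suc: "c (\<tau> + 1) = c \<tau>" for \<tau>
  proof (rule ccontr)
    assume ne: "c (\<tau> + 1) \<noteq> c \<tau>"
    define a where "a = \<bar>c (\<tau> + 1) - c \<tau>\<bar> powr p"
    have "a > 0" using ne by (simp add: a_def)
    define m where "m t = k t - rot k t - d t" for t
    have lpm: "lp p m"
      unfolding m_def[abs_def]
      by (rule lp_diff[OF p lp_diff[OF p lpk lp_averaging[OF averaging_rot p lpk]] lpd])
    have m: "\<bar>m t\<bar> powr p = a" if "t \<in> triangles" "vtype (fst t) = \<tau>" for t
      using that by (cases t) (simp add: m_def k_def d_def triangles_iff a_def)
    obtain n :: nat where n: "pow_sum p m / a < n" using reals_Archimedean2 by blast
    obtain F where F: "F \<subseteq> {t \<in> triangles. vtype (fst t) = \<tau>}" "finite F" "card F = n"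
      using infinite_arbitrarily_large[OF infinite_triangles[OF inf, of \<tau>], of n] by blast
    have "(\<Sum>t\<in>F. \<bar>m t\<bar> powr p) = (\<Sum>t\<in>F. a)"
      by (rule sum.cong[OF refl], rule m) (use F(1) in blast)+
    then have "n * a = (\<Sum>t\<in>F. \<bar>m t\<bar> powr p)" using F(3) by simp
    also have "\<dots> \<le> pow_sum p m" by (rule sum_le_pow_sum[OF lpm F(2)]) (use F in auto)
    also have "\<dots> < n * a" using n \<open>a > 0\<close> by (simp add: field_simps)
    finally show False by simp
  qed
  have c0: "c \<tau> = c 0" for \<tau>
  proof -
    have "c (0 + 1) = c 0" by (rule c_Suc)
    moreover have "c (0 + 2) = c (0 + 1)" using c_Suc[of "0 + 1"] unfolding type3_add(2) .
    ultimately show ?thesis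
      using type3_cases[of \<tau> 0] by (elim disjE) (simp_all only:)
  qed
  \<comment> \<open>One triangle with first vertex x for each vertex x: an injection along which the
    bound for k is restricted from triangles to vertices.\<close>
  define j where "j x = (SOME t. t \<in> triangles \<and> fst t = x)" for x
  have j: "j x \<in> triangles \<and> fst (j x) = x" if x: "x \<in> vertices X" for x
  proof -
    obtain b c where "(x, b, c) \<in> triangles" using vertex_triangle[OF x] .
    then have "\<exists>t. t \<in> triangles \<and> fst t = x" by (intro exI[of _ "(x, b, c)"]) simp
    then show ?thesis unfolding j_def by (rule someI_ex)
  qed
  have "(\<lambda>t. \<bar>k t\<bar> powr p) summable_on j ` vertices X"
    using lpk unfolding lp_def by (rule summable_on_subset_banach) (use j in blast)
  moreover have "inj_on j (vertices X)"
    by (rule inj_on_inverseI[of _ fst]) (rule conjunct2[OF j])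
  ultimately have "((\<lambda>t. \<bar>k t\<bar> powr p) \<circ> j) summable_on vertices X"
    by (simp only: summable_on_reindex)
  moreover have "((\<lambda>t. \<bar>k t\<bar> powr p) \<circ> j) x = \<bar>h x - c 0\<bar> powr p" if x: "x \<in> vertices X" for x
  proof -
    have "fst (j x) = x" using j[OF x] by (rule conjunct2)
    moreover have "k (j x) = h (fst (j x)) - c (vtype (fst (j x)))"
      by (simp add: k_def case_prod_unfold)
    ultimately have "k (j x) = h x - c (vtype x)" by simp
    then show ?thesis by (simp add: c0[of "vtype x"])
  qed
  ultimately have "(\<lambda>x. \<bar>h x - c 0\<bar> powr p) summable_on vertices X"
    by (rule summable_on_cong[THEN iffD1, rotated])
  then show thesis by (rule that)
qed

section \<open>Comparison of cocycles and coboundaries\<close>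

lemma lp_vertices_diff:
  assumes "p > 1" "f \<in> lp_vertices p X" "g \<in> lp_vertices p X"
  shows "f - g \<in> lp_vertices p X"
proof -
  have "(\<lambda>v. (1 / 2) powr (1 - p) * norm (f v) powr p + (1 / 2) powr (1 - p) * norm (g v) powr p)
      summable_on vertices X"
    using assms by (intro summable_on_add summable_on_cmult_right) (auto simp: lp_vertices_def)
  then have "(\<lambda>v. norm ((f - g) v) powr p) summable_on vertices X"
    by (rule summable_on_comparison_test) (use norm_diff_powr_le[OF assms(1)] in auto)
  then show ?thesis using assms by (auto simp: lp_vertices_def l0_vertices_def)
qed

lemma potential:
  assumes p: "p > 1" and f: "f \<in> l0_vertices X" "coboundary X f \<in> lp_edges p X"
  shows "coboundary X f \<in> lp_B1 p X"
proof -
  \<comment> \<open>Over a finite vertex set every function is summable; the spectral gap serves the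
    infinite case.\<close>
  have "\<exists>c. (\<lambda>x. norm (f x - c) powr p) summable_on vertices X"
  proof (cases "finite (vertices X)")
    case False
    have "(\<lambda>e. norm (coboundary X f e) powr p) summable_on oriented_edges X"
      using f by (simp add: lp_edges_def)
    then have "(\<lambda>e. norm (f (snd e) - f (fst e)) powr p) summable_on oriented_edges X"
      by (rule summable_on_cong[THEN iffD1, rotated]) (simp add: coboundary_def)
    then have parts: "(\<lambda>(x, y). \<bar>Re (f y) - Re (f x)\<bar> powr p) summable_on oriented_edges X"
      "(\<lambda>(x, y). \<bar>Im (f y) - Im (f x)\<bar> powr p) summable_on oriented_edges X"
      unfolding summable_complex_parts[OF p] by (simp_all add: case_prod_unfold)
    obtain a where "(\<lambda>x. \<bar>Re (f x) - a\<bar> powr p) summable_on vertices X"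
      by (rule real_potential[OF False p parts(1)])
    moreover obtain b where "(\<lambda>x. \<bar>Im (f x) - b\<bar> powr p) summable_on vertices X"
      by (rule real_potential[OF False p parts(2)])
    ultimately have "(\<lambda>x. norm (f x - Complex a b) powr p) summable_on vertices X"
      unfolding summable_complex_parts[OF p] by simp
    then show ?thesis by blast
  qed simp
  then obtain c where c: "(\<lambda>x. norm (f x - c) powr p) summable_on vertices X" by blast
  define g where "g x = (if x \<in> vertices X then f x - c else 0)" for x
  have "(\<lambda>x. norm (g x) powr p) summable_on vertices X"
    using c by (rule summable_on_cong[THEN iffD1, rotated]) (simp add: g_def)
  then have "g \<in> lp_vertices p X" by (auto simp: lp_vertices_def l0_vertices_def g_def)
  moreover have "coboundary X f = coboundary X g"
  proof
    fix e
    show "coboundary X f e = coboundary X g e"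
      by (cases e) (auto simp: coboundary_def g_def vertices_def oriented_edges_def)
  qed
  ultimately show ?thesis by (auto simp: lp_B1_def)
qed

text \<open>Local finiteness alone gives no uniform bound; the common order q does. Two adjacent
  neighbours x, y of v represent both types in the link, and every neighbour of v shares a neighbour
  there with the one of its own type, so it is within two steps of x or y.\<close>

lemma nbrs_bound:
  obtains N where "\<And>v. v \<in> vertices X \<Longrightarrow> finite (nbrs v) \<and> card (nbrs v) \<le> N"
proof -
  obtain q where "q \<ge> 2" and q: "\<And>v x. x \<in> nbrs v \<Longrightarrow> card (third v x) = q + 1"
    using building_order by blast
  have fin: "finite (third v x)" for v x
  proof (cases "x \<in> nbrs v")
    case True
    with q[OF True] show ?thesis by (intro card_ge_0_finite) simp
  next
    case False
    then show ?thesis using third_nbrs(2) by (metis ex_in_conv finite.emptyI)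
  qed
  have card: "card (third v x) \<le> q + 1" for v x
  proof (cases "x \<in> nbrs v")
    case False
    then have "third v x = {}" using third_nbrs(2) by blast
    then show ?thesis by simp
  qed (simp add: q)
  have "finite (nbrs v) \<and> card (nbrs v) \<le> (q + 1) * (q + 1) + (q + 1) * (q + 1)"
    if v: "v \<in> vertices X" for v
  proof -
    define W where "W x = (\<Union>y\<in>third v x. third v y)" for x
    have W: "finite (W x)" "card (W x) \<le> (q + 1) * (q + 1)" for x
    proof -
      show "finite (W x)" using fin by (simp add: W_def)
      have "card (W x) \<le> (\<Sum>y\<in>third v x. card (third v y))"
        unfolding W_def by (rule card_UN_le[OF fin])
      also have "\<dots> \<le> card (third v x) * (q + 1)"
        using sum_bounded_above[of "third v x" "\<lambda>y. card (third v y)" "q + 1"] card by simp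
      also have "\<dots> \<le> (q + 1) * (q + 1)" by (rule mult_le_mono1[OF card])
      finally show "card (W x) \<le> (q + 1) * (q + 1)" .
    qed
    obtain x where x: "x \<in> nbrs v" using link_plane[OF v] by blast
    obtain y where y: "y \<in> third v x" using nbrs_third[OF x] .
    have y': "y \<in> nbrs v" "vtype y \<noteq> vtype x"
      using third_nbrs(1)[OF y] vtype_nbrs[of y x] third_nbrs(1)[of y x v] y third_sym[of v x] by auto
    have "nbrs v \<subseteq> W x \<union> W y"
    proof
      fix u assume u: "u \<in> nbrs v"
      have same: "u \<in> W s" if s: "s \<in> nbrs v" "vtype s = vtype u" for s
      proof -
        have "\<exists>r. r \<in> third v s \<and> r \<in> third v u"
        proof (cases "s = u")
          case True
          then show ?thesis using nbrs_third[OF s(1)] by blast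
        next
          case False
          show ?thesis
            by (rule link_plane[OF v]) (use s u False in blast)
        qed
        then obtain r where r: "r \<in> third v s" "r \<in> third v u" by blast
        then have "u \<in> third v r" using third_sym[of v u] third_rotate[of r u v] by simp
        with r(1) show ?thesis unfolding W_def by (rule UN_I)
      qed
      have "vtype u = vtype x \<or> vtype u = vtype y"
        using vtype_nbrs[OF u] vtype_nbrs[OF x] vtype_nbrs[OF y'(1)] y'(2)
          type3_cases[of "vtype u" "vtype v"] type3_cases[of "vtype x" "vtype v"]
          type3_cases[of "vtype y" "vtype v"] by metis
      with same[OF x] same[OF y'(1)] show "u \<in> W x \<union> W y" by auto
    qed
    moreover have "card (W x \<union> W y) \<le> (q + 1) * (q + 1) + (q + 1) * (q + 1)"
      using card_Un_le[of "W x" "W y"] W(2)[of x] W(2)[of y] by linarith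
    moreover have "finite (W x \<union> W y)" using W(1) by simp
    ultimately show ?thesis
      using card_mono[of "W x \<union> W y" "nbrs v"] finite_subset[of "nbrs v" "W x \<union> W y"] by linarith
  qed
  then show thesis by (rule that)
qed

text \<open>Bounded degree makes the coboundary map l^p to l^p, so that the denominator of the
  quotient really lies in the numerator.\<close>

lemma coboundary_lp:
  assumes p: "p > 1" and f: "f \<in> lp_vertices p X"
  shows "coboundary X f \<in> lp_Z1 p X"
proof -
  obtain N where N: "\<And>v. v \<in> vertices X \<Longrightarrow> finite (nbrs v) \<and> card (nbrs v) \<le> N"
    using nbrs_bound by blast
  have fsum: "(\<lambda>v. norm (f v) powr p) summable_on vertices X" using f by (simp add: lp_vertices_def)
  have edges: "Sigma (vertices X) nbrs = oriented_edges X"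
    using nbrs_vertex by (auto simp flip: nbrs_iff)
  have "(\<lambda>v. real (card (nbrs v)) * norm (f v) powr p) summable_on vertices X"
    by (rule summable_on_comparison_test[OF summable_on_cmult_right[OF fsum, of "real N"]])
      (use N in \<open>auto intro!: mult_right_mono\<close>)
  then have 1: "(\<lambda>(v, w). norm (f v) powr p) summable_on oriented_edges X"
    unfolding edges[symmetric]
    by (rule summable_on_SigmaI[rotated]) (use N in \<open>auto intro!: has_sum_finiteI\<close>)
  have "bij_betw prod.swap (oriented_edges X) (oriented_edges X)"
    by (rule bij_betwI[where g = prod.swap]) (auto simp: nbrs_sym simp flip: nbrs_iff)
  from summable_on_reindex_bij_betw[OF this, of "\<lambda>(v, w). norm (f v) powr p"] 1
  have 2: "(\<lambda>(v, w). norm (f w) powr p) summable_on oriented_edges X"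
    by (simp add: case_prod_unfold)
  have "(\<lambda>(v, w). (1 / 2) powr (1 - p) * norm (f w) powr p + (1 / 2) powr (1 - p) * norm (f v) powr p)
      summable_on oriented_edges X"
    using summable_on_add[OF summable_on_cmult_right[OF 2, of "(1 / 2) powr (1 - p)"]
        summable_on_cmult_right[OF 1, of "(1 / 2) powr (1 - p)"]] by (simp add: case_prod_unfold)
  then have "(\<lambda>e. norm (coboundary X f e) powr p) summable_on oriented_edges X"
    by (rule summable_on_comparison_test)
      (use norm_diff_powr_le[OF p] in \<open>auto simp: coboundary_def\<close>)
  moreover have "coboundary X f \<in> l0_edges X"
    by (auto simp: l0_edges_def coboundary_def oriented_edges_def insert_commute)
  ultimately show ?thesis
    using f by (auto simp: lp_Z1_def lp_edges_def lp_vertices_def)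
qed

theorem lp_Z1_eq_lp_B1:
  assumes "p > 1"
  shows "lp_Z1 p X = lp_B1 p X"
proof
  show "lp_Z1 p X \<subseteq> lp_B1 p X" using potential[OF assms] by (auto simp: lp_Z1_def)
  show "lp_B1 p X \<subseteq> lp_Z1 p X" using coboundary_lp[OF assms] by (auto simp: lp_B1_def)
qed

end

theorem theorem3:
  fixes X :: "'a set set" and vtype :: "'a \<Rightarrow> 3" and p :: real
  assumes "A2_tilde_building X vtype"
    and "locally_finite X"
    and "1 < p"
  shows "lp_H1 p X = {lp_B1 p X}"
proof -
  interpret locally_finite_building X vtype
    using assms(1,2) by (simp add: locally_finite_building_def locally_finite_building_axioms_def)
  have diff: "\<omega> - \<eta> \<in> lp_B1 p X" if "\<omega> \<in> lp_B1 p X" "\<eta> \<in> lp_B1 p X" for \<omega> \<eta>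
  proof -
    obtain f g where fg: "f \<in> lp_vertices p X" "g \<in> lp_vertices p X"
      "\<omega> = coboundary X f" "\<eta> = coboundary X g" using \<open>\<omega> \<in> _\<close> \<open>\<eta> \<in> _\<close> by (auto simp: lp_B1_def)
    then have "\<omega> - \<eta> = coboundary X (f - g)" by (auto simp: coboundary_def fun_eq_iff)
    with lp_vertices_diff[OF assms(3) fg(1,2)] show ?thesis by (auto simp: lp_B1_def)
  qed
  \<comment> \<open>The quotient of an empty set would have no class at all, so an element is
    exhibited before the single class is identified.\<close>
  have "(\<lambda>_. 0) \<in> lp_vertices p X" by (simp add: lp_vertices_def l0_vertices_def)
  then have "lp_B1 p X \<noteq> {}" by (auto simp: lp_B1_def)
  moreover have "{(\<omega>, \<eta>). \<omega> \<in> lp_B1 p X \<and> \<eta> \<in> lp_B1 p X \<and> \<omega> - \<eta> \<in> lp_B1 p X} = lp_B1 p X \<times> lp_B1 p X"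
    using diff by auto
  ultimately show ?thesis
    unfolding lp_H1_def lp_Z1_eq_lp_B1[OF assms(3)] by (auto simp: quotient_def)
qed

end
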